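(* For given $f\in L^2(I;L^2(\Omega))$, $u_0\in L^2(\Omega)$ and $q\in\mathcal{M}(\bar I_c;L^2(\omega))$, let $u_\sigma(q)\in Y_\sigma$ solve $$A(u_\sigma(q),v_\sigma)=\int_I(f,v_\sigma)\,dt+\langle q,v_\sigma\rangle_{\bar I_c\times\omega}+(u_0,v_\sigma(0))\quad\forall v_\sigma\in P_\sigma.$$ Then $$\|\nabla u_\sigma(q)\|_{L^2(I;L^2(\Omega))}+\|u_\sigma(q)(T)\|_{L^2(\Omega)}\le C\big(\|f\|_{L^2(I;L^2(\Omega))}+\|q\|_{\mathcal{M}(\bar I_c;L^2(\omega))}+\|u_0\|_{L^2(\Omega)}\big),$$ where $C>0$ is a constant independent of $\sigma=(\tau,h)$.
   Context: $\Omega\subset\mathbb{R}^d$ ($d=2,3$) is a convex polyhedron; $T>0$, $I=(0,T)$; $\omega\subset\Omega$ (polygonal) and $I_c\subset\subset I$ (an open interval relatively compact in $I$) are the control domains; $(\cdot,\cdot)$ is the $L^2(\Omega)$ inner product. $\mathcal{M}(\bar I_c;L^2(\omega))$ is the space of countably additive $L^2(\omega)$-valued measures on the Borel sets of $\bar I_c$ with bounded total variation, normed by total variation and identified with the dual of $C(\bar I_c;L^2(\omega))$, with pairing $\langle\cdot,\cdot\rangle_{\bar I_c\times\omega}$. Discretization: $\{\mathcal{T}_h\}_{h>0}$ is a family of quasi-uniform, shape regular triangulations of $\Omega$ with mesh parameter $h$, whose restriction to $\omega$ is a partition of $\omega$; $V_h=\{v_h\in H_0^1(\Omega): v_h|_K\in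 P_1(K)\ \forall K\in\mathcal{T}_h\}$. Time grid $0=t_0<t_1<\dots<t_M=T$, $I_m=(t_{m-1},t_m]$ for $m<M$, $I_M=(t_{M-1},t_M)$, $\tau=\max_m(t_m-t_{m-1})$, such that $\bar I_c=[t_{k_1-1},t_{k_2}]$ for some $1<k_1<k_2<M$. With $\mathcal{P}_i(I_m;V_h)$ the $V_h$-valued polynomials in $t$ of degree at most $i$ on $I_m$, $$P_\sigma=\{v\in C(\bar I;H_0^1(\Omega)): v|_{I_m}\in\mathcal{P}_1(I_m;V_h),\ 1\le m\le M\},$$ $$Y_\sigma=\{v\in L^2(I;H_0^1(\Omega)): v|_{I_m}\in\mathcal{P}_0(I_m;V_h),\ 1\le m\le M,\ v(T)\in V_h\},$$ where the value $v(T)$ is an additional independent degree of freedom. The bilinear form is $$A(u,v)=-\int_I\langle u,\partial_tv\rangle dt+\int_I(\nabla u,\nabla v)dt+(u(T),v(T)).$$ *)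

theory Defs
  imports "HOL-Analysis.Analysis"
begin

text \<open>
  Elements of \<open>L\<^sup>2(S)\<close> and of the Sobolev spaces are represented by functions on the whole space; only
  their values on \<open>S\<close>, up to Lebesgue null sets, are relevant.
\<close>

section \<open>Square integrable functions\<close>

definition Ltwo :: "'a::euclidean_space set \<Rightarrow> ('a \<Rightarrow> 'b::euclidean_space) set" where
  "Ltwo S = {f. f \<in> borel_measurable (lebesgue_on S) \<and> integrable (lebesgue_on S) (\<lambda>x. (norm (f x))\<^sup>2)}"

definition l2inner :: "'a::euclidean_space set \<Rightarrow> ('a \<Rightarrow> 'b::euclidean_space) \<Rightarrow> ('a \<Rightarrow> 'b) \<Rightarrow> real" where
  "l2inner S f g = integral\<^sup>L (lebesgue_on S) (\<lambda>x. f x \<bullet> g x)"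

definition l2norm :: "'a::euclidean_space set \<Rightarrow> ('a \<Rightarrow> 'b::euclidean_space) \<Rightarrow> real" where
  "l2norm S f = sqrt (integral\<^sup>L (lebesgue_on S) (\<lambda>x. (norm (f x))\<^sup>2))"


section \<open>Weak gradients and the space \<open>H\<^sub>0\<^sup>1\<close>\<close>

text \<open>Coinductively: all iterated partial derivatives exist and are (Frechet) differentiable.\<close>

coinductive smooth_fun :: "('a::euclidean_space \<Rightarrow> real) \<Rightarrow> bool" where
  "\<lbrakk>\<And>x. \<phi> differentiable (at x); \<And>b. b \<in> Basis \<Longrightarrow> smooth_fun (\<lambda>x. frechet_derivative \<phi> (at x) b)\<rbrakk>
    \<Longrightarrow> smooth_fun \<phi>"

definition test_funs :: "'a::euclidean_space set \<Rightarrow> ('a \<Rightarrow> real) set" where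
  "test_funs \<Omega> = {\<phi>. smooth_fun \<phi> \<and> compact (closure {x. \<phi> x \<noteq> 0}) \<and> closure {x. \<phi> x \<noteq> 0} \<subseteq> \<Omega>}"

definition is_weak_grad :: "'a::euclidean_space set \<Rightarrow> ('a \<Rightarrow> real) \<Rightarrow> ('a \<Rightarrow> 'a) \<Rightarrow> bool" where
  "is_weak_grad \<Omega> v G \<longleftrightarrow>
     (\<forall>\<phi>\<in>test_funs \<Omega>. \<forall>b\<in>Basis.
        integral\<^sup>L (lebesgue_on \<Omega>) (\<lambda>x. v x * frechet_derivative \<phi> (at x) b)
          = - integral\<^sup>L (lebesgue_on \<Omega>) (\<lambda>x. (G x \<bullet> b) * \<phi> x))"

definition Hone :: "'a::euclidean_space set \<Rightarrow> ('a \<Rightarrow> real) set" where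
  "Hone \<Omega> = {v \<in> Ltwo \<Omega>. \<exists>G \<in> Ltwo \<Omega>. is_weak_grad \<Omega> v G}"

text \<open>A representative of the weak gradient, which is unique up to null sets.\<close>

definition wgrad :: "'a::euclidean_space set \<Rightarrow> ('a \<Rightarrow> real) \<Rightarrow> 'a \<Rightarrow> 'a" where
  "wgrad \<Omega> v = (SOME G. G \<in> Ltwo \<Omega> \<and> is_weak_grad \<Omega> v G)"

definition h1norm :: "'a::euclidean_space set \<Rightarrow> ('a \<Rightarrow> real) \<Rightarrow> real" where
  "h1norm \<Omega> v = sqrt ((l2norm \<Omega> v)\<^sup>2 + (l2norm \<Omega> (wgrad \<Omega> v))\<^sup>2)"

definition Hone0 :: "'a::euclidean_space set \<Rightarrow> ('a \<Rightarrow> real) set" where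
  "Hone0 \<Omega> = {v \<in> Hone \<Omega>. \<exists>\<phi> :: nat \<Rightarrow> 'a \<Rightarrow> real.
      (\<forall>n. \<phi> n \<in> test_funs \<Omega>) \<and> (\<lambda>n. h1norm \<Omega> (\<lambda>x. v x - \<phi> n x)) \<longlonglongrightarrow> 0}"


section \<open>Bochner spaces over a time interval\<close>

text \<open>
  \<open>L\<^sup>2(J; X)\<close> for a space \<open>X\<close> of functions with norm \<open>N\<close>: functions that are almost everywhere limits,
  with respect to \<open>N\<close>, of \<open>X\<close>-valued simple functions and whose norm is square integrable.
\<close>

definition bochner_L2 :: "real set \<Rightarrow> ('a \<Rightarrow> real) set \<Rightarrow> (('a \<Rightarrow> real) \<Rightarrow> real) \<Rightarrow> (real \<Rightarrow> 'a \<Rightarrow> real) set" where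
  "bochner_L2 J X N = {f.
      (AE t in lebesgue_on J. f t \<in> X) \<and>
      (\<exists>s :: nat \<Rightarrow> real \<Rightarrow> 'a \<Rightarrow> real.
         (\<forall>n. finite (s n ` J) \<and> s n ` J \<subseteq> X \<and> (\<forall>w. {t \<in> J. s n t = w} \<in> sets lebesgue)) \<and>
         (AE t in lebesgue_on J. (\<lambda>n. N (\<lambda>x. s n t x - f t x)) \<longlonglongrightarrow> 0)) \<and>
      integrable (lebesgue_on J) (\<lambda>t. (N (f t))\<^sup>2)}"

definition bochner_norm :: "real set \<Rightarrow> (('a \<Rightarrow> 'b) \<Rightarrow> real) \<Rightarrow> (real \<Rightarrow> 'a \<Rightarrow> 'b) \<Rightarrow> real" where
  "bochner_norm J N f = sqrt (integral\<^sup>L (lebesgue_on J) (\<lambda>t. (N (f t))\<^sup>2))"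


section \<open>Measures with values in \<open>L\<^sup>2(\<omega>)\<close>\<close>

definition borel_partition :: "real set \<Rightarrow> real set set \<Rightarrow> bool" where
  "borel_partition J P \<longleftrightarrow> finite P \<and> partition_on J P \<and> P \<subseteq> sets borel"

definition total_variation :: "real set \<Rightarrow> 'a::euclidean_space set \<Rightarrow> (real set \<Rightarrow> 'a \<Rightarrow> real) \<Rightarrow> real" where
  "total_variation J \<omega> q = (SUP P\<in>{P. borel_partition J P}. \<Sum>E\<in>P. l2norm \<omega> (q E))"

text \<open>Countable additivity is convergence of the series in the norm of \<open>L\<^sup>2(\<omega>)\<close>.\<close>

definition vector_measures :: "real set \<Rightarrow> 'a::euclidean_space set \<Rightarrow> (real set \<Rightarrow> 'a \<Rightarrow> real) set" where
  "vector_measures J \<omega> = {q.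
      (\<forall>E\<in>sets borel. E \<subseteq> J \<longrightarrow> q E \<in> Ltwo \<omega>) \<and>
      (\<forall>A :: nat \<Rightarrow> real set. range A \<subseteq> sets borel \<longrightarrow> (\<forall>i. A i \<subseteq> J) \<longrightarrow> disjoint_family A \<longrightarrow>
         (\<lambda>n. l2norm \<omega> (\<lambda>x. q (\<Union>i. A i) x - (\<Sum>i<n. q (A i) x))) \<longlonglongrightarrow> 0) \<and>
      bdd_above ((\<lambda>P. \<Sum>E\<in>P. l2norm \<omega> (q E)) ` {P. borel_partition J P})}"

text \<open>
  The integral of a continuous \<open>L\<^sup>2(\<omega>)\<close>-valued function \<open>\<phi>\<close> on the compact interval \<open>J\<close> against \<open>q\<close>,
  as the limit of the sums \<open>\<Sum>E. (\<phi>(\<xi>\<^sub>E), q(E))\<close> over tagged Borel partitions whose mesh tends to zero.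
\<close>

definition has_pairing ::
  "real set \<Rightarrow> 'a::euclidean_space set \<Rightarrow> (real set \<Rightarrow> 'a \<Rightarrow> real) \<Rightarrow> (real \<Rightarrow> 'a \<Rightarrow> real) \<Rightarrow> real \<Rightarrow> bool" where
  "has_pairing J \<omega> q \<phi> r \<longleftrightarrow>
     (\<forall>\<epsilon>>0. \<exists>\<delta>>0. \<forall>P \<xi>. borel_partition J P \<and> (\<forall>E\<in>P. \<xi> E \<in> E \<and> diameter E < \<delta>) \<longrightarrow>
        \<bar>(\<Sum>E\<in>P. l2inner \<omega> (\<phi> (\<xi> E)) (q E)) - r\<bar> < \<epsilon>)"

definition pairing ::
  "real set \<Rightarrow> 'a::euclidean_space set \<Rightarrow> (real set \<Rightarrow> 'a \<Rightarrow> real) \<Rightarrow> (real \<Rightarrow> 'a \<Rightarrow> real) \<Rightarrow> real" where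
  "pairing J \<omega> q \<phi> = (THE r. has_pairing J \<omega> q \<phi> r)"


section \<open>Domains and triangulations\<close>

definition convex_polyhedral_domain :: "'a::euclidean_space set \<Rightarrow> bool" where
  "convex_polyhedral_domain \<Omega> \<longleftrightarrow> open \<Omega> \<and> convex \<Omega> \<and> \<Omega> \<noteq> {} \<and> polytope (closure \<Omega>)"

text \<open>The set need not be convex or connected; its boundary consists of finitely many polytopes.\<close>

definition polygonal_domain :: "'a::euclidean_space set \<Rightarrow> bool" where
  "polygonal_domain \<omega> \<longleftrightarrow> open \<omega> \<and> bounded \<omega> \<and> \<omega> \<noteq> {} \<and>
     (\<exists>P. finite P \<and> (\<forall>F\<in>P. polytope F) \<and> frontier \<omega> = \<Union>P)"

definition inball_diameter :: "'a::euclidean_space set \<Rightarrow> real" where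
  "inball_diameter K = Sup {2 * r | r. r > 0 \<and> (\<exists>x. cball x r \<subseteq> K)}"

definition mesh_of :: "'a::euclidean_space set \<Rightarrow> real \<Rightarrow> 'a set set \<Rightarrow> bool" where
  "mesh_of \<Omega> h \<T> \<longleftrightarrow> triangulation \<T> \<and> (\<forall>K\<in>\<T>. int DIM('a) simplex K) \<and> \<Union>\<T> = closure \<Omega> \<and>
     h = Max (diameter ` \<T>)"

text \<open>
  A bounded domain has no triangulation of large mesh size, so the family is indexed by a set \<open>H\<close> of
  positive mesh sizes rather than by all positive reals.
\<close>

definition mesh_family :: "'a::euclidean_space set \<Rightarrow> 'a set \<Rightarrow> real set \<Rightarrow> (real \<Rightarrow> 'a set set) \<Rightarrow> bool" where
  "mesh_family \<Omega> \<omega> H \<T> \<longleftrightarrow> H \<subseteq> {0<..} \<and>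
     (\<forall>h\<in>H. mesh_of \<Omega> h (\<T> h)) \<and>
     (\<forall>h\<in>H. \<Union>{K \<in> \<T> h. K \<subseteq> closure \<omega>} = closure \<omega>) \<and>
     (\<exists>c>0. \<forall>h\<in>H. \<forall>K\<in>\<T> h. h \<le> c * diameter K) \<and>
     (\<exists>\<kappa>>0. \<forall>h\<in>H. \<forall>K\<in>\<T> h. diameter K \<le> \<kappa> * inball_diameter K)"

text \<open>The elements \<open>K\<close> are closed, so that the condition selects the continuous representative of \<open>v\<close>.\<close>

definition fe_space :: "'a::euclidean_space set \<Rightarrow> 'a set set \<Rightarrow> ('a \<Rightarrow> real) set" where
  "fe_space \<Omega> \<T> = {v \<in> Hone0 \<Omega>. \<forall>K\<in>\<T>. \<exists>\<alpha> \<beta>. \<forall>x\<in>K. v x = \<alpha> + \<beta> \<bullet> x}"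


section \<open>Space-time discretization\<close>

definition time_grid :: "real \<Rightarrow> real \<Rightarrow> real \<Rightarrow> nat \<Rightarrow> (nat \<Rightarrow> real) \<Rightarrow> real \<Rightarrow> bool" where
  "time_grid T a b M t \<tau> \<longleftrightarrow> t 0 = 0 \<and> t M = T \<and> (\<forall>m\<in>{1..M}. t (m - 1) < t m) \<and>
     \<tau> = Max ((\<lambda>m. t m - t (m - 1)) ` {1..M}) \<and>
     (\<exists>k1 k2. 1 < k1 \<and> k1 < k2 \<and> k2 < M \<and> {a..b} = {t (k1 - 1)..t k2})"

definition time_cell :: "nat \<Rightarrow> (nat \<Rightarrow> real) \<Rightarrow> nat \<Rightarrow> real set" where
  "time_cell M t m = (if m < M then {t (m - 1)<..t m} else {t (m - 1)<..<t m})"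

definition time_poly ::
  "'a::euclidean_space set \<Rightarrow> nat \<Rightarrow> real set \<Rightarrow> ('a \<Rightarrow> real) set \<Rightarrow> (real \<Rightarrow> 'a \<Rightarrow> real) \<Rightarrow> bool" where
  "time_poly \<Omega> i J V v \<longleftrightarrow>
     (\<exists>c :: nat \<Rightarrow> 'a \<Rightarrow> real. (\<forall>j\<le>i. c j \<in> V) \<and> (\<forall>s\<in>J. \<forall>x\<in>\<Omega>. v s x = (\<Sum>j\<le>i. s ^ j * c j x)))"

definition P_space ::
  "'a::euclidean_space set \<Rightarrow> real \<Rightarrow> 'a set set \<Rightarrow> nat \<Rightarrow> (nat \<Rightarrow> real) \<Rightarrow> (real \<Rightarrow> 'a \<Rightarrow> real) set" where
  "P_space \<Omega> T \<T> M t = {v.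
     (\<forall>s\<in>{0..T}. v s \<in> Hone0 \<Omega> \<and>
        ((\<lambda>r. h1norm \<Omega> (\<lambda>x. v r x - v s x)) \<longlongrightarrow> 0) (at s within {0..T})) \<and>
     (\<forall>m\<in>{1..M}. time_poly \<Omega> 1 (time_cell M t m) (fe_space \<Omega> \<T>) v)}"

text \<open>No time cell contains \<open>T\<close>, so \<open>v T\<close> is an independent degree of freedom.\<close>

definition Y_space ::
  "'a::euclidean_space set \<Rightarrow> real \<Rightarrow> 'a set set \<Rightarrow> nat \<Rightarrow> (nat \<Rightarrow> real) \<Rightarrow> (real \<Rightarrow> 'a \<Rightarrow> real) set" where
  "Y_space \<Omega> T \<T> M t = {v \<in> bochner_L2 {0<..<T} (Hone0 \<Omega>) (h1norm \<Omega>).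
     (\<forall>m\<in>{1..M}. time_poly \<Omega> 0 (time_cell M t m) (fe_space \<Omega> \<T>) v) \<and> v T \<in> fe_space \<Omega> \<T>}"

text \<open>
  The functions in the second argument are piecewise polynomial in time, so the time derivative is
  taken pointwise (away from the grid points); the duality product of \<open>H\<^sub>0\<^sup>1\<close> with its dual is then the
  \<open>L\<^sup>2\<close> inner product.
\<close>

definition A_form ::
  "'a::euclidean_space set \<Rightarrow> real \<Rightarrow> (real \<Rightarrow> 'a \<Rightarrow> real) \<Rightarrow> (real \<Rightarrow> 'a \<Rightarrow> real) \<Rightarrow> real" where
  "A_form \<Omega> T u v =
     - integral\<^sup>L (lebesgue_on {0<..<T}) (\<lambda>s. l2inner \<Omega> (u s) (\<lambda>x. deriv (\<lambda>r. v r x) s))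
     + integral\<^sup>L (lebesgue_on {0<..<T}) (\<lambda>s. l2inner \<Omega> (wgrad \<Omega> (u s)) (wgrad \<Omega> (v s)))
     + l2inner \<Omega> (u T) (v T)"

end

theory Submission
  imports Defs
begin

text \<open>
  The estimate is proved by duality. Let \<open>U\<^sub>m\<close> be the value of \<open>u\<close> on the \<open>m\<close>-th time cell and \<open>\<tau>\<^sub>m\<close> the
  length of that cell. The equation cannot be tested with \<open>u\<close> itself, since trial functions jump in time
  and test functions are continuous. Instead one constructs a test function \<open>v\<close> for which \<open>A(u, v) = E\<^sup>2\<close>, where
  \<open>E\<^sup>2 = \<parallel>\<nabla>u\<parallel>\<^sup>2 + \<parallel>u(T)\<parallel>\<^sup>2\<close>, and which satisfies \<open>\<parallel>v(s)\<parallel> \<le> E\<close> at every time \<open>s\<close>. The right-hand side of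
  the discrete equation is then at most \<open>E (\<surd>T \<parallel>f\<parallel> + \<parallel>q\<parallel> + \<parallel>u\<^sub>0\<parallel>)\<close>, and division by \<open>E\<close> gives the claim,
  with a constant that depends on \<open>T\<close> only.

  The function \<open>v\<close> is the continuous piecewise linear interpolant of nodal values \<open>V\<^sub>m\<close> given by the
  Crank--Nicolson scheme that runs backwards in time from \<open>V\<^sub>M = u(T)\<close>:
  \<open>(V\<^sub>m\<^sub>-\<^sub>1 - V\<^sub>m, w) + \<tau>\<^sub>m / 2 (\<nabla>V\<^sub>m\<^sub>-\<^sub>1 + \<nabla>V\<^sub>m, \<nabla>w) = \<tau>\<^sub>m (\<nabla>U\<^sub>m, \<nabla>w)\<close> for all \<open>w \<in> V\<^sub>h\<close>.
  Taking \<open>w = U\<^sub>m\<close> and summing over \<open>m\<close> gives \<open>A(u, v) = E\<^sup>2\<close> (\<open>A_form_interp\<close>, where the integral over a cell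
  of the linear function \<open>(\<nabla>U\<^sub>m, \<nabla>v)\<close> is its midpoint value times \<open>\<tau>\<^sub>m\<close>). Taking \<open>w = V\<^sub>m\<^sub>-\<^sub>1 + V\<^sub>m\<close> and
  using Young's inequality gives \<open>\<parallel>V\<^sub>m\<^sub>-\<^sub>1\<parallel>\<^sup>2 \<le> \<parallel>V\<^sub>m\<parallel>\<^sup>2 + \<tau>\<^sub>m \<parallel>\<nabla>U\<^sub>m\<parallel>\<^sup>2\<close>, hence \<open>\<parallel>V\<^sub>m\<parallel> \<le> E\<close>
  (\<open>Crank_Nicolson_stable\<close>).

  Three foundations carry this argument. The gradient of a Sobolev function is a chosen representative,
  and it is linear only because weak gradients are unique up to null sets (\<open>weak_grad_unique\<close>); this
  rests on the fundamental lemma of the calculus of variations and thus on smooth bump functions. The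
  scheme is solvable because a function of \<open>V\<^sub>h\<close> is determined by its values at the vertices of the mesh
  (\<open>riesz_on_finitely_determined_space\<close>). Finally, the pairing with the vector measure \<open>q\<close> is a limit
  over tagged partitions, which exists for Lipschitz continuous functions and obeys
  \<open>\<bar>\<langle>q, v\<rangle>\<bar> \<le> sup \<parallel>v\<parallel> \<parallel>q\<parallel>\<close> (\<open>pairing_bound\<close>).
\<close>

section \<open>The inner product of \<open>L\<^sup>2\<close>\<close>

lemma Ltwo_inner_integrable:
  assumes "f \<in> Ltwo S" "g \<in> Ltwo S"
  shows "integrable (lebesgue_on S) (\<lambda>x. f x \<bullet> g x)"
proof (rule Bochner_Integration.integrable_bound)
  show "integrable (lebesgue_on S) (\<lambda>x. (norm (f x))\<^sup>2 + (norm (g x))\<^sup>2)"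
    using assms by (auto simp: Ltwo_def)
  show "(\<lambda>x. f x \<bullet> g x) \<in> borel_measurable (lebesgue_on S)"
    using assms by (auto simp: Ltwo_def)
  have "\<bar>f x \<bullet> g x\<bar> \<le> (norm (f x))\<^sup>2 + (norm (g x))\<^sup>2" for x
  proof -
    have "\<bar>f x \<bullet> g x\<bar> \<le> norm (f x) * norm (g x)" by (rule Cauchy_Schwarz_ineq2)
    moreover have "2 * (norm (f x) * norm (g x)) \<le> (norm (f x))\<^sup>2 + (norm (g x))\<^sup>2"
      using sum_squares_bound[of "norm (f x)" "norm (g x)"] by simp
    moreover have "0 \<le> norm (f x) * norm (g x)" by simp
    ultimately show ?thesis by linarith
  qed
  then show "AE x in lebesgue_on S. norm (f x \<bullet> g x) \<le> norm ((norm (f x))\<^sup>2 + (norm (g x))\<^sup>2)"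
    by simp
qed

lemma Ltwo_scaleR_add:
  assumes "f \<in> Ltwo S" "g \<in> Ltwo S"
  shows "(\<lambda>x. c *\<^sub>R f x + d *\<^sub>R g x) \<in> Ltwo S"
proof -
  have "integrable (lebesgue_on S)
    (\<lambda>x. c\<^sup>2 * (f x \<bullet> f x) + 2 * c * d * (f x \<bullet> g x) + d\<^sup>2 * (g x \<bullet> g x))"
    using assms by (intro Bochner_Integration.integrable_add integrable_mult_right Ltwo_inner_integrable)
  moreover have "(norm (c *\<^sub>R f x + d *\<^sub>R g x))\<^sup>2 =
      c\<^sup>2 * (f x \<bullet> f x) + 2 * c * d * (f x \<bullet> g x) + d\<^sup>2 * (g x \<bullet> g x)" for x
    unfolding power2_norm_eq_inner
    by (simp add: inner_add_left inner_add_right algebra_simps inner_commute power2_eq_square)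
  ultimately show ?thesis using assms by (auto simp: Ltwo_def)
qed

lemma Ltwo_lincomb:
  fixes f g :: "'a::euclidean_space \<Rightarrow> real"
  assumes "f \<in> Ltwo S" "g \<in> Ltwo S"
  shows "(\<lambda>x. c * f x + d * g x) \<in> Ltwo S"
  using Ltwo_scaleR_add[OF assms, of c d] by simp

lemma Ltwo_zero: "(\<lambda>x. 0) \<in> Ltwo S"
  by (simp add: Ltwo_def)

lemma Ltwo_scale:
  fixes f :: "'a::euclidean_space \<Rightarrow> real"
  shows "f \<in> Ltwo S \<Longrightarrow> (\<lambda>x. c * f x) \<in> Ltwo S"
  using Ltwo_lincomb[of f S f c 0] by simp

lemma Ltwo_add:
  "f \<in> Ltwo S \<Longrightarrow> g \<in> Ltwo S \<Longrightarrow> (\<lambda>x. f x + g x) \<in> Ltwo S"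
  using Ltwo_scaleR_add[of f S g 1 1] by simp

lemma Ltwo_diff:
  "f \<in> Ltwo S \<Longrightarrow> g \<in> Ltwo S \<Longrightarrow> (\<lambda>x. f x - g x) \<in> Ltwo S"
  using Ltwo_scaleR_add[of f S g 1 "-1"] by simp

lemma Ltwo_sum:
  assumes "\<And>i. i \<in> I \<Longrightarrow> f i \<in> Ltwo S"
  shows "(\<lambda>x. \<Sum>i\<in>I. f i x) \<in> Ltwo S"
  using assms by (induction I rule: infinite_finite_induct) (auto intro: Ltwo_zero Ltwo_add)

lemma l2inner_commute: "l2inner S f g = l2inner S g f"
  by (simp add: l2inner_def inner_commute)

lemma l2inner_AE_cong:
  assumes "f \<in> Ltwo S" "f' \<in> Ltwo S" "g \<in> Ltwo S" "g' \<in> Ltwo S"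
    and "AE x in lebesgue_on S. f x = f' x" "AE x in lebesgue_on S. g x = g' x"
  shows "l2inner S f g = l2inner S f' g'"
  unfolding l2inner_def
  using assms by (intro integral_cong_AE) (auto simp: Ltwo_def)

lemma l2norm_eq_sqrt_inner: "l2norm S f = sqrt (l2inner S f f)"
  by (simp add: l2norm_def l2inner_def power2_norm_eq_inner)

lemma l2inner_cong:
  assumes "\<And>x. x \<in> S \<Longrightarrow> f x = f' x" "\<And>x. x \<in> S \<Longrightarrow> g x = g' x"
  shows "l2inner S f g = l2inner S f' g'"
  unfolding l2inner_def by (intro Bochner_Integration.integral_cong) (auto simp: assms)

lemma l2norm_nonneg [simp]: "0 \<le> l2norm S f"
  by (simp add: l2norm_def)

lemma l2norm_sq: "(l2norm S f)\<^sup>2 = l2inner S f f"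
  by (simp add: l2norm_def l2inner_def power2_norm_eq_inner)

lemma l2inner_self_nonneg [simp]: "0 \<le> l2inner S f f"
  using l2norm_sq[of S f] zero_le_power2[of "l2norm S f"] by simp

lemma l2inner_scaleR_add_left:
  assumes "f \<in> Ltwo S" "g \<in> Ltwo S" "h \<in> Ltwo S"
  shows "l2inner S (\<lambda>x. c *\<^sub>R f x + d *\<^sub>R g x) h = c * l2inner S f h + d * l2inner S g h"
  unfolding l2inner_def
  using Ltwo_inner_integrable[OF assms(1,3)] Ltwo_inner_integrable[OF assms(2,3)]
  by (simp add: inner_add_left)

lemma l2inner_lincomb_left:
  fixes f g h :: "'a::euclidean_space \<Rightarrow> real"
  assumes "f \<in> Ltwo S" "g \<in> Ltwo S" "h \<in> Ltwo S"
  shows "l2inner S (\<lambda>x. c * f x + d * g x) h = c * l2inner S f h + d * l2inner S g h"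
  using l2inner_scaleR_add_left[OF assms, of c d] by simp

lemma l2inner_add_left:
  assumes "f \<in> Ltwo S" "g \<in> Ltwo S" "h \<in> Ltwo S"
  shows "l2inner S (\<lambda>x. f x + g x) h = l2inner S f h + l2inner S g h"
  using l2inner_scaleR_add_left[OF assms, of 1 1] by simp

lemma l2inner_diff_left:
  assumes "f \<in> Ltwo S" "g \<in> Ltwo S" "h \<in> Ltwo S"
  shows "l2inner S (\<lambda>x. f x - g x) h = l2inner S f h - l2inner S g h"
  using l2inner_scaleR_add_left[OF assms, of 1 "-1"] by simp

lemma l2inner_zero_left [simp]: "l2inner S (\<lambda>x. 0) h = 0"
  by (simp add: l2inner_def)

lemma l2inner_sum_left:
  assumes "\<And>i. i \<in> I \<Longrightarrow> f i \<in> Ltwo S" "h \<in> Ltwo S"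
  shows "l2inner S (\<lambda>x. \<Sum>i\<in>I. f i x) h = (\<Sum>i\<in>I. l2inner S (f i) h)"
  using assms
  by (induction I rule: infinite_finite_induct) (auto simp: l2inner_add_left Ltwo_sum)

lemma l2norm_sq_scaleR_add:
  assumes "f \<in> Ltwo S" "g \<in> Ltwo S"
  shows "(l2norm S (\<lambda>x. c *\<^sub>R f x + d *\<^sub>R g x))\<^sup>2
    = c\<^sup>2 * (l2norm S f)\<^sup>2 + 2 * c * d * l2inner S f g + d\<^sup>2 * (l2norm S g)\<^sup>2"
proof -
  have fg: "(\<lambda>x. c *\<^sub>R f x + d *\<^sub>R g x) \<in> Ltwo S" by (rule Ltwo_scaleR_add[OF assms])
  show ?thesis
    unfolding l2norm_sq l2inner_scaleR_add_left[OF assms fg]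
    unfolding l2inner_commute[of S _ "\<lambda>x. c *\<^sub>R f x + d *\<^sub>R g x"]
      l2inner_scaleR_add_left[OF assms assms(1)] l2inner_scaleR_add_left[OF assms assms(2)]
    by (simp add: l2inner_commute[of S g f] algebra_simps power2_eq_square)
qed

lemma l2inner_Cauchy_Schwarz:
  assumes "f \<in> Ltwo S" "g \<in> Ltwo S"
  shows "\<bar>l2inner S f g\<bar> \<le> l2norm S f * l2norm S g"
proof -
  define A B C where "A = (l2norm S f)\<^sup>2" and "B = l2inner S f g" and "C = (l2norm S g)\<^sup>2"
  have pos: "0 \<le> c\<^sup>2 * A + 2 * c * d * B + d\<^sup>2 * C" for c d
    unfolding A_def B_def C_def
    using l2norm_sq_scaleR_add[OF assms, of c d] zero_le_power2 by metis
  have "B\<^sup>2 \<le> A * C"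
  proof (cases "C = 0")
    case False
    then have "C > 0" by (simp add: C_def)
    moreover have "0 \<le> C * (A * C - B\<^sup>2)"
      using pos[of C "-B"] by (simp add: algebra_simps power2_eq_square)
    ultimately show ?thesis by (simp add: zero_le_mult_iff)
  next
    case True
    have "B = 0"
    proof (rule ccontr)
      assume "B \<noteq> 0"
      \<comment> \<open>with this second coefficient the quadratic form takes the value \<open>-1\<close>\<close>
      have "0 \<le> A + 2 * (- (A + 1) / (2 * B)) * B" using pos[of 1 "- (A + 1) / (2 * B)"] True by simp
      then show False using \<open>B \<noteq> 0\<close> by (simp add: field_simps)
    qed
    then show ?thesis using True by simp
  qed
  then have "sqrt (B\<^sup>2) \<le> sqrt (A * C)" by (rule real_sqrt_le_mono)
  then show ?thesis unfolding A_def B_def C_def by (simp add: real_sqrt_mult)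
qed

lemma l2norm_triangle:
  assumes "f \<in> Ltwo S" "g \<in> Ltwo S"
  shows "l2norm S (\<lambda>x. f x + g x) \<le> l2norm S f + l2norm S g"
proof (rule power2_le_imp_le)
  have "(l2norm S (\<lambda>x. f x + g x))\<^sup>2 = (l2norm S f)\<^sup>2 + 2 * l2inner S f g + (l2norm S g)\<^sup>2"
    using l2norm_sq_scaleR_add[OF assms, of 1 1] by simp
  also have "\<dots> \<le> (l2norm S f + l2norm S g)\<^sup>2"
    using l2inner_Cauchy_Schwarz[OF assms] by (simp add: power2_sum abs_le_iff)
  finally show "(l2norm S (\<lambda>x. f x + g x))\<^sup>2 \<le> (l2norm S f + l2norm S g)\<^sup>2" .
qed simp

lemma l2norm_scaleR: "l2norm S (\<lambda>x. c *\<^sub>R f x) = \<bar>c\<bar> * l2norm S f"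
  by (simp add: l2norm_def power_mult_distrib real_sqrt_mult)

lemma l2norm_scale: "l2norm S (\<lambda>x. c * f x) = \<bar>c\<bar> * l2norm S (f :: _ \<Rightarrow> real)"
  using l2norm_scaleR[of S c f] by simp

lemma l2norm_zero [simp]: "l2norm S (\<lambda>x. 0) = 0"
  by (simp add: l2norm_def)

lemma l2norm_AE_cong:
  assumes "f \<in> Ltwo S" "g \<in> Ltwo S" "AE x in lebesgue_on S. f x = g x"
  shows "l2norm S f = l2norm S g"
  using l2inner_AE_cong[OF assms(1,2) assms(1,2) assms(3,3)] by (simp add: l2norm_eq_sqrt_inner)

lemma l2norm_lincomb:
  fixes v w :: "'a::euclidean_space \<Rightarrow> real"
  assumes "v \<in> Ltwo S" "w \<in> Ltwo S"
  shows "l2norm S (\<lambda>x. c * v x + d * w x) \<le> \<bar>c\<bar> * l2norm S v + \<bar>d\<bar> * l2norm S w"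
  using l2norm_triangle[OF Ltwo_scale[OF assms(1)] Ltwo_scale[OF assms(2)], of c d]
  unfolding l2norm_scale .

lemma Ltwo_component:
  fixes G :: "'a::euclidean_space \<Rightarrow> 'b::euclidean_space"
  assumes "G \<in> Ltwo S"
  shows "(\<lambda>x. G x \<bullet> b) \<in> Ltwo S"
proof -
  have meas: "(\<lambda>x. G x \<bullet> b) \<in> borel_measurable (lebesgue_on S)" using assms by (auto simp: Ltwo_def)
  have "integrable (lebesgue_on S) (\<lambda>x. (norm (G x \<bullet> b))\<^sup>2)"
  proof (rule Bochner_Integration.integrable_bound)
    show "integrable (lebesgue_on S) (\<lambda>x. (norm (G x))\<^sup>2 * (norm b)\<^sup>2)"
      using assms by (auto simp: Ltwo_def)
    have "(norm (G x \<bullet> b))\<^sup>2 \<le> (norm (G x))\<^sup>2 * (norm b)\<^sup>2" for x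
      using Cauchy_Schwarz_ineq2[of "G x" b] power_mono[of "norm (G x \<bullet> b)" "norm (G x) * norm b" 2]
      by (simp add: power_mult_distrib)
    then show "AE x in lebesgue_on S. norm ((norm (G x \<bullet> b))\<^sup>2) \<le> norm ((norm (G x))\<^sup>2 * (norm b)\<^sup>2)"
      by simp
  qed (use meas in measurable)
  then show ?thesis using meas by (simp add: Ltwo_def)
qed

lemma Ltwo_mono:
  assumes "S' \<subseteq> S" "S' \<in> sets lebesgue" "S \<in> sets lebesgue" "f \<in> Ltwo S"
  shows "f \<in> Ltwo S'"
proof -
  have "(\<lambda>x. (norm (f x))\<^sup>2) absolutely_integrable_on S"
    using assms by (auto simp: Ltwo_def integrable_restrict_space set_integrable_def)
  then have "set_integrable lebesgue S' (\<lambda>x. (norm (f x))\<^sup>2)"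
    by (rule set_integrable_subset) (use assms in auto)
  then have "integrable (lebesgue_on S') (\<lambda>x. (norm (f x))\<^sup>2)"
    using assms by (auto simp: integrable_restrict_space set_integrable_def)
  moreover have "f \<in> borel_measurable (lebesgue_on S')"
    using assms by (auto simp: Ltwo_def intro: measurable_restrict_mono)
  ultimately show ?thesis by (simp add: Ltwo_def)
qed

lemma l2norm_mono_set:
  assumes "S' \<subseteq> S" "S' \<in> sets lebesgue" "S \<in> sets lebesgue" "f \<in> Ltwo S"
  shows "l2norm S' f \<le> l2norm S f"
proof -
  have "(\<integral>x. (norm (f x))\<^sup>2 \<partial>(lebesgue_on S')) \<le> (\<integral>x. (norm (f x))\<^sup>2 \<partial>(lebesgue_on S))"
    using assms Ltwo_mono[OF assms]
    by (intro integral_mono_lebesgue_on_AE) (auto simp: Ltwo_def)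
  then show ?thesis by (simp add: l2norm_def)
qed

section \<open>Smooth bump functions\<close>

text \<open>
  The factor \<open>p(1/x)\<close> makes this class of functions closed under differentiation.
\<close>

definition flat_exp :: "real poly \<Rightarrow> real \<Rightarrow> real" where
  "flat_exp p x = (if x > 0 then poly p (1 / x) * exp (- (1 / x)) else 0)"

lemma poly_times_exp_neg_tendsto_0: "((\<lambda>y. poly p y * exp (- y)) \<longlongrightarrow> (0::real)) at_top"
proof -
  have "((\<lambda>y. \<Sum>i\<le>degree p. coeff p i * (y ^ i / exp y)) \<longlongrightarrow> (\<Sum>i\<le>degree p. coeff p i * 0)) at_top"
    by (intro tendsto_sum tendsto_mult tendsto_const tendsto_power_div_exp_0)
  moreover have "(\<lambda>y. \<Sum>i\<le>degree p. coeff p i * (y ^ i / exp y)) = (\<lambda>y. poly p y * exp (- y))"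
    by (simp add: poly_altdef sum_distrib_right sum_divide_distrib exp_minus field_simps)
  ultimately show ?thesis by simp
qed

lemma flat_exp_tendsto_0: "(flat_exp p \<longlongrightarrow> 0) (at 0)"
proof -
  have "((\<lambda>x. poly p (inverse x) * exp (- inverse x)) \<longlongrightarrow> 0) (at_right 0)"
    by (rule filterlim_compose[OF poly_times_exp_neg_tendsto_0 filterlim_inverse_at_top_right])
  then have "(flat_exp p \<longlongrightarrow> 0) (at_right 0)"
    by (rule Lim_transform_eventually)
       (auto simp: flat_exp_def eventually_at_filter inverse_eq_divide)
  moreover have "(flat_exp p \<longlongrightarrow> 0) (at_left 0)"
    by (rule Lim_transform_eventually[OF tendsto_const])
       (auto simp: flat_exp_def eventually_at_filter)
  ultimately show ?thesis by (simp add: filterlim_split_at_real)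
qed

text \<open>
  Away from 0 this is calculus. At 0 the difference quotient of \<open>flat_exp p\<close> is again a function of the
  same class, for the polynomial \<open>X p\<close>, and therefore tends to 0.
\<close>

lemma flat_exp_has_derivative:
  "(flat_exp p has_real_derivative flat_exp ([:0, 0, 1:] * (p - pderiv p)) x) (at x)"
proof (rule linorder_cases[of x 0])
  assume "x > 0"
  have "((\<lambda>x. poly p (1 / x) * exp (- (1 / x))) has_real_derivative
      flat_exp ([:0, 0, 1:] * (p - pderiv p)) x) (at x)"
    using \<open>x > 0\<close>
    by (auto intro!: derivative_eq_intros DERIV_chain2[OF poly_DERIV]
        simp: flat_exp_def field_simps power2_eq_square)
  then show ?thesis
    by (rule has_field_derivative_transform_within_open[where S = "{0<..}"])
       (use \<open>x > 0\<close> in \<open>auto simp: flat_exp_def\<close>)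
next
  assume "x < 0"
  have "((\<lambda>x. 0) has_real_derivative flat_exp ([:0, 0, 1:] * (p - pderiv p)) x) (at x)"
    using \<open>x < 0\<close> by (auto simp: flat_exp_def)
  then show ?thesis
    by (rule has_field_derivative_transform_within_open[where S = "{..<0}"])
       (use \<open>x < 0\<close> in \<open>auto simp: flat_exp_def\<close>)
next
  assume "x = 0"
  have "(\<lambda>h. (flat_exp p (0 + h) - flat_exp p 0) / h) = flat_exp ([:0, 1:] * p)"
    by (auto simp: flat_exp_def fun_eq_iff)
  then have "(flat_exp p has_real_derivative 0) (at 0)"
    using flat_exp_tendsto_0[of "[:0, 1:] * p"] by (simp add: DERIV_def)
  then show ?thesis using \<open>x = 0\<close> by (simp add: flat_exp_def)
qed

text \<open>
  Closure under sums and products, as the product rule requires, makes this set invariant under partial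
  derivatives; such an invariant is exactly what the coinduction principle of \<open>smooth_fun\<close> asks for.
\<close>

inductive_set bump_algebra :: "('a::euclidean_space \<Rightarrow> real) set" where
  const: "(\<lambda>x. k) \<in> bump_algebra"
| flat: "(\<lambda>x. flat_exp p (c * (x \<bullet> e) + d)) \<in> bump_algebra"
| add: "f \<in> bump_algebra \<Longrightarrow> g \<in> bump_algebra \<Longrightarrow> (\<lambda>x. f x + g x) \<in> bump_algebra"
| mult: "f \<in> bump_algebra \<Longrightarrow> g \<in> bump_algebra \<Longrightarrow> (\<lambda>x. f x * g x) \<in> bump_algebra"

lemma bump_algebra_derivative:
  assumes "f \<in> bump_algebra"
  shows "\<exists>f'. (\<forall>x. (f has_derivative f' x) (at x)) \<and> (\<forall>b. (\<lambda>x. f' x b) \<in> bump_algebra)"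
  using assms
proof induction
  case (const k)
  show ?case by (intro exI[of _ "\<lambda>x b. 0"]) (auto intro: bump_algebra.const)
next
  case (flat p c e d)
  define q where "q = [:0, 0, 1:] * (p - pderiv p)"
  have "((\<lambda>x. flat_exp p (c * (x \<bullet> e) + d)) has_derivative
      (\<lambda>b. flat_exp q (c * (x \<bullet> e) + d) * (c * (b \<bullet> e)))) (at x)" for x
  proof -
    have "((\<lambda>x. c * (x \<bullet> e) + d) has_derivative (\<lambda>b. c * (b \<bullet> e))) (at x)"
      by (auto intro!: derivative_eq_intros)
    moreover have "(flat_exp p has_derivative (*) (flat_exp q (c * (x \<bullet> e) + d))) (at (c * (x \<bullet> e) + d))"
      using flat_exp_has_derivative unfolding has_field_derivative_def q_def by blast
    ultimately show ?thesis by (rule has_derivative_compose)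
  qed
  moreover have "(\<lambda>x. flat_exp q (c * (x \<bullet> e) + d) * (c * (b \<bullet> e))) \<in> bump_algebra" for b
    by (intro bump_algebra.intros)
  ultimately show ?case by (intro exI conjI allI)
next
  case (add f g)
  then obtain f' g' where "\<And>x. (f has_derivative f' x) (at x)" "\<And>x. (g has_derivative g' x) (at x)"
    and "\<And>b. (\<lambda>x. f' x b) \<in> bump_algebra" "\<And>b. (\<lambda>x. g' x b) \<in> bump_algebra" by metis
  then show ?case
    by (intro exI[of _ "\<lambda>x b. f' x b + g' x b"])
       (auto intro: bump_algebra.add has_derivative_add)
next
  case (mult f g)
  then obtain f' g' where "\<And>x. (f has_derivative f' x) (at x)" "\<And>x. (g has_derivative g' x) (at x)"
    and "\<And>b. (\<lambda>x. f' x b) \<in> bump_algebra" "\<And>b. (\<lambda>x. g' x b) \<in> bump_algebra" by metis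
  then show ?case using mult.hyps
    by (intro exI[of _ "\<lambda>x b. f x * g' x b + f' x b * g x"])
       (auto intro!: bump_algebra.add bump_algebra.mult has_derivative_mult)
qed

lemma bump_algebra_smooth:
  assumes "f \<in> bump_algebra"
  shows "smooth_fun f"
  using assms
proof (coinduction arbitrary: f)
  case (smooth_fun f)
  then obtain f' where f': "\<And>x. (f has_derivative f' x) (at x)" "\<And>b. (\<lambda>x. f' x b) \<in> bump_algebra"
    using bump_algebra_derivative by metis
  have "frechet_derivative f (at x) = f' x" for x
    using frechet_derivative_at[OF f'(1)] by simp
  then show ?case using f' by (auto simp: differentiable_def)
qed

lemma bump_algebra_prod:
  assumes "\<And>i. i \<in> I \<Longrightarrow> f i \<in> bump_algebra"
  shows "(\<lambda>x. \<Prod>i\<in>I. f i x) \<in> bump_algebra"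
  using assms
  by (induction I rule: infinite_finite_induct) (auto intro: bump_algebra.const bump_algebra.mult)

lemma smooth_fun_differentiable: "smooth_fun \<phi> \<Longrightarrow> \<phi> differentiable (at x)"
  by (auto elim: smooth_fun.cases)

lemma smooth_fun_partial:
  "smooth_fun \<phi> \<Longrightarrow> b \<in> Basis \<Longrightarrow> smooth_fun (\<lambda>x. frechet_derivative \<phi> (at x) b)"
  by (auto elim: smooth_fun.cases)

lemma smooth_fun_has_derivative:
  "smooth_fun \<phi> \<Longrightarrow> (\<phi> has_derivative frechet_derivative \<phi> (at x)) (at x)"
  using smooth_fun_differentiable frechet_derivative_works by blast

lemma smooth_fun_continuous: "smooth_fun \<phi> \<Longrightarrow> continuous_on A \<phi>"
  by (meson continuous_at_imp_continuous_on differentiable_imp_continuous_within smooth_fun_differentiable)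

lemma frechet_derivative_lincomb:
  assumes "smooth_fun \<phi>" "smooth_fun \<psi>"
  shows "frechet_derivative (\<lambda>x. c * \<phi> x + d * \<psi> x) (at x) b =
    c * frechet_derivative \<phi> (at x) b + d * frechet_derivative \<psi> (at x) b"
proof -
  have "((\<lambda>x. c * \<phi> x + d * \<psi> x) has_derivative
      (\<lambda>b. c * frechet_derivative \<phi> (at x) b + d * frechet_derivative \<psi> (at x) b)) (at x)"
    by (intro derivative_intros smooth_fun_has_derivative assms)
  from frechet_derivative_at[OF this] show ?thesis by metis
qed

lemma smooth_fun_lincomb:
  assumes "smooth_fun \<phi>" "smooth_fun \<psi>"
  shows "smooth_fun (\<lambda>x. c * \<phi> x + d * \<psi> x)"
  using assms
proof (coinduction arbitrary: \<phi> \<psi>)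
  case (smooth_fun \<phi> \<psi>)
  then have "(\<lambda>x. c * \<phi> x + d * \<psi> x) differentiable (at x)" for x
    by (intro differentiable_add differentiable_mult differentiable_const) (auto intro: smooth_fun_differentiable)
  moreover have "\<exists>\<phi>' \<psi>'. (\<lambda>x. frechet_derivative (\<lambda>x. c * \<phi> x + d * \<psi> x) (at x) b)
      = (\<lambda>x. c * \<phi>' x + d * \<psi>' x) \<and> smooth_fun \<phi>' \<and> smooth_fun \<psi>'" if "b \<in> Basis" for b
    using that smooth_fun
    by (intro exI[of _ "\<lambda>x. frechet_derivative \<phi> (at x) b"] exI[of _ "\<lambda>x. frechet_derivative \<psi> (at x) b"])
       (simp add: frechet_derivative_lincomb smooth_fun_partial)
  ultimately show ?case by blast
qed

lemma test_funs_smooth: "\<phi> \<in> test_funs \<Omega> \<Longrightarrow> smooth_fun \<phi>"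
  by (simp add: test_funs_def)

lemma test_funs_lincomb:
  assumes "\<phi> \<in> test_funs \<Omega>" "\<psi> \<in> test_funs \<Omega>"
  shows "(\<lambda>x. c * \<phi> x + d * \<psi> x) \<in> test_funs \<Omega>"
proof -
  have *: "closure {x. c * \<phi> x + d * \<psi> x \<noteq> 0} \<subseteq> closure {x. \<phi> x \<noteq> 0} \<union> closure {x. \<psi> x \<noteq> 0}"
    unfolding closure_Un[symmetric] by (rule closure_mono) auto
  then have "compact (closure {x. c * \<phi> x + d * \<psi> x \<noteq> 0})"
    using assms unfolding test_funs_def
    by (metis (no_types, lifting) mem_Collect_eq compact_Un closed_closure compact_Int_closed inf.absorb_iff2)
  then show ?thesis using assms * smooth_fun_lincomb by (auto simp: test_funs_def)
qed

text \<open>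
  The \<open>n\<close>-th function is a product over the coordinates of factors \<open>exp (- 1 / ((n + 1) d))\<close>, where \<open>d\<close> is the
  inward signed distance to a face of the box (the factor is 0 if \<open>d \<le> 0\<close>). Inside the box the exponents
  tend to 0.
\<close>

lemma box_indicator_approximation:
  fixes l u :: "'a::euclidean_space"
  assumes "cbox l u \<subseteq> \<Omega>"
  obtains \<phi> :: "nat \<Rightarrow> 'a \<Rightarrow> real" where "\<And>n. \<phi> n \<in> test_funs \<Omega>" "\<And>n x. \<bar>\<phi> n x\<bar> \<le> 1"
    "\<And>x. (\<lambda>n. \<phi> n x) \<longlonglongrightarrow> indicator (box l u) x"
proof
  define \<eta> where "\<eta> n e x = flat_exp [:1:] (real (Suc n) * (x \<bullet> e) + (- real (Suc n) * (l \<bullet> e)))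
      * flat_exp [:1:] (- real (Suc n) * (x \<bullet> e) + real (Suc n) * (u \<bullet> e))" for n and e x :: 'a
  define \<phi> where "\<phi> n x = (\<Prod>e\<in>Basis. \<eta> n e x)" for n and x :: 'a
  have flat1: "flat_exp [:1:] y = (if y > 0 then exp (- (1 / y)) else 0)" for y
    by (simp add: flat_exp_def)
  have \<eta>_eq: "\<eta> n e x = (if l \<bullet> e < x \<bullet> e \<and> x \<bullet> e < u \<bullet> e
      then exp (- (1 / (real (Suc n) * (x \<bullet> e - l \<bullet> e)))) * exp (- (1 / (real (Suc n) * (u \<bullet> e - x \<bullet> e)))) else 0)"
    for n e x
  proof -
    have 1: "real (Suc n) * (x \<bullet> e) + (- real (Suc n) * (l \<bullet> e)) = real (Suc n) * (x \<bullet> e - l \<bullet> e)"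
      "- real (Suc n) * (x \<bullet> e) + real (Suc n) * (u \<bullet> e) = real (Suc n) * (u \<bullet> e - x \<bullet> e)"
      by (simp_all add: algebra_simps)
    show ?thesis unfolding \<eta>_def 1 flat1 by (auto simp: zero_less_mult_iff)
  qed
  show "\<phi> n \<in> test_funs \<Omega>" for n
  proof -
    have "smooth_fun (\<phi> n)"
      unfolding \<phi>_def \<eta>_def by (intro bump_algebra_smooth bump_algebra_prod bump_algebra.intros)
    moreover have "{x. \<phi> n x \<noteq> 0} \<subseteq> box l u"
      by (auto simp: \<phi>_def \<eta>_eq mem_box split: if_splits)
    then have supp: "closure {x. \<phi> n x \<noteq> 0} \<subseteq> cbox l u"
      by (meson box_subset_cbox closed_cbox closure_minimal subset_trans)
    moreover have "compact (closure {x. \<phi> n x \<noteq> 0})"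
      using compact_Int_closed[OF compact_cbox[of l u] closed_closure[of "{x. \<phi> n x \<noteq> 0}"]] supp
      by (simp add: inf.absorb2)
    ultimately show ?thesis using assms supp unfolding test_funs_def by simp
  qed
  have \<eta>01: "0 \<le> \<eta> n e x \<and> \<eta> n e x \<le> 1" for n e x
  proof -
    have "exp (- (1 / (real (Suc n) * r))) \<le> 1" if "r > 0" for r
      using that by simp
    then show ?thesis unfolding \<eta>_eq by (auto intro!: mult_le_one simp del: of_nat_Suc exp_le_one_iff)
  qed
  show "\<bar>\<phi> n x\<bar> \<le> 1" for n x
    unfolding \<phi>_def abs_prod by (rule prod_le_1) (simp add: \<eta>01)
  show "(\<lambda>n. \<phi> n x) \<longlonglongrightarrow> indicator (box l u) x" for x
  proof (cases "x \<in> box l u")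
    case True
    have lim: "(\<lambda>n. exp (- (1 / (real (Suc n) * r)))) \<longlonglongrightarrow> 1" for r :: real
    proof -
      have "(\<lambda>n. exp (- (1 / r * (1 / real (Suc n))))) \<longlonglongrightarrow> exp (- (1 / r * 0))"
        by (intro tendsto_intros lim_1_over_n[THEN LIMSEQ_Suc])
      then show ?thesis by (simp add: mult.commute del: of_nat_Suc)
    qed
    have "(\<lambda>n. \<eta> n e x) \<longlonglongrightarrow> 1 * 1" if "e \<in> Basis" for e
    proof -
      have "(\<lambda>n. \<eta> n e x) = (\<lambda>n. exp (- (1 / (real (Suc n) * (x \<bullet> e - l \<bullet> e))))
          * exp (- (1 / (real (Suc n) * (u \<bullet> e - x \<bullet> e)))))"
        using True that unfolding \<eta>_eq mem_box by presburger
      then show ?thesis by (simp only:) (intro tendsto_mult lim)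
    qed
    then have "(\<lambda>n. \<phi> n x) \<longlonglongrightarrow> (\<Prod>e\<in>(Basis::'a set). 1 * 1)"
      unfolding \<phi>_def by (intro tendsto_prod)
    then show ?thesis using True by simp
  next
    case False
    then obtain e where "e \<in> Basis" "\<not> (l \<bullet> e < x \<bullet> e \<and> x \<bullet> e < u \<bullet> e)" by (auto simp: mem_box)
    then have "\<phi> n x = 0" for n
      unfolding \<phi>_def by (intro prod_zero) (auto simp: \<eta>_eq)
    then show ?thesis using False by simp
  qed
qed

section \<open>The fundamental lemma of the calculus of variations\<close>

text \<open>
  Open boxes are stable under intersection and generate the Borel sets, so by Dynkin's argument the
  integral of \<open>g\<close> vanishes over every Borel set.
\<close>

lemma AE_zero_if_box_integrals_zero:
  fixes g :: "'a::euclidean_space \<Rightarrow> real"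
  assumes int: "integrable lebesgue g" and supp: "\<And>x. x \<notin> box a b \<Longrightarrow> g x = 0"
    and box0: "\<And>l u. integral\<^sup>L lebesgue (\<lambda>x. indicator (box l u) x * g x) = 0"
  shows "AE x in lebesgue. g x = 0"
proof -
  obtain g' where g' [measurable]: "g' \<in> borel_measurable lborel" and ae: "AE x in lborel. g x = g' x"
    using completion_ex_borel_measurable_real[of g lborel] int by auto
  have ae': "AE x in lebesgue. g x = g' x" using ae by (rule AE_completion)
  have "integrable lebesgue g'"
    using int ae' g' integrable_cong_AE[of g lebesgue g'] by (auto simp: measurable_completion)
  then have int': "integrable lborel g'" by (simp add: integrable_completion)
  have box0': "(\<integral>x. indicator (box l u) x * g' x \<partial>lborel) = 0" for l u
  proof -
    have "(\<integral>x. indicator (box l u) x * g' x \<partial>lborel) = (\<integral>x. indicator (box l u) x * g' x \<partial>lebesgue)"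
      by (rule integral_completion[symmetric]) measurable
    also have "\<dots> = (\<integral>x. indicator (box l u) x * g x \<partial>lebesgue)"
    proof (rule integral_cong_AE)
      have "g \<in> borel_measurable lebesgue" "g' \<in> borel_measurable lebesgue"
        using int g' by (auto simp: measurable_completion)
      then show "(\<lambda>x. indicator (box l u) x * g' x) \<in> borel_measurable lebesgue"
        "(\<lambda>x. indicator (box l u) x * g x) \<in> borel_measurable lebesgue"
        by (intro borel_measurable_times borel_measurable_indicator; simp)+
    qed (use ae' in auto)
    finally show ?thesis using box0 by simp
  qed
  have total: "(\<integral>x. g' x \<partial>lborel) = 0"
  proof -
    have "(\<integral>x. g' x \<partial>lborel) = (\<integral>x. indicator (box a b) x * g' x \<partial>lborel)"
      using ae supp by (intro integral_cong_AE) (auto simp: indicator_def)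
    then show ?thesis using box0' by simp
  qed
  have "(LINT x:A|lborel. g' x) = 0" if "A \<in> sets borel" for A
  proof -
    have "Int_stable (range (\<lambda>(a, b). box a b :: 'a set))"
      by (auto simp: Int_stable_def box_Int_box)
    moreover have "range (\<lambda>(a, b). box a b :: 'a set) \<subseteq> Pow UNIV" by auto
    moreover have "A \<in> sigma_sets UNIV (range (\<lambda>(a, b). box a b))"
      using that unfolding borel_eq_box by simp
    ultimately show ?thesis
    proof (induction rule: sigma_sets_induct_disjoint)
      case (basic A)
      then show ?case using box0' by (auto simp: set_lebesgue_integral_def)
    next
      case empty
      then show ?case by (simp add: set_lebesgue_integral_def)
    next
      case (compl A)
      then have [measurable]: "A \<in> sets borel" by (simp add: borel_eq_box)
      have "(LINT x:(UNIV - A)|lborel. g' x) = (\<integral>x. g' x - indicator A x *\<^sub>R g' x \<partial>lborel)"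
        unfolding set_lebesgue_integral_def
        by (intro Bochner_Integration.integral_cong) (auto simp: indicator_def)
      also have "\<dots> = (\<integral>x. g' x \<partial>lborel) - (LINT x:A|lborel. g' x)"
        unfolding set_lebesgue_integral_def
        by (intro Bochner_Integration.integral_diff int' integrable_mult_indicator) auto
      finally show ?case using compl total by simp
    next
      case (union F)
      then have [measurable]: "\<And>i. F i \<in> sets borel"
        by (simp add: borel_eq_box subset_eq)
      have "set_integrable lborel (\<Union>i. F i) g'"
        unfolding set_integrable_def by (intro integrable_mult_indicator int') auto
      then have "(LINT x:(\<Union>i. F i)|lborel. g' x) = (\<Sum>i. (LINT x:F i|lborel. g' x))"
        using union.hyps(1)
        by (intro lebesgue_integral_countable_add) (auto simp: disjoint_family_on_def)
      then show ?case using union by simp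
    qed
  qed
  then have "AE x in lborel. g' x = 0"
    using density_unique_real[OF int', of "\<lambda>x. 0"] by (simp add: set_lebesgue_integral_def)
  then show ?thesis using ae by (auto intro!: AE_completion)
qed

text \<open>
  Test functions approximate the indicator of every box whose closure lies in \<open>\<Omega>\<close>, so \<open>g\<close> has integral zero
  over all such boxes. This suffices on each closed box inside \<open>\<Omega>\<close>, and countably many of these
  cover \<open>\<Omega>\<close>.
\<close>

lemma fundamental_lemma:
  fixes g :: "'a::euclidean_space \<Rightarrow> real"
  assumes "open \<Omega>" and int: "integrable (lebesgue_on \<Omega>) g"
    and zero: "\<And>\<phi>. \<phi> \<in> test_funs \<Omega> \<Longrightarrow> integral\<^sup>L (lebesgue_on \<Omega>) (\<lambda>x. g x * \<phi> x) = 0"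
  shows "AE x in lebesgue_on \<Omega>. g x = 0"
proof -
  have \<Omega>_sets [simp]: "\<Omega> \<in> sets lebesgue" using assms by (simp add: lebesgue_openin)
  have int\<Omega>: "integrable lebesgue (\<lambda>x. indicator \<Omega> x * g x)"
    using int by (simp add: integrable_restrict_space)
  have box0: "(\<integral>x. indicator (box l u) x * g x \<partial>lebesgue) = 0" if lu: "cbox l u \<subseteq> \<Omega>" for l u
  proof -
    obtain \<phi> :: "nat \<Rightarrow> 'a \<Rightarrow> real" where \<phi>: "\<And>n. \<phi> n \<in> test_funs \<Omega>" "\<And>n x. \<bar>\<phi> n x\<bar> \<le> 1"
      "\<And>x. (\<lambda>n. \<phi> n x) \<longlonglongrightarrow> indicator (box l u) x"
      using box_indicator_approximation[OF lu] by blast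
    have [measurable]: "\<phi> n \<in> borel_measurable (lebesgue_on \<Omega>)" for n
      using smooth_fun_continuous[OF test_funs_smooth[OF \<phi>(1)]]
      by (intro continuous_imp_measurable_on_sets_lebesgue) auto
    have [measurable]: "g \<in> borel_measurable (lebesgue_on \<Omega>)" using int by simp
    have "(\<lambda>n. integral\<^sup>L (lebesgue_on \<Omega>) (\<lambda>x. g x * \<phi> n x)) \<longlonglongrightarrow>
        integral\<^sup>L (lebesgue_on \<Omega>) (\<lambda>x. g x * indicator (box l u) x)"
    proof (rule integral_dominated_convergence[where w = "\<lambda>x. \<bar>g x\<bar>"])
      have "indicator (box l u) \<in> borel_measurable (lebesgue_on \<Omega>)"
        by (intro measurable_restrict_space1 borel_measurable_indicator) auto
      then show "(\<lambda>x. g x * indicator (box l u) x) \<in> borel_measurable (lebesgue_on \<Omega>)"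
        using int by (intro borel_measurable_times) auto
      show "AE x in lebesgue_on \<Omega>. norm (g x * \<phi> n x) \<le> \<bar>g x\<bar>" for n
        using \<phi>(2) by (auto simp: abs_mult intro!: mult_left_le)
    qed (use int \<phi>(3) in \<open>auto intro!: tendsto_intros\<close>)
    moreover have "integral\<^sup>L (lebesgue_on \<Omega>) (\<lambda>x. g x * indicator (box l u) x)
        = (\<integral>x. indicator (box l u) x * g x \<partial>lebesgue)"
    proof -
      have "box l u \<subseteq> \<Omega>" using lu box_subset_cbox by blast
      then show ?thesis
        by (subst integral_restrict_space) (auto intro!: Bochner_Integration.integral_cong simp: indicator_def)
    qed
    ultimately show ?thesis using zero[OF \<phi>(1)] by (simp add: LIMSEQ_const_iff)
  qed
  have local: "AE x in lebesgue. x \<in> cbox a b \<longrightarrow> g x = 0" if ab: "cbox a b \<subseteq> \<Omega>" for a b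
  proof -
    have "AE x in lebesgue. indicator (box a b) x * g x = 0"
    proof (rule AE_zero_if_box_integrals_zero[of _ a b])
      have "integrable lebesgue (\<lambda>x. indicator (box a b) x *\<^sub>R (indicator \<Omega> x * g x))"
        by (rule integrable_mult_indicator) (use int\<Omega> in auto)
      moreover have "(\<lambda>x. indicator (box a b) x *\<^sub>R (indicator \<Omega> x * g x)) = (\<lambda>x. indicator (box a b) x * g x)"
        using ab box_subset_cbox[of a b] by (auto simp: indicator_def fun_eq_iff)
      ultimately show "integrable lebesgue (\<lambda>x. indicator (box a b) x * g x)" by metis
      fix l u
      obtain c d where cd: "box l u \<inter> box a b = box c d" unfolding box_Int_box by blast
      have zero: "(\<integral>x. indicator (box c d) x * g x \<partial>lebesgue) = 0"
      proof (cases "box c d = {}")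
        case False
        then have "cbox c d = closure (box c d)" by simp
        also have "\<dots> \<subseteq> cbox a b"
          using cd box_subset_cbox[of a b] by (intro closure_minimal) auto
        finally show ?thesis using ab by (intro box0) auto
      qed simp
      have "indicator (box l u) x * (indicator (box a b) x * g x) = indicator (box c d) x * g x" for x
        unfolding cd[symmetric] indicator_inter_arith by (rule mult.assoc[symmetric])
      then show "(\<integral>x. indicator (box l u) x * (indicator (box a b) x * g x) \<partial>lebesgue) = 0"
        unfolding zero[symmetric] by (intro Bochner_Integration.integral_cong refl)
    qed simp
    moreover have "AE x in lebesgue. x \<notin> cbox a b - box a b"
    proof -
      have "negligible (cbox a b - box a b)"
        using negligible_frontier_interval by blast
      then show ?thesis by (intro AE_not_in) (simp add: negligible_iff_null_sets)
    qed
    ultimately show ?thesis by eventually_elim (auto simp: indicator_def)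
  qed
  obtain \<D> where \<D>: "countable \<D>" "\<D> \<subseteq> Pow \<Omega>" "\<And>X. X \<in> \<D> \<Longrightarrow> \<exists>a b. X = cbox a b" "\<Union>\<D> = \<Omega>"
    by (rule open_countable_Union_open_cbox[OF \<open>open \<Omega>\<close>]) blast
  have "\<forall>X\<in>\<D>. AE x in lebesgue. x \<in> X \<longrightarrow> g x = 0"
  proof
    fix X assume "X \<in> \<D>"
    then obtain a b where "X = cbox a b" using \<D>(3) by blast
    then show "AE x in lebesgue. x \<in> X \<longrightarrow> g x = 0" using local[of a b] \<D>(2) \<open>X \<in> \<D>\<close> by blast
  qed
  then have "AE x in lebesgue. \<forall>X\<in>\<D>. x \<in> X \<longrightarrow> g x = 0"
    unfolding AE_ball_countable[OF \<D>(1)] .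
  then have "AE x in lebesgue. x \<in> \<Omega> \<longrightarrow> g x = 0"
    by eventually_elim (use \<D>(4) in blast)
  then show ?thesis by (simp add: AE_restrict_space_iff)
qed

section \<open>Weak gradients\<close>

lemma integral_shift:
  fixes f :: "'a::euclidean_space \<Rightarrow> real"
  assumes "integrable lborel f"
  shows "integrable lborel (\<lambda>x. f (x + c))" "(\<integral>x. f (x + c) \<partial>lborel) = (\<integral>x. f x \<partial>lborel)"
proof -
  have [measurable]: "f \<in> borel_measurable borel" using assms by simp
  have "integrable (distr lborel borel ((+) c)) f" using assms by (simp add: lborel_distr_plus)
  then show "integrable lborel (\<lambda>x. f (x + c))"
    by (simp add: integrable_distr_eq add.commute)
  have "(\<integral>x. f x \<partial>distr lborel borel ((+) c)) = (\<integral>x. f (c + x) \<partial>lborel)"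
    by (rule integral_distr) auto
  then show "(\<integral>x. f (x + c) \<partial>lborel) = (\<integral>x. f x \<partial>lborel)"
    by (simp add: lborel_distr_plus add.commute)
qed

text \<open>
  The difference quotients of \<open>f\<close> in direction \<open>b\<close> have integral zero by translation invariance of
  Lebesgue measure, and they converge dominatedly to the derivative by the mean value theorem.
\<close>

lemma integral_partial_derivative_zero:
  fixes f :: "'a::euclidean_space \<Rightarrow> real"
  assumes der: "\<And>x. (f has_derivative f' x) (at x)"
    and cont: "continuous_on UNIV (\<lambda>x. f' x b)"
    and supp: "\<And>x. x \<notin> K \<Longrightarrow> f x = 0" and "bounded K"
  shows "(\<integral>x. f' x b \<partial>lborel) = 0"
proof -
  obtain R where R: "\<And>x. x \<in> K \<Longrightarrow> norm x \<le> R" using \<open>bounded K\<close> by (auto simp: bounded_iff)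
  \<comment> \<open>shifts by at most \<open>b\<close> and the intermediate point of the mean value theorem stay in this ball\<close>
  define B where "B = cball (0::'a) (R + 2 * norm b)"
  have f_cont: "continuous_on UNIV f"
    using der by (meson continuous_at_imp_continuous_on has_derivative_continuous)
  have f_int: "integrable lborel f"
  proof -
    have "indicator B x *\<^sub>R f x = f x" for x
    proof (cases "x \<in> K")
      case True
      then have "x \<in> B" using R[of x] norm_ge_zero[of b] unfolding B_def mem_cball_0 by linarith
      then show ?thesis by simp
    qed (simp add: supp)
    then have "(\<lambda>x. indicator B x *\<^sub>R f x) = f" by auto
    then show ?thesis
      using borel_integrable_compact[of B f] f_cont by (metis B_def compact_cball continuous_on_subset subset_UNIV)
  qed
  have "compact ((\<lambda>x. f' x b) ` B)"
    using cont by (intro compact_continuous_image) (auto simp: B_def intro: continuous_on_subset)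
  then obtain M where M: "\<And>x. x \<in> B \<Longrightarrow> \<bar>f' x b\<bar> \<le> M"
    using compact_imp_bounded by (fastforce simp: bounded_iff)
  define h where "h n = 1 / real (Suc n)" for n
  have h: "0 < h n" "h n \<le> 1" for n by (auto simp: h_def)
  define q where "q n x = (f (x + h n *\<^sub>R b) - f x) / h n" for n x
  have q_bound: "\<bar>q n x\<bar> \<le> M * indicator B x" for n x
  proof (cases "x \<in> K \<or> x + h n *\<^sub>R b \<in> K")
    case False
    then have "q n x = 0" using supp by (simp add: q_def)
    moreover have "M * indicator B x \<ge> 0" using M[of x] by (auto simp: indicator_def)
    ultimately show ?thesis by simp
  next
    case True
    have hb: "norm (h n *\<^sub>R b) \<le> norm b" using h[of n] by (simp add: mult_left_le_one_le)
    have nx: "norm x \<le> R + norm b"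
      using True
    proof
      assume "x \<in> K"
      then show ?thesis using R[of x] norm_ge_zero[of b] by linarith
    next
      assume "x + h n *\<^sub>R b \<in> K"
      then show ?thesis
        using R[of "x + h n *\<^sub>R b"] hb norm_diff_ineq[of x "h n *\<^sub>R b"] by linarith
    qed
    have "((\<lambda>s. f (x + s *\<^sub>R b)) has_real_derivative f' (x + s *\<^sub>R b) b) (at s)" for s
    proof -
      have "((\<lambda>s. x + s *\<^sub>R b) has_derivative (\<lambda>s. s *\<^sub>R b)) (at s)"
        by (auto intro!: derivative_eq_intros)
      from has_derivative_compose[OF this der]
      have "((\<lambda>s. f (x + s *\<^sub>R b)) has_derivative (\<lambda>r. f' (x + s *\<^sub>R b) (r *\<^sub>R b))) (at s)" .
      moreover have "f' (x + s *\<^sub>R b) (r *\<^sub>R b) = f' (x + s *\<^sub>R b) b * r" for r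
        using linear_cmul[OF has_derivative_linear[OF der]] by simp
      ultimately show ?thesis by (simp add: has_field_derivative_def)
    qed
    then obtain z where z: "0 < z" "z < h n" "f (x + h n *\<^sub>R b) - f (x + 0 *\<^sub>R b) = (h n - 0) * f' (x + z *\<^sub>R b) b"
      using MVT2[of 0 "h n" "\<lambda>s. f (x + s *\<^sub>R b)" "\<lambda>s. f' (x + s *\<^sub>R b) b"] h by blast
    have "norm (z *\<^sub>R b) \<le> norm b" using z h[of n] by (simp add: mult_left_le_one_le)
    then have "x + z *\<^sub>R b \<in> B" using norm_triangle_ineq[of x "z *\<^sub>R b"] nx by (simp add: B_def)
    moreover have "x \<in> B" using nx by (simp add: B_def add_increasing2 order_trans)
    moreover have "q n x = f' (x + z *\<^sub>R b) b" using z(3) h(1)[of n] by (simp add: q_def)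
    ultimately show ?thesis using M by simp
  qed
  have "(\<lambda>n. \<integral>x. q n x \<partial>lborel) \<longlonglongrightarrow> (\<integral>x. f' x b \<partial>lborel)"
  proof (rule integral_dominated_convergence[where w = "\<lambda>x. M * indicator B x"])
    show "(\<lambda>x. f' x b) \<in> borel_measurable lborel"
      using borel_measurable_continuous_onI[OF cont] by simp
    show "q n \<in> borel_measurable lborel" for n
      using borel_measurable_integrable[OF f_int] unfolding q_def by measurable
    show "integrable lborel (\<lambda>x. M * indicator B x)"
      using borel_integrable_compact[of B "\<lambda>x. M"] by (simp add: B_def mult.commute)
    show "AE x in lborel. (\<lambda>n. q n x) \<longlonglongrightarrow> f' x b"
    proof (intro AE_I2)
      fix x
      have "((\<lambda>s. f (x + s *\<^sub>R b)) has_real_derivative f' x b) (at 0)"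
      proof -
        have "((\<lambda>s. x + s *\<^sub>R b) has_derivative (\<lambda>s. s *\<^sub>R b)) (at 0)"
          by (auto intro!: derivative_eq_intros)
        from has_derivative_compose[OF this der]
        have "((\<lambda>s. f (x + s *\<^sub>R b)) has_derivative (\<lambda>r. f' x (r *\<^sub>R b))) (at 0)" by simp
        moreover have "f' x (r *\<^sub>R b) = f' x b * r" for r
          using linear_cmul[OF has_derivative_linear[OF der]] by simp
        ultimately show ?thesis by (simp add: has_field_derivative_def)
      qed
      then have "((\<lambda>s. (f (x + s *\<^sub>R b) - f x) / s) \<longlongrightarrow> f' x b) (at 0)"
        by (simp add: DERIV_def)
      moreover have "filterlim h (at 0) sequentially"
        unfolding filterlim_at using LIMSEQ_Suc[OF lim_1_over_n[where 'a = real]] h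
        by (auto simp: h_def[abs_def] simp del: of_nat_Suc)
      ultimately show "(\<lambda>n. q n x) \<longlonglongrightarrow> f' x b"
        unfolding q_def by (rule filterlim_compose)
    qed
    show "AE x in lborel. norm (q n x) \<le> M * indicator B x" for n
      using q_bound by simp
  qed
  moreover have "(\<integral>x. q n x \<partial>lborel) = 0" for n
    using integral_shift[OF f_int, of "h n *\<^sub>R b"] f_int by (simp add: q_def)
  ultimately show ?thesis by (simp add: LIMSEQ_const_iff)
qed

lemma test_funs_outside:
  assumes "\<phi> \<in> test_funs \<Omega>" "x \<notin> \<Omega>"
  shows "\<phi> x = 0"
  using assms closure_subset[of "{x. \<phi> x \<noteq> 0}"] by (auto simp: test_funs_def)

lemma wgrad_weak:
  assumes "v \<in> Hone \<Omega>"
  shows "wgrad \<Omega> v \<in> Ltwo \<Omega>" "is_weak_grad \<Omega> v (wgrad \<Omega> v)"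
  using assms someI_ex[of "\<lambda>G. G \<in> Ltwo \<Omega> \<and> is_weak_grad \<Omega> v G"]
  unfolding Hone_def wgrad_def by auto

lemma Hone_Ltwo: "v \<in> Hone \<Omega> \<Longrightarrow> v \<in> Ltwo \<Omega>"
  by (simp add: Hone_def)

lemma wgrad_cong:
  assumes "\<And>x. x \<in> \<Omega> \<Longrightarrow> v x = w x"
  shows "wgrad \<Omega> v = wgrad \<Omega> w"
proof -
  have "integral\<^sup>L (lebesgue_on \<Omega>) (\<lambda>x. v x * D x) = integral\<^sup>L (lebesgue_on \<Omega>) (\<lambda>x. w x * D x)" for D
    by (intro Bochner_Integration.integral_cong) (auto simp: assms)
  then show ?thesis unfolding wgrad_def is_weak_grad_def by simp
qed

context
  fixes \<Omega> :: "'a::euclidean_space set"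
  assumes open_dom: "open \<Omega>" and bounded_dom: "bounded \<Omega>"
begin

lemma dom_sets [simp]: "\<Omega> \<in> sets lebesgue"
  using open_dom by (simp add: lebesgue_openin)

lemma dom_finite_measure: "finite_measure (lebesgue_on \<Omega>)"
  by (intro finite_measure_lebesgue_on bounded_set_imp_lmeasurable bounded_dom dom_sets)

lemma continuous_Ltwo:
  fixes f :: "'a \<Rightarrow> 'b::euclidean_space"
  assumes "continuous_on UNIV f"
  shows "f \<in> Ltwo \<Omega>"
proof -
  interpret finite_measure "lebesgue_on \<Omega>" by (rule dom_finite_measure)
  have meas [measurable]: "f \<in> borel_measurable (lebesgue_on \<Omega>)"
    using assms by (intro continuous_imp_measurable_on_sets_lebesgue) (auto intro: continuous_on_subset)
  have "compact (f ` closure \<Omega>)"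
    using assms bounded_dom by (intro compact_continuous_image) (auto intro: continuous_on_subset)
  then obtain B where B: "\<And>x. x \<in> closure \<Omega> \<Longrightarrow> norm (f x) \<le> B"
    using compact_imp_bounded by (fastforce simp: bounded_iff)
  have "integrable (lebesgue_on \<Omega>) (\<lambda>x. (norm (f x))\<^sup>2)"
    using B closure_subset[of \<Omega>]
    by (intro integrable_const_bound[where B = "B\<^sup>2"] AE_I2) (auto intro!: power_mono)
  then show ?thesis using meas by (simp add: Ltwo_def)
qed

lemma Ltwo_integrable: 
  fixes f :: "'a \<Rightarrow> real"
  assumes "f \<in> Ltwo \<Omega>"
  shows "integrable (lebesgue_on \<Omega>) f"
  using Ltwo_inner_integrable[OF assms continuous_Ltwo[of "\<lambda>x. 1"]] by simp

lemma test_funs_Ltwo: "\<phi> \<in> test_funs \<Omega> \<Longrightarrow> \<phi> \<in> Ltwo \<Omega>"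
  by (intro continuous_Ltwo smooth_fun_continuous test_funs_smooth)

lemma test_funs_partial_Ltwo:
  "\<phi> \<in> test_funs \<Omega> \<Longrightarrow> b \<in> Basis \<Longrightarrow> (\<lambda>x. frechet_derivative \<phi> (at x) b) \<in> Ltwo \<Omega>"
  by (intro continuous_Ltwo smooth_fun_continuous smooth_fun_partial test_funs_smooth)

text \<open>
  The gradient \<open>wgrad\<close> of the definitions is an arbitrary choice among the weak gradients; uniqueness
  is what makes it linear up to null sets.
\<close>

lemma weak_grad_unique:
  assumes G: "G1 \<in> Ltwo \<Omega>" "G2 \<in> Ltwo \<Omega>" and weak: "is_weak_grad \<Omega> v G1" "is_weak_grad \<Omega> v G2"
  shows "AE x in lebesgue_on \<Omega>. G1 x = G2 x"
proof -
  have "AE x in lebesgue_on \<Omega>. (G1 x - G2 x) \<bullet> b = 0" if b: "b \<in> Basis" for b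
  proof (rule fundamental_lemma[OF open_dom])
    show "integrable (lebesgue_on \<Omega>) (\<lambda>x. (G1 x - G2 x) \<bullet> b)"
      by (intro Ltwo_integrable Ltwo_component Ltwo_diff G)
    fix \<phi> assume \<phi>: "\<phi> \<in> test_funs \<Omega>"
    have "integrable (lebesgue_on \<Omega>) (\<lambda>x. (G1 x \<bullet> b) * \<phi> x)" "integrable (lebesgue_on \<Omega>) (\<lambda>x. (G2 x \<bullet> b) * \<phi> x)"
      using Ltwo_inner_integrable[OF Ltwo_component[OF G(1)] test_funs_Ltwo[OF \<phi>], of b]
        Ltwo_inner_integrable[OF Ltwo_component[OF G(2)] test_funs_Ltwo[OF \<phi>], of b] by simp_all
    then show "integral\<^sup>L (lebesgue_on \<Omega>) (\<lambda>x. (G1 x - G2 x) \<bullet> b * \<phi> x) = 0"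
      using weak \<phi> b unfolding is_weak_grad_def by (simp add: inner_diff_left left_diff_distrib)
  qed
  then have "AE x in lebesgue_on \<Omega>. \<forall>b\<in>Basis. (G1 x - G2 x) \<bullet> b = 0"
    by (subst AE_ball_countable) (auto intro: countable_finite)
  then show ?thesis
    by eventually_elim (metis euclidean_all_zero_iff right_minus_eq)
qed

lemma is_weak_grad_lincomb:
  assumes "v \<in> Ltwo \<Omega>" "w \<in> Ltwo \<Omega>" "G \<in> Ltwo \<Omega>" "F \<in> Ltwo \<Omega>"
    and "is_weak_grad \<Omega> v G" "is_weak_grad \<Omega> w F"
  shows "is_weak_grad \<Omega> (\<lambda>x. c * v x + d * w x) (\<lambda>x. c *\<^sub>R G x + d *\<^sub>R F x)"
  unfolding is_weak_grad_def
proof (intro ballI)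
  fix \<phi> and b :: 'a assume \<phi>: "\<phi> \<in> test_funs \<Omega>" and b: "b \<in> Basis"
  note D = test_funs_partial_Ltwo[OF \<phi> b]
  have int: "integrable (lebesgue_on \<Omega>) (\<lambda>x. v x * frechet_derivative \<phi> (at x) b)"
    "integrable (lebesgue_on \<Omega>) (\<lambda>x. w x * frechet_derivative \<phi> (at x) b)"
    "integrable (lebesgue_on \<Omega>) (\<lambda>x. (G x \<bullet> b) * \<phi> x)"
    "integrable (lebesgue_on \<Omega>) (\<lambda>x. (F x \<bullet> b) * \<phi> x)"
    using Ltwo_inner_integrable[OF assms(1) D] Ltwo_inner_integrable[OF assms(2) D]
      Ltwo_inner_integrable[OF Ltwo_component[OF assms(3)] test_funs_Ltwo[OF \<phi>]]
      Ltwo_inner_integrable[OF Ltwo_component[OF assms(4)] test_funs_Ltwo[OF \<phi>]]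
    by simp_all
  then show "integral\<^sup>L (lebesgue_on \<Omega>) (\<lambda>x. (c * v x + d * w x) * frechet_derivative \<phi> (at x) b)
      = - integral\<^sup>L (lebesgue_on \<Omega>) (\<lambda>x. ((c *\<^sub>R G x + d *\<^sub>R F x) \<bullet> b) * \<phi> x)"
    using assms(5,6) \<phi> b unfolding is_weak_grad_def
    by (simp add: distrib_right inner_add_left mult.assoc)
qed

text \<open>
  Integration by parts: the product of two test functions has compact support, so the integral of
  its partial derivative vanishes.
\<close>

lemma test_funs_weak_grad:
  assumes \<phi>: "\<phi> \<in> test_funs \<Omega>"
  shows "is_weak_grad \<Omega> \<phi> (\<lambda>x. \<Sum>b\<in>Basis. frechet_derivative \<phi> (at x) b *\<^sub>R b)"
  unfolding is_weak_grad_def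
proof (intro ballI)
  fix \<psi> and b :: 'a assume \<psi>: "\<psi> \<in> test_funs \<Omega>" and b: "b \<in> Basis"
  let ?d = "\<lambda>x. \<phi> x * frechet_derivative \<psi> (at x) b + frechet_derivative \<phi> (at x) b * \<psi> x"
  note smooth = test_funs_smooth[OF \<phi>] test_funs_smooth[OF \<psi>]
  have d_cont: "continuous_on UNIV ?d"
    using smooth b by (intro continuous_intros smooth_fun_continuous smooth_fun_partial)
  have "(\<integral>x. ?d x \<partial>lborel) = 0"
  proof (rule integral_partial_derivative_zero[where K = \<Omega> and f = "\<lambda>x. \<phi> x * \<psi> x" and b = b
        and f' = "\<lambda>x h. \<phi> x * frechet_derivative \<psi> (at x) h + frechet_derivative \<phi> (at x) h * \<psi> x"])
    show "((\<lambda>x. \<phi> x * \<psi> x) has_derivative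
        (\<lambda>h. \<phi> x * frechet_derivative \<psi> (at x) h + frechet_derivative \<phi> (at x) h * \<psi> x)) (at x)" for x
      by (intro has_derivative_mult smooth_fun_has_derivative smooth)
  qed (use d_cont bounded_dom test_funs_outside[OF \<phi>] in auto)
  also have "(\<integral>x. ?d x \<partial>lborel) = (\<integral>x. ?d x \<partial>lebesgue)"
    using borel_measurable_continuous_onI[OF d_cont] by (intro integral_completion[symmetric]) simp
  also have "\<dots> = integral\<^sup>L (lebesgue_on \<Omega>) ?d"
    using test_funs_outside[OF \<phi>] test_funs_outside[OF \<psi>]
    by (subst integral_restrict_space) (auto intro!: Bochner_Integration.integral_cong simp: indicator_def)
  also have "\<dots> = integral\<^sup>L (lebesgue_on \<Omega>) (\<lambda>x. \<phi> x * frechet_derivative \<psi> (at x) b)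
      + integral\<^sup>L (lebesgue_on \<Omega>) (\<lambda>x. frechet_derivative \<phi> (at x) b * \<psi> x)"
    using Ltwo_inner_integrable[OF test_funs_Ltwo[OF \<phi>] test_funs_partial_Ltwo[OF \<psi> b]]
      Ltwo_inner_integrable[OF test_funs_partial_Ltwo[OF \<phi> b] test_funs_Ltwo[OF \<psi>]] by simp
  finally show "integral\<^sup>L (lebesgue_on \<Omega>) (\<lambda>x. \<phi> x * frechet_derivative \<psi> (at x) b) =
      - integral\<^sup>L (lebesgue_on \<Omega>) (\<lambda>x. ((\<Sum>b\<in>Basis. frechet_derivative \<phi> (at x) b *\<^sub>R b) \<bullet> b) * \<psi> x)"
    using b by (simp add: inner_sum_left inner_Basis if_distrib cong: if_cong)
qed

text \<open>
  Without this the norm of \<open>v - \<phi>\<^sub>n\<close> in the definition of \<open>Hone0\<close> would involve the gradient of a function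
  that need not have one, and \<open>Hone0\<close> could not be shown to be a linear space.
\<close>

lemma test_funs_Hone:
  assumes "\<phi> \<in> test_funs \<Omega>"
  shows "\<phi> \<in> Hone \<Omega>"
proof -
  have "(\<lambda>x. \<Sum>b\<in>Basis. frechet_derivative \<phi> (at x) b *\<^sub>R b) \<in> Ltwo \<Omega>"
    using assms by (intro continuous_Ltwo continuous_intros smooth_fun_continuous smooth_fun_partial test_funs_smooth)
  then show ?thesis using test_funs_weak_grad test_funs_Ltwo assms by (auto simp: Hone_def)
qed

lemma Hone_lincomb:
  assumes "v \<in> Hone \<Omega>" "w \<in> Hone \<Omega>"
  shows "(\<lambda>x. c * v x + d * w x) \<in> Hone \<Omega>"
proof -
  have "(\<lambda>x. c *\<^sub>R wgrad \<Omega> v x + d *\<^sub>R wgrad \<Omega> w x) \<in> Ltwo \<Omega>"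
    by (intro Ltwo_scaleR_add wgrad_weak assms)
  moreover have "is_weak_grad \<Omega> (\<lambda>x. c * v x + d * w x) (\<lambda>x. c *\<^sub>R wgrad \<Omega> v x + d *\<^sub>R wgrad \<Omega> w x)"
    by (intro is_weak_grad_lincomb wgrad_weak Hone_Ltwo assms)
  ultimately show ?thesis using assms Ltwo_lincomb by (auto simp: Hone_def)
qed

lemma wgrad_lincomb:
  assumes "v \<in> Hone \<Omega>" "w \<in> Hone \<Omega>"
  shows "AE x in lebesgue_on \<Omega>. wgrad \<Omega> (\<lambda>x. c * v x + d * w x) x = c *\<^sub>R wgrad \<Omega> v x + d *\<^sub>R wgrad \<Omega> w x"
  by (rule weak_grad_unique[where v = "\<lambda>x. c * v x + d * w x"])
     (intro Ltwo_scaleR_add is_weak_grad_lincomb wgrad_weak Hone_lincomb Hone_Ltwo assms)+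

end

section \<open>The spaces \<open>H\<^sub>0\<^sup>1\<close> and \<open>V\<^sub>h\<close>\<close>

abbreviation dirichlet :: "'a::euclidean_space set \<Rightarrow> ('a \<Rightarrow> real) \<Rightarrow> ('a \<Rightarrow> real) \<Rightarrow> real" where
  "dirichlet \<Omega> v w \<equiv> l2inner \<Omega> (wgrad \<Omega> v) (wgrad \<Omega> w)"

lemma fe_space_Hone0: "v \<in> fe_space \<Omega> \<T> \<Longrightarrow> v \<in> Hone0 \<Omega>"
  by (simp add: fe_space_def)

lemma Hone0_Hone: "v \<in> Hone0 \<Omega> \<Longrightarrow> v \<in> Hone \<Omega>"
  by (simp add: Hone0_def)

lemma fe_space_Hone: "v \<in> fe_space \<Omega> \<T> \<Longrightarrow> v \<in> Hone \<Omega>"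
  by (simp add: fe_space_def Hone0_def)

lemma fe_space_Ltwo: "v \<in> fe_space \<Omega> \<T> \<Longrightarrow> v \<in> Ltwo \<Omega>"
  by (simp add: fe_space_def Hone0_def Hone_def)

lemma h1norm_nonneg [simp]: "0 \<le> h1norm \<Omega> v"
  by (simp add: h1norm_def)

context
  fixes \<Omega> :: "'a::euclidean_space set"
  assumes open_dom: "open \<Omega>" and bounded_dom: "bounded \<Omega>"
begin

lemma dirichlet_lincomb_left:
  assumes "v \<in> Hone \<Omega>" "w \<in> Hone \<Omega>" "z \<in> Hone \<Omega>"
  shows "dirichlet \<Omega> (\<lambda>x. c * v x + d * w x) z = c * dirichlet \<Omega> v z + d * dirichlet \<Omega> w z"
proof -
  note [simp] = wgrad_weak(1)
  have "dirichlet \<Omega> (\<lambda>x. c * v x + d * w x) z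
      = l2inner \<Omega> (\<lambda>x. c *\<^sub>R wgrad \<Omega> v x + d *\<^sub>R wgrad \<Omega> w x) (wgrad \<Omega> z)"
    by (intro l2inner_AE_cong wgrad_lincomb[OF open_dom bounded_dom] Hone_lincomb[OF open_dom bounded_dom]
        wgrad_weak(1) Ltwo_scaleR_add AE_I2 refl assms)
  then show ?thesis using assms by (simp add: l2inner_scaleR_add_left)
qed

lemma h1norm_lincomb:
  assumes "v \<in> Hone \<Omega>" "w \<in> Hone \<Omega>"
  shows "h1norm \<Omega> (\<lambda>x. c * v x + d * w x) \<le> \<bar>c\<bar> * h1norm \<Omega> v + \<bar>d\<bar> * h1norm \<Omega> w"
proof -
  note W [simp] = wgrad_weak(1)
  have scaled: "(\<lambda>x. c *\<^sub>R wgrad \<Omega> v x) \<in> Ltwo \<Omega>" "(\<lambda>x. d *\<^sub>R wgrad \<Omega> w x) \<in> Ltwo \<Omega>"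
    using Ltwo_scaleR_add[OF W[OF assms(1)] W[OF assms(1)], of c 0]
      Ltwo_scaleR_add[OF W[OF assms(2)] W[OF assms(2)], of d 0] by simp_all
  have "l2norm \<Omega> (wgrad \<Omega> (\<lambda>x. c * v x + d * w x))
      = l2norm \<Omega> (\<lambda>x. c *\<^sub>R wgrad \<Omega> v x + d *\<^sub>R wgrad \<Omega> w x)"
    by (intro l2norm_AE_cong wgrad_lincomb[OF open_dom bounded_dom] Hone_lincomb[OF open_dom bounded_dom]
        wgrad_weak(1) Ltwo_scaleR_add assms)
  also have "\<dots> \<le> \<bar>c\<bar> * l2norm \<Omega> (wgrad \<Omega> v) + \<bar>d\<bar> * l2norm \<Omega> (wgrad \<Omega> w)"
    using l2norm_triangle[OF scaled] unfolding l2norm_scaleR .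
  finally have grad: "l2norm \<Omega> (wgrad \<Omega> (\<lambda>x. c * v x + d * w x))
      \<le> \<bar>c\<bar> * l2norm \<Omega> (wgrad \<Omega> v) + \<bar>d\<bar> * l2norm \<Omega> (wgrad \<Omega> w)" .
  have "h1norm \<Omega> (\<lambda>x. c * v x + d * w x)
      \<le> sqrt ((\<bar>c\<bar> * l2norm \<Omega> v + \<bar>d\<bar> * l2norm \<Omega> w)\<^sup>2
          + (\<bar>c\<bar> * l2norm \<Omega> (wgrad \<Omega> v) + \<bar>d\<bar> * l2norm \<Omega> (wgrad \<Omega> w))\<^sup>2)"
    unfolding h1norm_def
    by (intro real_sqrt_le_mono add_mono power_mono l2norm_lincomb grad l2norm_nonneg
        Hone_Ltwo assms)
  also have "\<dots> \<le> sqrt ((\<bar>c\<bar> * l2norm \<Omega> v)\<^sup>2 + (\<bar>c\<bar> * l2norm \<Omega> (wgrad \<Omega> v))\<^sup>2)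
      + sqrt ((\<bar>d\<bar> * l2norm \<Omega> w)\<^sup>2 + (\<bar>d\<bar> * l2norm \<Omega> (wgrad \<Omega> w))\<^sup>2)"
    by (rule real_sqrt_sum_squares_triangle_ineq)
  also have "\<dots> = \<bar>c\<bar> * h1norm \<Omega> v + \<bar>d\<bar> * h1norm \<Omega> w"
    unfolding h1norm_def power_mult_distrib distrib_left[symmetric] real_sqrt_mult by simp
  finally show ?thesis .
qed

lemma Hone0_lincomb:
  assumes "v \<in> Hone0 \<Omega>" "w \<in> Hone0 \<Omega>"
  shows "(\<lambda>x. c * v x + d * w x) \<in> Hone0 \<Omega>"
proof -
  from assms obtain \<phi> \<psi> where \<phi>: "\<And>n::nat. \<phi> n \<in> test_funs \<Omega>" "(\<lambda>n. h1norm \<Omega> (\<lambda>x. v x - \<phi> n x)) \<longlonglongrightarrow> 0"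
    and \<psi>: "\<And>n::nat. \<psi> n \<in> test_funs \<Omega>" "(\<lambda>n. h1norm \<Omega> (\<lambda>x. w x - \<psi> n x)) \<longlonglongrightarrow> 0"
    by (auto simp: Hone0_def)
  have "v \<in> Hone \<Omega>" "w \<in> Hone \<Omega>" using assms by (auto simp: Hone0_def)
  have H: "(\<lambda>x. v x - \<phi> n x) \<in> Hone \<Omega>" "(\<lambda>x. w x - \<psi> n x) \<in> Hone \<Omega>" for n
    using Hone_lincomb[OF open_dom bounded_dom \<open>v \<in> Hone \<Omega>\<close> test_funs_Hone[OF open_dom bounded_dom \<phi>(1)], of 1 "-1" n]
      Hone_lincomb[OF open_dom bounded_dom \<open>w \<in> Hone \<Omega>\<close> test_funs_Hone[OF open_dom bounded_dom \<psi>(1)], of 1 "-1" n]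
    by simp_all
  have "(\<lambda>n. h1norm \<Omega> (\<lambda>x. (c * v x + d * w x) - (c * \<phi> n x + d * \<psi> n x))) \<longlonglongrightarrow> 0"
  proof (rule tendsto_sandwich[OF _ _ tendsto_const])
    have "(\<lambda>x. (c * v x + d * w x) - (c * \<phi> n x + d * \<psi> n x))
        = (\<lambda>x. c * (v x - \<phi> n x) + d * (w x - \<psi> n x))" for n
      by (simp add: algebra_simps)
    then show "\<forall>\<^sub>F n in sequentially. h1norm \<Omega> (\<lambda>x. (c * v x + d * w x) - (c * \<phi> n x + d * \<psi> n x))
        \<le> \<bar>c\<bar> * h1norm \<Omega> (\<lambda>x. v x - \<phi> n x) + \<bar>d\<bar> * h1norm \<Omega> (\<lambda>x. w x - \<psi> n x)"
      using h1norm_lincomb[OF H] by simp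
    have "(\<lambda>n. \<bar>c\<bar> * h1norm \<Omega> (\<lambda>x. v x - \<phi> n x) + \<bar>d\<bar> * h1norm \<Omega> (\<lambda>x. w x - \<psi> n x)) \<longlonglongrightarrow> \<bar>c\<bar> * 0 + \<bar>d\<bar> * 0"
      by (intro tendsto_intros \<phi> \<psi>)
    then show "(\<lambda>n. \<bar>c\<bar> * h1norm \<Omega> (\<lambda>x. v x - \<phi> n x) + \<bar>d\<bar> * h1norm \<Omega> (\<lambda>x. w x - \<psi> n x)) \<longlonglongrightarrow> 0" by simp
  qed simp
  moreover have "(\<lambda>x. c * \<phi> n x + d * \<psi> n x) \<in> test_funs \<Omega>" for n by (intro test_funs_lincomb \<phi> \<psi>)
  moreover have "(\<lambda>x. c * v x + d * w x) \<in> Hone \<Omega>"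
    using assms by (intro Hone_lincomb[OF open_dom bounded_dom] Hone0_Hone)
  ultimately show ?thesis
    unfolding Hone0_def by (intro CollectI conjI exI[of _ "\<lambda>n x. c * \<phi> n x + d * \<psi> n x"]) auto
qed

lemma fe_space_lincomb:
  assumes "v \<in> fe_space \<Omega> \<T>" "w \<in> fe_space \<Omega> \<T>"
  shows "(\<lambda>x. c * v x + d * w x) \<in> fe_space \<Omega> \<T>"
proof -
  have "\<exists>\<alpha> \<beta>. \<forall>x\<in>K. c * v x + d * w x = \<alpha> + \<beta> \<bullet> x" if K: "K \<in> \<T>" for K
  proof -
    have "\<exists>\<alpha> \<beta>. \<forall>x\<in>K. v x = \<alpha> + \<beta> \<bullet> x" "\<exists>\<alpha> \<beta>. \<forall>x\<in>K. w x = \<alpha> + \<beta> \<bullet> x"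
      using assms K by (auto simp: fe_space_def)
    then obtain \<alpha> \<beta> \<alpha>' \<beta>' where "\<forall>x\<in>K. v x = \<alpha> + \<beta> \<bullet> x" "\<forall>x\<in>K. w x = \<alpha>' + \<beta>' \<bullet> x"
      by blast
    then have "\<forall>x\<in>K. c * v x + d * w x = (c * \<alpha> + d * \<alpha>') + (c *\<^sub>R \<beta> + d *\<^sub>R \<beta>') \<bullet> x"
      by (auto simp: algebra_simps inner_add_left)
    then show ?thesis by blast
  qed
  then show ?thesis using assms Hone0_lincomb by (auto simp: fe_space_def)
qed

end

text \<open>
  An affine function on a simplex that vanishes at the vertices vanishes on the simplex, so the
  vertices of the mesh serve as \<open>N\<close>.
\<close>

lemma fe_space_finitely_determined:
  fixes \<Omega> :: "'a::euclidean_space set"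
  assumes "mesh_of \<Omega> h \<T>"
  obtains N where "finite N" "\<And>v x. v \<in> fe_space \<Omega> \<T> \<Longrightarrow> \<forall>p\<in>N. v p = 0 \<Longrightarrow> x \<in> \<Omega> \<Longrightarrow> v x = 0"
proof -
  have "\<exists>C. finite C \<and> K = convex hull C" if "K \<in> \<T>" for K
  proof -
    have "int DIM('a) simplex K" using assms that by (simp add: mesh_of_def)
    then show ?thesis using aff_independent_finite unfolding simplex_def by blast
  qed
  then have "\<forall>K\<in>\<T>. \<exists>C. finite C \<and> K = convex hull C" by blast
  from bchoice[OF this] obtain C
    where C: "\<And>K. K \<in> \<T> \<Longrightarrow> finite (C K)" "\<And>K. K \<in> \<T> \<Longrightarrow> K = convex hull (C K)" by blast
  show ?thesis
  proof
    show "finite (\<Union>K\<in>\<T>. C K)" using assms C by (auto simp: mesh_of_def triangulation_def)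
    fix v x assume v: "v \<in> fe_space \<Omega> \<T>" "\<forall>p\<in>\<Union>K\<in>\<T>. C K. v p = 0" and "x \<in> \<Omega>"
    then have "x \<in> \<Union>\<T>" using assms closure_subset[of \<Omega>] by (auto simp: mesh_of_def)
    then obtain K where K: "K \<in> \<T>" "x \<in> K" by blast
    obtain \<alpha> \<beta> where ab: "\<And>x. x \<in> K \<Longrightarrow> v x = \<alpha> + \<beta> \<bullet> x" using v(1) K(1) unfolding fe_space_def by blast
    have "C K \<subseteq> {y. \<beta> \<bullet> y = - \<alpha>}"
    proof
      fix y assume "y \<in> C K"
      then have "y \<in> convex hull (C K)" by (rule hull_inc)
      then have "y \<in> K" using C(2)[OF K(1)] by simp
      then show "y \<in> {y. \<beta> \<bullet> y = - \<alpha>}" using ab[of y] v(2) K(1) \<open>y \<in> C K\<close> by auto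
    qed
    then have "convex hull (C K) \<subseteq> {y. \<beta> \<bullet> y = - \<alpha>}" by (intro hull_minimal convex_hyperplane)
    then have "x \<in> {y. \<beta> \<bullet> y = - \<alpha>}" using K(2) C(2)[OF K(1)] by blast
    then show "v x = 0" using ab[OF K(2)] by simp
  qed
qed

text \<open>
  The Riesz representation theorem for a space of functions of finite dimension. Finite dimension
  is expressed by a finite set \<open>N\<close> of points that determines the functions, and the proof is an induction
  on \<open>N\<close>: the functions of \<open>W\<close> that vanish at a point \<open>p\<close> form a space determined by the other points, and a
  single function \<open>g\<close> with \<open>g p = 1\<close>, made \<open>B\<close>-orthogonal to that space, spans the rest.
  The form \<open>B\<close> is allowed to degenerate, because functions that represent the same element of \<open>L\<^sup>2(\<Omega>)\<close>
  may differ off \<open>\<Omega>\<close>; the functional \<open>L\<close> then has to vanish wherever \<open>B\<close> does.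
\<close>

lemma riesz_on_finitely_determined_space:
  fixes W :: "('a \<Rightarrow> real) set"
  assumes "finite N" and "W \<noteq> {}"
    and W: "\<And>v w c d. v \<in> W \<Longrightarrow> w \<in> W \<Longrightarrow> (\<lambda>x. c * v x + d * w x) \<in> W"
    and B_lin: "\<And>u v w c d. u \<in> W \<Longrightarrow> v \<in> W \<Longrightarrow> w \<in> W \<Longrightarrow> B (\<lambda>x. c * u x + d * v x) w = c * B u w + d * B v w"
    and B_sym: "\<And>v w. v \<in> W \<Longrightarrow> w \<in> W \<Longrightarrow> B v w = B w v"
    and B_deg: "\<And>v w. v \<in> W \<Longrightarrow> w \<in> W \<Longrightarrow> B v v = 0 \<Longrightarrow> B v w = 0"
    and det: "\<And>v. v \<in> W \<Longrightarrow> \<forall>p\<in>N. v p = 0 \<Longrightarrow> B v v = 0"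
    and L_lin: "\<And>v w c d. v \<in> W \<Longrightarrow> w \<in> W \<Longrightarrow> L (\<lambda>x. c * v x + d * w x) = c * L v + d * L w"
    and L_deg: "\<And>v. v \<in> W \<Longrightarrow> B v v = 0 \<Longrightarrow> L v = (0::real)"
  shows "\<exists>r\<in>W. \<forall>w\<in>W. B r w = L w"
  using assms
proof (induction N arbitrary: W L rule: finite_induct)
  case empty
  then obtain r where r: "r \<in> W" by blast
  have deg: "B v v = 0" if "v \<in> W" for v by (rule empty.prems(6)[OF that]) simp
  have "B r w = L w" if "w \<in> W" for w
    using empty.prems(5)[OF r that deg[OF r]] empty.prems(8)[OF that deg[OF that]] by simp
  then show ?case using r by blast
next
  case (insert p N)
  note W = insert.prems(2) and B_lin = insert.prems(3) and B_sym = insert.prems(4)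
    and B_deg = insert.prems(5) and det = insert.prems(6) and L_lin = insert.prems(7) and L_deg = insert.prems(8)
  define W0 where "W0 = {v \<in> W. v p = 0}"
  have sub: "v \<in> W0 \<Longrightarrow> v \<in> W" for v by (simp add: W0_def)
  obtain z where "z \<in> W" using insert.prems(1) by blast
  then have "(\<lambda>x. 0 * z x + 0 * z x) \<in> W0" using W[of z z 0 0] by (simp add: W0_def)
  then have ne: "W0 \<noteq> {}" by blast
  have IH: "\<exists>r\<in>W0. \<forall>w\<in>W0. B r w = F w"
    if F_lin: "\<And>v w c d. v \<in> W \<Longrightarrow> w \<in> W \<Longrightarrow> F (\<lambda>x. c * v x + d * w x) = c * F v + d * F w"
      and F_deg: "\<And>v. v \<in> W \<Longrightarrow> B v v = 0 \<Longrightarrow> F v = 0" for F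
  proof (rule insert.IH[OF ne])
    show "(\<lambda>x. c * v x + d * w x) \<in> W0" if "v \<in> W0" "w \<in> W0" for v w c d
      using that W by (simp add: W0_def)
    show "B v v = 0" if "v \<in> W0" "\<forall>p\<in>N. v p = 0" for v
      using that det by (simp add: W0_def)
  qed (rule B_lin B_sym B_deg F_lin F_deg; (rule sub)?; assumption)+
  have "\<exists>r\<in>W0. \<forall>w\<in>W0. B r w = L w" by (rule IH) (rule L_lin L_deg; assumption)+
  then obtain r0 where r0: "r0 \<in> W0" "\<And>w. w \<in> W0 \<Longrightarrow> B r0 w = L w" by blast
  show ?case
  proof (cases "W0 = W")
    case True
    then show ?thesis using r0 by blast
  next
    case False
    then obtain e0 where e0: "e0 \<in> W" "e0 p \<noteq> 0" by (auto simp: W0_def)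
    define e where "e = (\<lambda>x. (1 / e0 p) * e0 x + 0 * e0 x)"
    have e: "e \<in> W" "e p = 1" unfolding e_def by (rule W[OF e0(1) e0(1)]) (use e0(2) in simp)
    have Be_lin: "B e (\<lambda>x. c * v x + d * w x) = c * B e v + d * B e w" if "v \<in> W" "w \<in> W" for v w c d
    proof -
      have "B e (\<lambda>x. c * v x + d * w x) = B (\<lambda>x. c * v x + d * w x) e"
        by (rule B_sym[OF e(1) W[OF that]])
      also have "\<dots> = c * B v e + d * B w e" by (rule B_lin[OF that e(1)])
      finally show ?thesis unfolding B_sym[OF that(1) e(1)] B_sym[OF that(2) e(1)] .
    qed
    have Be_deg: "B e v = 0" if "v \<in> W" "B v v = 0" for v
      using B_deg[OF that(1) e(1) that(2)] unfolding B_sym[OF that(1) e(1)] .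
    have "\<exists>r\<in>W0. \<forall>w\<in>W0. B r w = B e w" by (rule IH) (rule Be_lin Be_deg; assumption)+
    then obtain e' where e': "e' \<in> W0" "\<And>w. w \<in> W0 \<Longrightarrow> B e' w = B e w" by blast
    define g where "g = (\<lambda>x. 1 * e x + (-1) * e' x)"
    have g: "g \<in> W" "g p = 1"
      unfolding g_def by (rule W[OF e(1) sub[OF e'(1)]]) (use e(2) e'(1) in \<open>simp add: W0_def\<close>)
    have Bg: "B g w = 0" if "w \<in> W0" for w
      unfolding g_def using B_lin[OF e(1) sub[OF e'(1)] sub[OF that], of 1 "-1"] e'(2)[OF that] by simp
    \<comment> \<open>if \<open>B g g = 0\<close>, then \<open>L g = 0\<close> and the value \<open>\<gamma> = 0\<close> of the division by zero is the right one\<close>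
    define \<gamma> where "\<gamma> = L g / B g g"
    have \<gamma>: "\<gamma> * B g g = L g" using L_deg[OF g(1)] by (auto simp: \<gamma>_def)
    define r where "r = (\<lambda>x. 1 * r0 x + \<gamma> * g x)"
    have r: "r \<in> W" unfolding r_def by (intro W sub r0 g)
    have "B r w = L w" if w: "w \<in> W" for w
    proof -
      define w0 where "w0 = (\<lambda>x. 1 * w x + (- w p) * g x)"
      have w0: "w0 \<in> W0" using W[OF w g(1), of 1 "- w p"] g(2) by (simp add: w0_def W0_def)
      have w_eq: "w = (\<lambda>x. 1 * w0 x + w p * g x)" by (simp add: w0_def)
      have "B r0 w = B w r0" using B_sym w sub[OF r0(1)] by blast
      also have "\<dots> = 1 * B w0 r0 + w p * B g r0"
        by (subst w_eq) (rule B_lin[OF sub[OF w0] g(1) sub[OF r0(1)]])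
      also have "\<dots> = L w0"
        using Bg[OF r0(1)] r0(2)[OF w0] B_sym[OF sub[OF w0] sub[OF r0(1)]] by simp
      finally have 1: "B r0 w = L w0" .
      have "B g w = B w g" using B_sym w g(1) by blast
      also have "\<dots> = 1 * B w0 g + w p * B g g"
        by (subst w_eq) (rule B_lin[OF sub[OF w0] g(1) g(1)])
      also have "\<dots> = w p * B g g" using Bg[OF w0] B_sym[OF sub[OF w0] g(1)] by simp
      finally have 2: "B g w = w p * B g g" .
      have "L w = 1 * L w0 + w p * L g"
        by (subst w_eq) (rule L_lin[OF sub[OF w0] g(1)])
      then show ?thesis
        unfolding r_def B_lin[OF sub[OF r0(1)] g(1) w] 1 2 using \<gamma> by (simp add: mult.left_commute)
    qed
    then show ?thesis using r by blast
  qed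
qed

section \<open>The pairing of measures with Lipschitz functions\<close>

text \<open>
  Pairing with a fixed \<open>g\<close> turns the vector measure into a scalar one, by the Cauchy--Schwarz inequality.
  The additivity that is needed below holds for \<open>q\<close> itself only up to null sets, but for these scalar
  measures it holds exactly.
\<close>

lemma vector_measure_inner_sums:
  assumes q: "q \<in> vector_measures J \<omega>" and g: "g \<in> Ltwo \<omega>"
    and A: "range A \<subseteq> sets borel" "\<And>i. A i \<subseteq> J" "disjoint_family A"
  shows "(\<lambda>i. l2inner \<omega> (q (A i)) g) sums l2inner \<omega> (q (\<Union>i. A i)) g"
proof -
  have qA: "q (A i) \<in> Ltwo \<omega>" for i
    using q A(1) A(2)[of i] unfolding vector_measures_def by blast
  have "(\<Union>i. A i) \<in> sets borel" "(\<Union>i. A i) \<subseteq> J" using A by auto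
  then have qU: "q (\<Union>i. A i) \<in> Ltwo \<omega>" using q unfolding vector_measures_def by blast
  have conv: "(\<lambda>n. l2norm \<omega> (\<lambda>x. q (\<Union>i. A i) x - (\<Sum>i<n. q (A i) x))) \<longlonglongrightarrow> 0"
    using q A unfolding vector_measures_def by blast
  have "(\<lambda>n. l2inner \<omega> (q (\<Union>i. A i)) g - (\<Sum>i<n. l2inner \<omega> (q (A i)) g)) \<longlonglongrightarrow> 0"
  proof (rule Lim_null_comparison)
    have "\<bar>l2inner \<omega> (q (\<Union>i. A i)) g - (\<Sum>i<n. l2inner \<omega> (q (A i)) g)\<bar>
        \<le> l2norm \<omega> (\<lambda>x. q (\<Union>i. A i) x - (\<Sum>i<n. q (A i) x)) * l2norm \<omega> g" for n
    proof -
      have S: "(\<lambda>x. \<Sum>i<n. q (A i) x) \<in> Ltwo \<omega>" by (intro Ltwo_sum qA)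
      have "l2inner \<omega> (q (\<Union>i. A i)) g - (\<Sum>i<n. l2inner \<omega> (q (A i)) g)
          = l2inner \<omega> (\<lambda>x. q (\<Union>i. A i) x - (\<Sum>i<n. q (A i) x)) g"
        unfolding l2inner_diff_left[OF qU S g] l2inner_sum_left[OF qA g] ..
      then show ?thesis using l2inner_Cauchy_Schwarz[OF Ltwo_diff[OF qU S] g] by simp
    qed
    then show "\<forall>\<^sub>F n in sequentially. norm (l2inner \<omega> (q (\<Union>i. A i)) g - (\<Sum>i<n. l2inner \<omega> (q (A i)) g))
        \<le> l2norm \<omega> (\<lambda>x. q (\<Union>i. A i) x - (\<Sum>i<n. q (A i) x)) * l2norm \<omega> g" by simp
    show "(\<lambda>n. l2norm \<omega> (\<lambda>x. q (\<Union>i. A i) x - (\<Sum>i<n. q (A i) x)) * l2norm \<omega> g) \<longlonglongrightarrow> 0"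
      using tendsto_mult_right[OF conv, of "l2norm \<omega> g"] by simp
  qed
  from tendsto_diff[OF tendsto_const this, of "l2inner \<omega> (q (\<Union>i. A i)) g"]
  show ?thesis by (simp add: sums_def)
qed

text \<open>
  A constant sequence is summable only if it is zero.
\<close>

lemma vector_measure_inner_empty:
  assumes "q \<in> vector_measures J \<omega>" "g \<in> Ltwo \<omega>"
  shows "l2inner \<omega> (q {}) g = 0"
proof -
  have "(\<lambda>i::nat. l2inner \<omega> (q {}) g) sums l2inner \<omega> (q {}) g"
    using vector_measure_inner_sums[OF assms, of "\<lambda>i. {}"] by (simp add: disjoint_family_on_def)
  then have "summable (\<lambda>i::nat. l2inner \<omega> (q {}) g)" by (rule sums_summable)
  then show ?thesis by (simp only: summable_const_iff)
qed

lemma vector_measure_inner_Un: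
  assumes q: "q \<in> vector_measures J \<omega>" and g: "g \<in> Ltwo \<omega>"
    and AB: "A \<in> sets borel" "B \<in> sets borel" "A \<subseteq> J" "B \<subseteq> J" "A \<inter> B = {}"
  shows "l2inner \<omega> (q (A \<union> B)) g = l2inner \<omega> (q A) g + l2inner \<omega> (q B) g"
proof -
  have "(\<lambda>i. l2inner \<omega> (q (binaryset A B i)) g) sums l2inner \<omega> (q (\<Union>i. binaryset A B i)) g"
    using AB by (intro vector_measure_inner_sums[OF q g])
      (auto simp: range_binaryset_eq disjoint_family_on_def binaryset_def)
  moreover have "(\<lambda>i. l2inner \<omega> (q (binaryset A B i)) g) sums (l2inner \<omega> (q A) g + l2inner \<omega> (q B) g)"
    using binaryset_sums[of "\<lambda>E. l2inner \<omega> (q E) g" A B] vector_measure_inner_empty[OF q g] by simp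
  ultimately show ?thesis unfolding UN_binaryset_eq by (rule sums_unique2)
qed

lemma vector_measure_inner_UN:
  assumes q: "q \<in> vector_measures J \<omega>" and g: "g \<in> Ltwo \<omega>"
    and "finite I" and "\<And>i. i \<in> I \<Longrightarrow> A i \<in> sets borel \<and> A i \<subseteq> J" "disjoint_family_on A I"
  shows "l2inner \<omega> (q (\<Union>i\<in>I. A i)) g = (\<Sum>i\<in>I. l2inner \<omega> (q (A i)) g)"
  using assms(3-)
proof (induction I)
  case empty
  then show ?case using vector_measure_inner_empty[OF q g] by simp
next
  case (insert i I)
  have "A i \<inter> (\<Union>j\<in>I. A j) = {}"
    using insert.prems(2) insert.hyps(2) by (auto simp: disjoint_family_on_def)
  moreover have "(\<Union>j\<in>I. A j) \<in> sets borel"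
    using insert by (intro sets.finite_UN) auto
  ultimately have "l2inner \<omega> (q (A i \<union> (\<Union>j\<in>I. A j))) g = l2inner \<omega> (q (A i)) g + l2inner \<omega> (q (\<Union>j\<in>I. A j)) g"
    using insert.prems(1) by (intro vector_measure_inner_Un[OF q g]) auto
  moreover have "disjoint_family_on A I" using insert.prems(2) by (auto simp: disjoint_family_on_def)
  ultimately show ?case using insert by simp
qed

lemma partition_sum_le_total_variation:
  assumes "q \<in> vector_measures J \<omega>" "borel_partition J P"
  shows "(\<Sum>E\<in>P. l2norm \<omega> (q E)) \<le> total_variation J \<omega> q"
  unfolding total_variation_def
  using assms by (intro cSUP_upper) (auto simp: vector_measures_def)

text \<open>
  The interval is cut into the sets on which \<open>x / (\<delta> / 2)\<close> has a given integer part; only finitely many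
  of these are nonempty, and the empty ones do not occur among the images.
\<close>

lemma fine_borel_partition:
  assumes "0 < \<delta>"
  obtains P \<xi> where "borel_partition {a..b::real} P" "\<And>E. E \<in> P \<Longrightarrow> \<xi> E \<in> E" "\<And>E. E \<in> P \<Longrightarrow> diameter E < \<delta>"
proof -
  define k where "k x = \<lfloor>x / (\<delta> / 2)\<rfloor>" for x :: real
  define P where "P = (\<lambda>i. {x \<in> {a..b}. k x = i}) ` k ` {a..b}"
  have "k ` {a..b} \<subseteq> {k a..k b}"
  proof -
    have "k x \<le> k y" if "x \<le> y" for x y
      unfolding k_def using assms that by (intro floor_mono divide_right_mono) auto
    then show ?thesis by auto
  qed
  then have "finite (k ` {a..b})" by (rule finite_subset) simp
  then have "finite P" unfolding P_def by (rule finite_imageI)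
  moreover have "partition_on {a..b} P"
    by (rule partition_onI) (auto simp: P_def disjnt_def)
  moreover have "P \<subseteq> sets borel"
  proof
    fix E assume "E \<in> P"
    then obtain i where "E = {x \<in> {a..b}. k x = i}" by (auto simp: P_def)
    then have E: "E = {a..b} \<inter> {x. k x = i}" by auto
    have k_eq: "(k x = i) = (i * (\<delta> / 2) \<le> x \<and> x < (i + 1) * (\<delta> / 2))" for x
    proof -
      have "0 < \<delta> / 2" using assms by simp
      then show ?thesis
        unfolding k_def floor_eq_iff by (simp only: pos_le_divide_eq pos_divide_less_eq of_int_add of_int_1)
    qed
    have "E = {a..b} \<inter> {i * (\<delta> / 2)..<(i + 1) * (\<delta> / 2)}"
      unfolding E by (intro set_eqI) (simp only: Int_iff mem_Collect_eq atLeastLessThan_iff k_eq)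
    also have "\<dots> \<in> sets borel" by (intro sets.Int) auto
    finally show "E \<in> sets borel" .
  qed
  ultimately have part: "borel_partition {a..b} P" by (simp add: borel_partition_def)
  have tag: "(SOME x. x \<in> E) \<in> E" if E: "E \<in> P" for E
  proof -
    have "E \<noteq> {}" using E by (auto simp: P_def)
    then show ?thesis by (simp add: some_in_eq)
  qed
  have diam: "diameter E < \<delta>" if "E \<in> P" for E
  proof -
    have "diameter E \<le> \<delta> / 2"
    proof (rule diameter_le)
      fix x y assume "x \<in> E" "y \<in> E"
      then have "k x = k y" using that by (auto simp: P_def)
      then have *: "\<bar>x / (\<delta> / 2) - y / (\<delta> / 2)\<bar> < 1" unfolding k_def by linarith
      have "0 < \<delta> / 2" using assms by simp
      with * show "norm (x - y) \<le> \<delta> / 2"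
        unfolding diff_divide_distrib[symmetric] abs_divide real_norm_def
        by (simp only: abs_of_pos pos_divide_less_eq mult_1 less_imp_le)
    qed (use assms in simp)
    then show ?thesis using assms by simp
  qed
  show thesis by (rule that[of P "\<lambda>E. SOME x. x \<in> E", OF part tag diam])
qed

lemma total_variation_nonneg:
  assumes "q \<in> vector_measures {a..b} \<omega>"
  shows "0 \<le> total_variation {a..b} \<omega> q"
proof -
  obtain P where "borel_partition {a..b} P" by (rule fine_borel_partition[OF zero_less_one, of a b])
  then have "(\<Sum>E\<in>P. l2norm \<omega> (q E)) \<le> total_variation {a..b} \<omega> q"
    using assms by (rule partition_sum_le_total_variation[rotated])
  then show ?thesis using sum_nonneg[of P "\<lambda>E. l2norm \<omega> (q E)"] by simp
qed

text \<open>
  Both sums are rewritten as sums over the common refinement. There the two tags of a cell \<open>E \<inter> F\<close> have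
  distance at most \<open>\<delta> + \<delta>'\<close>, because \<open>E\<close> and \<open>F\<close> share a point, and the norms \<open>\<parallel>q(E \<inter> F)\<parallel>\<close> add
  up to at most the total variation.
\<close>

lemma tagged_sums_close:
  assumes q: "q \<in> vector_measures J \<omega>" and "bounded J" and K: "0 \<le> K" and \<delta>: "0 \<le> \<delta>" "0 \<le> \<delta>'"
    and \<phi>: "\<And>s. s \<in> J \<Longrightarrow> \<phi> s \<in> Ltwo \<omega>"
    and lip: "\<And>s r. s \<in> J \<Longrightarrow> r \<in> J \<Longrightarrow> l2norm \<omega> (\<lambda>x. \<phi> s x - \<phi> r x) \<le> K * \<bar>s - r\<bar>"
    and P: "borel_partition J P" "\<And>E. E \<in> P \<Longrightarrow> \<xi> E \<in> E" "\<And>E. E \<in> P \<Longrightarrow> diameter E < \<delta>"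
    and Q: "borel_partition J Q" "\<And>E. E \<in> Q \<Longrightarrow> \<eta> E \<in> E" "\<And>E. E \<in> Q \<Longrightarrow> diameter E < \<delta>'"
  shows "\<bar>(\<Sum>E\<in>P. l2inner \<omega> (\<phi> (\<xi> E)) (q E)) - (\<Sum>E\<in>Q. l2inner \<omega> (\<phi> (\<eta> E)) (q E))\<bar>
    \<le> K * (\<delta> + \<delta>') * total_variation J \<omega> q"
proof -
  have part: "finite P" "finite Q" "\<Union>P = J" "\<Union>Q = J" "disjoint P" "disjoint Q"
    "P \<subseteq> sets borel" "Q \<subseteq> sets borel"
    using P(1) Q(1) by (auto simp: borel_partition_def partition_on_def)
  have disj: "A \<in> P \<Longrightarrow> B \<in> P \<Longrightarrow> A \<noteq> B \<Longrightarrow> A \<inter> B = {}" "A \<in> Q \<Longrightarrow> B \<in> Q \<Longrightarrow> A \<noteq> B \<Longrightarrow> A \<inter> B = {}" for A B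
    using part(5,6) by (auto simp: disjoint_def)
  have sub: "E \<subseteq> J" "F \<subseteq> J" if "E \<in> P" "F \<in> Q" for E F using part that by auto
  have \<phi>P: "\<phi> (\<xi> E) \<in> Ltwo \<omega>" if "E \<in> P" for E
    using that part(3) P(2)[OF that] by (intro \<phi>) blast
  have \<phi>Q: "\<phi> (\<eta> E) \<in> Ltwo \<omega>" if "E \<in> Q" for E
    using that part(4) Q(2)[OF that] by (intro \<phi>) blast
  have refineP: "l2inner \<omega> (\<phi> (\<xi> E)) (q E) = (\<Sum>F\<in>Q. l2inner \<omega> (\<phi> (\<xi> E)) (q (E \<inter> F)))" if E: "E \<in> P" for E
  proof -
    have "(\<Union>F\<in>Q. E \<inter> F) = E" using part(3,4) E by auto
    moreover have "l2inner \<omega> (q (\<Union>F\<in>Q. E \<inter> F)) (\<phi> (\<xi> E)) = (\<Sum>F\<in>Q. l2inner \<omega> (q (E \<inter> F)) (\<phi> (\<xi> E)))"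
    proof (rule vector_measure_inner_UN[OF q \<phi>P[OF E] part(2)])
      show "E \<inter> F \<in> sets borel \<and> E \<inter> F \<subseteq> J" if "F \<in> Q" for F
        using part(7,8) E that sub(1)[OF E that] by auto
      show "disjoint_family_on (\<lambda>F. E \<inter> F) Q"
        unfolding disjoint_family_on_def
      proof (intro ballI impI)
        fix F G assume "F \<in> Q" "G \<in> Q" "F \<noteq> G"
        from disj(2)[OF this] show "(E \<inter> F) \<inter> (E \<inter> G) = {}" by auto
      qed
    qed
    ultimately show ?thesis by (simp add: l2inner_commute)
  qed
  have refineQ: "l2inner \<omega> (\<phi> (\<eta> F)) (q F) = (\<Sum>E\<in>P. l2inner \<omega> (\<phi> (\<eta> F)) (q (E \<inter> F)))" if F: "F \<in> Q" for F
  proof -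
    have "(\<Union>E\<in>P. E \<inter> F) = F" using part(3,4) F by auto
    moreover have "l2inner \<omega> (q (\<Union>E\<in>P. E \<inter> F)) (\<phi> (\<eta> F)) = (\<Sum>E\<in>P. l2inner \<omega> (q (E \<inter> F)) (\<phi> (\<eta> F)))"
    proof (rule vector_measure_inner_UN[OF q \<phi>Q[OF F] part(1)])
      show "E \<inter> F \<in> sets borel \<and> E \<inter> F \<subseteq> J" if "E \<in> P" for E
        using part(7,8) F that sub(1)[OF that F] by auto
      show "disjoint_family_on (\<lambda>E. E \<inter> F) P"
        unfolding disjoint_family_on_def
      proof (intro ballI impI)
        fix E G assume "E \<in> P" "G \<in> P" "E \<noteq> G"
        from disj(1)[OF this] show "(E \<inter> F) \<inter> (G \<inter> F) = {}" by auto
      qed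
    qed
    ultimately show ?thesis by (simp add: l2inner_commute)
  qed
  define I where "I = {(E, F) \<in> P \<times> Q. E \<inter> F \<noteq> {}}"
  have I: "finite I" "I \<subseteq> P \<times> Q" using part by (auto simp: I_def intro: finite_subset[of _ "P \<times> Q"])
  have term0: "l2inner \<omega> g (q (E \<inter> F)) = 0" if "g \<in> Ltwo \<omega>" "(E, F) \<in> P \<times> Q - I" for g E F
    using that vector_measure_inner_empty[OF q that(1)] by (auto simp: I_def l2inner_commute)
  have sumP: "(\<Sum>E\<in>P. l2inner \<omega> (\<phi> (\<xi> E)) (q E)) = (\<Sum>(E, F)\<in>I. l2inner \<omega> (\<phi> (\<xi> E)) (q (E \<inter> F)))"
  proof -
    have "(\<Sum>E\<in>P. l2inner \<omega> (\<phi> (\<xi> E)) (q E)) = (\<Sum>(E, F)\<in>P \<times> Q. l2inner \<omega> (\<phi> (\<xi> E)) (q (E \<inter> F)))"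
      by (simp add: refineP sum.cartesian_product)
    also have "\<dots> = (\<Sum>(E, F)\<in>I. l2inner \<omega> (\<phi> (\<xi> E)) (q (E \<inter> F)))"
      using I part term0 \<phi>P by (intro sum.mono_neutral_right) auto
    finally show ?thesis .
  qed
  have sumQ: "(\<Sum>F\<in>Q. l2inner \<omega> (\<phi> (\<eta> F)) (q F)) = (\<Sum>(E, F)\<in>I. l2inner \<omega> (\<phi> (\<eta> F)) (q (E \<inter> F)))"
  proof -
    have "(\<Sum>F\<in>Q. l2inner \<omega> (\<phi> (\<eta> F)) (q F)) = (\<Sum>F\<in>Q. \<Sum>E\<in>P. l2inner \<omega> (\<phi> (\<eta> F)) (q (E \<inter> F)))"
      by (simp add: refineQ)
    also have "\<dots> = (\<Sum>(E, F)\<in>P \<times> Q. l2inner \<omega> (\<phi> (\<eta> F)) (q (E \<inter> F)))"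
      by (subst sum.swap) (simp add: sum.cartesian_product)
    also have "\<dots> = (\<Sum>(E, F)\<in>I. l2inner \<omega> (\<phi> (\<eta> F)) (q (E \<inter> F)))"
      using I part term0 \<phi>Q by (intro sum.mono_neutral_right) auto
    finally show ?thesis .
  qed
  have close: "\<bar>l2inner \<omega> (\<phi> (\<xi> E)) (q (E \<inter> F)) - l2inner \<omega> (\<phi> (\<eta> F)) (q (E \<inter> F))\<bar>
      \<le> K * (\<delta> + \<delta>') * l2norm \<omega> (q (E \<inter> F))" if EF: "(E, F) \<in> I" for E F
  proof -
    have E: "E \<in> P" and F: "F \<in> Q" using EF by (auto simp: I_def)
    obtain z where z: "z \<in> E" "z \<in> F" using EF by (auto simp: I_def)
    have "bounded E" "bounded F" using sub[OF E F] \<open>bounded J\<close> bounded_subset by auto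
    then have "dist (\<xi> E) z \<le> diameter E" "dist (\<eta> F) z \<le> diameter F"
      using diameter_bounded_bound P(2)[OF E] Q(2)[OF F] z by blast+
    then have "\<bar>\<xi> E - \<eta> F\<bar> \<le> \<delta> + \<delta>'"
      using P(3)[OF E] Q(3)[OF F] by (simp add: dist_real_def)
    then have "K * \<bar>\<xi> E - \<eta> F\<bar> \<le> K * (\<delta> + \<delta>')" using K by (rule mult_left_mono)
    then have d: "l2norm \<omega> (\<lambda>x. \<phi> (\<xi> E) x - \<phi> (\<eta> F) x) \<le> K * (\<delta> + \<delta>')"
      using lip[of "\<xi> E" "\<eta> F"] P(2)[OF E] Q(2)[OF F] sub[OF E F] by force
    have "E \<inter> F \<in> sets borel" "E \<inter> F \<subseteq> J" using part E F sub by auto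
    then have qEF: "q (E \<inter> F) \<in> Ltwo \<omega>" using q unfolding vector_measures_def by blast
    have "\<bar>l2inner \<omega> (\<lambda>x. \<phi> (\<xi> E) x - \<phi> (\<eta> F) x) (q (E \<inter> F))\<bar>
        \<le> l2norm \<omega> (\<lambda>x. \<phi> (\<xi> E) x - \<phi> (\<eta> F) x) * l2norm \<omega> (q (E \<inter> F))"
      by (intro l2inner_Cauchy_Schwarz Ltwo_diff \<phi>P \<phi>Q E F qEF)
    also have "\<dots> \<le> K * (\<delta> + \<delta>') * l2norm \<omega> (q (E \<inter> F))"
      by (rule mult_right_mono[OF d]) simp
    finally show ?thesis unfolding l2inner_diff_left[OF \<phi>P[OF E] \<phi>Q[OF F] qEF] .
  qed
  have inj: "inj_on (\<lambda>(E, F). E \<inter> F) I"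
  proof (rule inj_onI, clarify)
    fix E F E' F' assume 1: "(E, F) \<in> I" "(E', F') \<in> I" "E \<inter> F = E' \<inter> F'"
    then have "E \<inter> E' \<noteq> {}" "F \<inter> F' \<noteq> {}" by (auto simp: I_def)
    moreover have "E \<in> P" "E' \<in> P" "F \<in> Q" "F' \<in> Q" using 1 by (auto simp: I_def)
    ultimately show "E = E' \<and> F = F'" using disj by blast
  qed
  have common: "borel_partition J ((\<lambda>(E, F). E \<inter> F) ` I)"
    unfolding borel_partition_def
  proof (intro conjI partition_onI)
    show "\<Union>((\<lambda>(E, F). E \<inter> F) ` I) = J" using part(3,4) by (fastforce simp: I_def)
    fix p p' assume "p \<in> (\<lambda>(E, F). E \<inter> F) ` I" "p' \<in> (\<lambda>(E, F). E \<inter> F) ` I" "p \<noteq> p'"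
    then obtain E F E' F' where 1: "(E, F) \<in> I" "(E', F') \<in> I" "p = E \<inter> F" "p' = E' \<inter> F'" by auto
    with \<open>p \<noteq> p'\<close> have "E \<noteq> E' \<or> F \<noteq> F'" by auto
    moreover have "E \<in> P" "E' \<in> P" "F \<in> Q" "F' \<in> Q" using 1 by (auto simp: I_def)
    ultimately have "E \<inter> E' = {} \<or> F \<inter> F' = {}" using disj by blast
    then show "disjnt p p'" using 1 by (auto simp: disjnt_def)
  next
    show "(\<lambda>(E, F). E \<inter> F) ` I \<subseteq> sets borel" using part(7,8) by (auto simp: I_def)
  qed (use I in \<open>auto simp: I_def\<close>)
  have "\<bar>(\<Sum>E\<in>P. l2inner \<omega> (\<phi> (\<xi> E)) (q E)) - (\<Sum>E\<in>Q. l2inner \<omega> (\<phi> (\<eta> E)) (q E))\<bar>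
      = \<bar>\<Sum>(E, F)\<in>I. l2inner \<omega> (\<phi> (\<xi> E)) (q (E \<inter> F)) - l2inner \<omega> (\<phi> (\<eta> F)) (q (E \<inter> F))\<bar>"
    unfolding sumP sumQ sum_subtractf[symmetric] by (simp add: case_prod_unfold)
  also have "\<dots> \<le> (\<Sum>(E, F)\<in>I. K * (\<delta> + \<delta>') * l2norm \<omega> (q (E \<inter> F)))"
    by (rule order_trans[OF sum_abs]) (intro sum_mono, use close in auto)
  also have "\<dots> = K * (\<delta> + \<delta>') * (\<Sum>G\<in>(\<lambda>(E, F). E \<inter> F) ` I. l2norm \<omega> (q G))"
    unfolding sum.reindex[OF inj] by (simp add: case_prod_unfold sum_distrib_left)
  also have "\<dots> \<le> K * (\<delta> + \<delta>') * total_variation J \<omega> q"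
    using K \<delta> by (intro mult_left_mono partition_sum_le_total_variation[OF q common]) auto
  finally show ?thesis .
qed

lemma tagged_sum_bound:
  assumes q: "q \<in> vector_measures J \<omega>" and \<phi>: "\<And>s. s \<in> J \<Longrightarrow> \<phi> s \<in> Ltwo \<omega>"
    and B: "\<And>s. s \<in> J \<Longrightarrow> l2norm \<omega> (\<phi> s) \<le> B" "0 \<le> B"
    and P: "borel_partition J P" "\<And>E. E \<in> P \<Longrightarrow> \<xi> E \<in> E"
  shows "\<bar>\<Sum>E\<in>P. l2inner \<omega> (\<phi> (\<xi> E)) (q E)\<bar> \<le> B * total_variation J \<omega> q"
proof -
  have part: "\<Union>P = J" "P \<subseteq> sets borel" using P(1) by (auto simp: borel_partition_def partition_on_def)
  have "\<bar>l2inner \<omega> (\<phi> (\<xi> E)) (q E)\<bar> \<le> B * l2norm \<omega> (q E)" if E: "E \<in> P" for E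
  proof -
    have \<xi>: "\<xi> E \<in> J" using P(2)[OF E] part(1) E by blast
    have "E \<in> sets borel" "E \<subseteq> J" using part E by auto
    then have "q E \<in> Ltwo \<omega>" using q unfolding vector_measures_def by blast
    then have "\<bar>l2inner \<omega> (\<phi> (\<xi> E)) (q E)\<bar> \<le> l2norm \<omega> (\<phi> (\<xi> E)) * l2norm \<omega> (q E)"
      by (rule l2inner_Cauchy_Schwarz[OF \<phi>[OF \<xi>]])
    also have "\<dots> \<le> B * l2norm \<omega> (q E)" by (rule mult_right_mono[OF B(1)[OF \<xi>]]) simp
    finally show ?thesis .
  qed
  then have "\<bar>\<Sum>E\<in>P. l2inner \<omega> (\<phi> (\<xi> E)) (q E)\<bar> \<le> (\<Sum>E\<in>P. B * l2norm \<omega> (q E))"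
    by (intro order_trans[OF sum_abs] sum_mono)
  also have "\<dots> = B * (\<Sum>E\<in>P. l2norm \<omega> (q E))" by (simp add: sum_distrib_left)
  also have "\<dots> \<le> B * total_variation J \<omega> q"
    by (rule mult_left_mono[OF partition_sum_le_total_variation[OF q P(1)] B(2)])
  finally show ?thesis .
qed

lemma has_pairing_unique:
  assumes "has_pairing {a..b} \<omega> q \<phi> r" "has_pairing {a..b} \<omega> q \<phi> r'"
  shows "r = r'"
proof (rule ccontr)
  assume "r \<noteq> r'"
  then have e: "0 < \<bar>r - r'\<bar> / 2" by simp
  let ?S = "\<lambda>P \<xi>. \<Sum>E\<in>P. l2inner \<omega> (\<phi> (\<xi> E)) (q E)"
  obtain \<delta> where \<delta>: "\<delta> > 0" "\<And>P \<xi>. borel_partition {a..b} P \<and> (\<forall>E\<in>P. \<xi> E \<in> E \<and> diameter E < \<delta>)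
      \<Longrightarrow> \<bar>?S P \<xi> - r\<bar> < \<bar>r - r'\<bar> / 2"
    using assms(1) e unfolding has_pairing_def by blast
  obtain \<delta>' where \<delta>': "\<delta>' > 0" "\<And>P \<xi>. borel_partition {a..b} P \<and> (\<forall>E\<in>P. \<xi> E \<in> E \<and> diameter E < \<delta>')
      \<Longrightarrow> \<bar>?S P \<xi> - r'\<bar> < \<bar>r - r'\<bar> / 2"
    using assms(2) e unfolding has_pairing_def by blast
  have "0 < min \<delta> \<delta>'" using \<delta>(1) \<delta>'(1) by simp
  then obtain P \<xi> where P: "borel_partition {a..b} P" "\<And>E. E \<in> P \<Longrightarrow> \<xi> E \<in> E" "\<And>E. E \<in> P \<Longrightarrow> diameter E < min \<delta> \<delta>'"
    using fine_borel_partition by blast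
  have "\<bar>?S P \<xi> - r\<bar> < \<bar>r - r'\<bar> / 2" using P by (intro \<delta>(2)) auto
  moreover have "\<bar>?S P \<xi> - r'\<bar> < \<bar>r - r'\<bar> / 2" using P by (intro \<delta>'(2)) auto
  moreover have "\<bar>r - r'\<bar> \<le> \<bar>s - r\<bar> + \<bar>s - r'\<bar>" for s by simp
  ultimately show False by (smt (verit) field_sum_of_halves)
qed

text \<open>
  The tagged sums over a sequence of ever finer partitions form a Cauchy sequence by
  \<open>tagged_sums_close\<close>, and the same estimate compares its limit with any other fine tagged sum.
\<close>

lemma has_pairing_Lipschitz:
  assumes q: "q \<in> vector_measures {a..b} \<omega>" and K: "0 \<le> K"
    and \<phi>: "\<And>s. s \<in> {a..b} \<Longrightarrow> \<phi> s \<in> Ltwo \<omega>"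
    and lip: "\<And>s r. s \<in> {a..b} \<Longrightarrow> r \<in> {a..b} \<Longrightarrow> l2norm \<omega> (\<lambda>x. \<phi> s x - \<phi> r x) \<le> K * \<bar>s - r\<bar>"
  shows "\<exists>r. has_pairing {a..b} \<omega> q \<phi> r"
proof -
  let ?S = "\<lambda>P \<xi>. \<Sum>E\<in>P. l2inner \<omega> (\<phi> (\<xi> E)) (q E)"
  define C where "C = K * total_variation {a..b} \<omega> q"
  have C: "0 \<le> C" unfolding C_def using K total_variation_nonneg[OF q] by simp
  have close: "\<bar>?S P \<xi> - ?S Q \<eta>\<bar> \<le> C * (\<delta> + \<delta>')"
    if "borel_partition {a..b} P" "\<And>E. E \<in> P \<Longrightarrow> \<xi> E \<in> E" "\<And>E. E \<in> P \<Longrightarrow> diameter E < \<delta>"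
      "borel_partition {a..b} Q" "\<And>E. E \<in> Q \<Longrightarrow> \<eta> E \<in> E" "\<And>E. E \<in> Q \<Longrightarrow> diameter E < \<delta>'" "0 \<le> \<delta>" "0 \<le> \<delta>'"
    for P \<xi> Q \<eta> \<delta> \<delta>'
    using tagged_sums_close[OF q bounded_closed_interval K that(7,8) \<phi> lip that(1-6)]
    by (simp add: C_def mult.commute mult.left_commute)
  define d where "d n = 1 / real (Suc n)" for n
  have d: "0 < d n" for n by (simp add: d_def)
  have d_lim: "d \<longlonglongrightarrow> 0" using LIMSEQ_Suc[OF lim_1_over_n[where 'a = real]] by (simp add: d_def[abs_def])
  have "\<exists>P \<xi>. borel_partition {a..b} P \<and> (\<forall>E\<in>P. \<xi> E \<in> E) \<and> (\<forall>E\<in>P. diameter E < d n)" for n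
    by (rule fine_borel_partition[OF d[of n], of a b]) blast
  then obtain P \<xi> where P: "\<And>n. borel_partition {a..b} (P n)"
    "\<And>n E. E \<in> P n \<Longrightarrow> \<xi> n E \<in> E" "\<And>n E. E \<in> P n \<Longrightarrow> diameter E < d n" by metis
  have Cauchy: "Cauchy (\<lambda>n. ?S (P n) (\<xi> n))"
  proof (rule metric_CauchyI)
    fix e :: real assume "0 < e"
    have "(\<lambda>n. C * d n) \<longlonglongrightarrow> C * 0" by (intro tendsto_intros d_lim)
    then have "\<forall>\<^sub>F n in sequentially. C * d n < e / 2" using \<open>0 < e\<close> by (intro order_tendstoD(2)) auto
    then obtain N where N: "\<And>n. n \<ge> N \<Longrightarrow> C * d n < e / 2" by (auto simp: eventually_sequentially)
    have "dist (?S (P m) (\<xi> m)) (?S (P n) (\<xi> n)) < e" if "m \<ge> N" "n \<ge> N" for m n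
    proof -
      have "\<bar>?S (P m) (\<xi> m) - ?S (P n) (\<xi> n)\<bar> \<le> C * (d m + d n)"
        using d by (intro close P) (auto intro: less_imp_le)
      then show ?thesis using N[OF that(1)] N[OF that(2)] by (simp add: dist_real_def distrib_left)
    qed
    then show "\<exists>M. \<forall>m\<ge>M. \<forall>n\<ge>M. dist (?S (P m) (\<xi> m)) (?S (P n) (\<xi> n)) < e" by blast
  qed
  then obtain r where r: "(\<lambda>n. ?S (P n) (\<xi> n)) \<longlonglongrightarrow> r" by (auto simp: Cauchy_convergent_iff convergent_def)
  have "has_pairing {a..b} \<omega> q \<phi> r"
    unfolding has_pairing_def
  proof (intro allI impI)
    fix \<epsilon> :: real assume "0 < \<epsilon>"
    define \<delta> where "\<delta> = \<epsilon> / (C + 1)"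
    have \<delta>: "0 < \<delta>" "C * \<delta> < \<epsilon>" using C \<open>0 < \<epsilon>\<close> by (auto simp: \<delta>_def field_simps)
    have "\<bar>?S Q \<eta> - r\<bar> < \<epsilon>" if Q: "borel_partition {a..b} Q" "\<forall>E\<in>Q. \<eta> E \<in> E \<and> diameter E < \<delta>" for Q \<eta>
    proof -
      have "(\<lambda>n. \<bar>?S Q \<eta> - ?S (P n) (\<xi> n)\<bar>) \<longlonglongrightarrow> \<bar>?S Q \<eta> - r\<bar>" by (intro tendsto_intros r)
      moreover have "(\<lambda>n. C * (\<delta> + d n)) \<longlonglongrightarrow> C * (\<delta> + 0)" by (intro tendsto_intros d_lim)
      moreover have "\<bar>?S Q \<eta> - ?S (P n) (\<xi> n)\<bar> \<le> C * (\<delta> + d n)" for n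
        using Q \<delta> d by (intro close P) (auto intro: less_imp_le)
      ultimately have "\<bar>?S Q \<eta> - r\<bar> \<le> C * (\<delta> + 0)" by (intro LIMSEQ_le) auto
      then show ?thesis using \<delta> by simp
    qed
    then show "\<exists>\<delta>>0. \<forall>P \<xi>. borel_partition {a..b} P \<and> (\<forall>E\<in>P. \<xi> E \<in> E \<and> diameter E < \<delta>) \<longrightarrow> \<bar>?S P \<xi> - r\<bar> < \<epsilon>"
      using \<delta>(1) by blast
  qed
  then show ?thesis by blast
qed

text \<open>
  As \<open>pairing\<close> is a definite description, nothing can be said about its value before existence and
  uniqueness of the limit are established; the bound then passes to the limit from the tagged sums.
\<close>

lemma pairing_bound:
  assumes q: "q \<in> vector_measures {a..b} \<omega>" and K: "0 \<le> K"
    and \<phi>: "\<And>s. s \<in> {a..b} \<Longrightarrow> \<phi> s \<in> Ltwo \<omega>"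
    and lip: "\<And>s r. s \<in> {a..b} \<Longrightarrow> r \<in> {a..b} \<Longrightarrow> l2norm \<omega> (\<lambda>x. \<phi> s x - \<phi> r x) \<le> K * \<bar>s - r\<bar>"
    and B: "\<And>s. s \<in> {a..b} \<Longrightarrow> l2norm \<omega> (\<phi> s) \<le> B" "0 \<le> B"
  shows "\<bar>pairing {a..b} \<omega> q \<phi>\<bar> \<le> B * total_variation {a..b} \<omega> q"
proof -
  obtain r where r: "has_pairing {a..b} \<omega> q \<phi> r"
    using has_pairing_Lipschitz[OF q K \<phi> lip] by blast
  have "pairing {a..b} \<omega> q \<phi> = r"
    unfolding pairing_def by (rule the_equality, rule r) (rule has_pairing_unique[OF _ r])
  moreover have "\<bar>r\<bar> \<le> B * total_variation {a..b} \<omega> q + e" if "e > 0" for e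
  proof -
    let ?S = "\<lambda>P \<xi>. \<Sum>E\<in>P. l2inner \<omega> (\<phi> (\<xi> E)) (q E)"
    obtain \<delta> where \<delta>: "\<delta> > 0" "\<And>P \<xi>. borel_partition {a..b} P \<and> (\<forall>E\<in>P. \<xi> E \<in> E \<and> diameter E < \<delta>)
        \<Longrightarrow> \<bar>?S P \<xi> - r\<bar> < e"
      using r \<open>e > 0\<close> unfolding has_pairing_def by blast
    obtain P \<xi> where P: "borel_partition {a..b} P" "\<And>E. E \<in> P \<Longrightarrow> \<xi> E \<in> E" "\<And>E. E \<in> P \<Longrightarrow> diameter E < \<delta>"
      by (rule fine_borel_partition[OF \<delta>(1), of a b]) blast
    have "\<bar>?S P \<xi> - r\<bar> < e" using P by (intro \<delta>(2)) auto
    moreover have "\<bar>?S P \<xi>\<bar> \<le> B * total_variation {a..b} \<omega> q" by (rule tagged_sum_bound[OF q \<phi> B P(1,2)])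
    ultimately show ?thesis by linarith
  qed
  ultimately show ?thesis using field_le_epsilon by blast
qed

section \<open>Piecewise linear interpolation in time\<close>

lemma has_bochner_integral_lebesgue_AE_cong:
  fixes f g :: "real \<Rightarrow> real"
  assumes f: "has_bochner_integral lebesgue f i" and ae: "AE x in lebesgue. f x = g x"
  shows "has_bochner_integral lebesgue g i"
proof -
  have "f \<in> borel_measurable lebesgue" using f by (auto simp: has_bochner_integral.simps)
  moreover from this have "g \<in> borel_measurable lebesgue" by (rule borel_measurable_AE[OF _ ae])
  ultimately show ?thesis using has_bochner_integral_cong_AE[OF _ _ ae] f by blast
qed

lemma has_bochner_integral_affine:
  fixes g :: "real \<Rightarrow> real"
  assumes "p \<le> q" and g: "\<And>s. p < s \<Longrightarrow> s < q \<Longrightarrow> g s = \<alpha> + \<beta> * s"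
  shows "has_bochner_integral (lebesgue_on {p..q}) g ((q - p) * (\<alpha> + \<beta> * ((p + q) / 2)))"
proof -
  have "has_bochner_integral lborel (\<lambda>s. (\<alpha> + \<beta> * s) * indicator {p..q} s)
      ((\<alpha> * q + \<beta> * q\<^sup>2 / 2) - (\<alpha> * p + \<beta> * p\<^sup>2 / 2))"
    by (rule has_bochner_integral_FTC_Icc_real[OF \<open>p \<le> q\<close>, where F = "\<lambda>s. \<alpha> * s + \<beta> * s\<^sup>2 / 2"])
       (auto intro!: derivative_eq_intros continuous_intros)
  then have "has_bochner_integral lebesgue (\<lambda>s. (\<alpha> + \<beta> * s) * indicator {p..q} s)
      ((\<alpha> * q + \<beta> * q\<^sup>2 / 2) - (\<alpha> * p + \<beta> * p\<^sup>2 / 2))"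
    by (auto simp: has_bochner_integral_iff integrable_completion integral_completion)
  then have "has_bochner_integral lebesgue (\<lambda>s. indicator {p..q} s *\<^sub>R g s)
      ((\<alpha> * q + \<beta> * q\<^sup>2 / 2) - (\<alpha> * p + \<beta> * p\<^sup>2 / 2))"
  proof (rule has_bochner_integral_lebesgue_AE_cong)
    have "AE s in lebesgue. s \<noteq> p \<and> s \<noteq> q"
      by (intro AE_conjI AE_completion AE_lborel_singleton)
    then show "AE s in lebesgue. (\<alpha> + \<beta> * s) * indicator {p..q} s = indicator {p..q} s *\<^sub>R g s"
      by eventually_elim (auto simp: indicator_def g)
  qed
  moreover have "(\<alpha> * q + \<beta> * q\<^sup>2 / 2) - (\<alpha> * p + \<beta> * p\<^sup>2 / 2) = (q - p) * (\<alpha> + \<beta> * ((p + q) / 2))"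
    by (simp add: power2_eq_square field_simps)
  ultimately show ?thesis by (simp add: has_bochner_integral_restrict_space)
qed

locale time_partition =
  fixes T :: real and M :: nat and t :: "nat \<Rightarrow> real"
  assumes t_0: "t 0 = 0" and t_M: "t M = T" and M_pos: "1 \<le> M"
    and t_less: "\<And>m. m \<in> {1..M} \<Longrightarrow> t (m - 1) < t m"
begin

lemma t_mono: "i \<le> j \<Longrightarrow> j \<le> M \<Longrightarrow> t i \<le> t j"
proof (induction rule: dec_induct)
  case (step n)
  then show ?case using t_less[of "Suc n"] by simp
qed simp

lemma T_pos: "0 < T"
  using t_less[of 1] t_mono[of 1 M] M_pos t_0 t_M by simp

lemma cells_cover:
  assumes "0 < s" "s \<le> T"
  obtains m where "m \<in> {1..M}" "t (m - 1) < s" "s \<le> t m"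
proof
  define m where "m = (LEAST m. s \<le> t m)"
  have m: "s \<le> t m" unfolding m_def by (rule LeastI[of _ M]) (simp add: t_M assms)
  have "m \<le> M" unfolding m_def by (rule Least_le) (simp add: t_M assms)
  moreover have "m \<noteq> 0" using m assms t_0 by (intro notI) simp
  ultimately show "m \<in> {1..M}" by simp
  show "s \<le> t m" by (rule m)
  show "t (m - 1) < s" using not_less_Least[of "m - 1" "\<lambda>m. s \<le> t m"] \<open>m \<noteq> 0\<close> by (simp add: m_def[symmetric])
qed

text \<open>
  The grid points form a null set, and an affine function has its midpoint value as mean.
\<close>

lemma integral_over_cells:
  fixes g :: "real \<Rightarrow> real"
  assumes g: "\<And>m s. m \<in> {1..M} \<Longrightarrow> t (m - 1) < s \<Longrightarrow> s < t m \<Longrightarrow> g s = \<alpha> m + \<beta> m * s"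
  shows "integral\<^sup>L (lebesgue_on {0<..<T}) g
    = (\<Sum>m=1..M. (t m - t (m - 1)) * (\<alpha> m + \<beta> m * ((t (m - 1) + t m) / 2)))"
proof -
  have "has_bochner_integral (lebesgue_on {t 0..t n}) g
      (\<Sum>m=1..n. (t m - t (m - 1)) * (\<alpha> m + \<beta> m * ((t (m - 1) + t m) / 2)))" if "n \<le> M" for n
    using that
  proof (induction n)
    case 0
    have "{t 0..t 0} \<in> null_sets lebesgue" by simp
    then show ?case using has_bochner_integral_null[of "{t 0..t 0}" g] by simp
  next
    case (Suc n)
    have "has_bochner_integral (lebesgue_on {t n..t (Suc n)}) g
        ((t (Suc n) - t n) * (\<alpha> (Suc n) + \<beta> (Suc n) * ((t n + t (Suc n)) / 2)))"
      using t_less[of "Suc n"] Suc.prems g[of "Suc n"] by (intro has_bochner_integral_affine) auto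
    then have "has_bochner_integral (lebesgue_on {t 0..t (Suc n)}) g
      ((\<Sum>m=1..n. (t m - t (m - 1)) * (\<alpha> m + \<beta> m * ((t (m - 1) + t m) / 2)))
        + (t (Suc n) - t n) * (\<alpha> (Suc n) + \<beta> (Suc n) * ((t n + t (Suc n)) / 2)))"
      using Suc t_mono[of 0 n] t_mono[of n "Suc n"] by (intro has_bochner_integral_combine) auto
    then show ?case by simp
  qed
  from this[of M] have "has_bochner_integral (lebesgue_on {0..T}) g
      (\<Sum>m=1..M. (t m - t (m - 1)) * (\<alpha> m + \<beta> m * ((t (m - 1) + t m) / 2)))"
    by (simp add: t_0 t_M)
  then have "has_bochner_integral lebesgue (\<lambda>s. indicator {0..T} s *\<^sub>R g s)
      (\<Sum>m=1..M. (t m - t (m - 1)) * (\<alpha> m + \<beta> m * ((t (m - 1) + t m) / 2)))"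
    by (simp add: has_bochner_integral_restrict_space)
  then have "has_bochner_integral lebesgue (\<lambda>s. indicator {0<..<T} s *\<^sub>R g s)
      (\<Sum>m=1..M. (t m - t (m - 1)) * (\<alpha> m + \<beta> m * ((t (m - 1) + t m) / 2)))"
  proof (rule has_bochner_integral_lebesgue_AE_cong)
    have "AE s in lebesgue. s \<noteq> 0 \<and> s \<noteq> T"
      by (intro AE_conjI AE_completion AE_lborel_singleton)
    then show "AE s in lebesgue. indicator {0..T} s *\<^sub>R g s = indicator {0<..<T} s *\<^sub>R g s"
      by eventually_elim (auto simp: indicator_def)
  qed
  then have "has_bochner_integral (lebesgue_on {0<..<T}) g
      (\<Sum>m=1..M. (t m - t (m - 1)) * (\<alpha> m + \<beta> m * ((t (m - 1) + t m) / 2)))"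
    by (simp add: has_bochner_integral_restrict_space)
  then show ?thesis by (rule has_bochner_integral_integral_eq)
qed

definition ramp :: "nat \<Rightarrow> real \<Rightarrow> real" where
  "ramp m s = max 0 (min 1 ((s - t (m - 1)) / (t m - t (m - 1))))"

text \<open>
  Writing the interpolant as a sum of ramps, instead of cell by cell, makes its continuity in time
  immediate.
\<close>

definition interp :: "(nat \<Rightarrow> 'b \<Rightarrow> real) \<Rightarrow> real \<Rightarrow> 'b \<Rightarrow> real" where
  "interp V s x = V 0 x + (\<Sum>m=1..M. ramp m s * (V m x - V (m - 1) x))"

lemma ramp_Lipschitz:
  assumes "m \<in> {1..M}"
  shows "\<bar>ramp m s - ramp m r\<bar> \<le> 1 / (t m - t (m - 1)) * \<bar>s - r\<bar>"
proof -
  have pos: "0 < t m - t (m - 1)" using t_less[OF assms] by simp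
  have clamp: "\<bar>max 0 (min 1 x) - max 0 (min 1 y)\<bar> \<le> \<bar>x - y\<bar>" for x y :: real by linarith
  have "(s - t (m - 1)) / (t m - t (m - 1)) - (r - t (m - 1)) / (t m - t (m - 1)) = (s - r) / (t m - t (m - 1))"
    unfolding diff_divide_distrib[symmetric] by simp
  then show ?thesis
    unfolding ramp_def using clamp[of "(s - t (m - 1)) / (t m - t (m - 1))" "(r - t (m - 1)) / (t m - t (m - 1))"] pos
    by (simp add: abs_divide)
qed

lemma interp_on_cell:
  assumes m: "m \<in> {1..M}" and s: "t (m - 1) \<le> s" "s \<le> t m"
  shows "interp V s x = V (m - 1) x + (s - t (m - 1)) / (t m - t (m - 1)) * (V m x - V (m - 1) x)"
proof -
  have before: "ramp j s = 1" if "j \<in> {1..m - 1}" for j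
  proof -
    have "j \<le> m - 1" "m - 1 \<le> M" using that m by auto
    then have "t j \<le> s" using t_mono[of j "m - 1"] s by simp
    moreover have "t (j - 1) < t j" using that m by (intro t_less) auto
    ultimately have "1 \<le> (s - t (j - 1)) / (t j - t (j - 1))" by (simp add: pos_le_divide_eq)
    then show ?thesis by (simp add: ramp_def)
  qed
  have after: "ramp j s = 0" if "j \<in> {1..M} - {1..m}" for j
  proof -
    have "m \<le> j - 1" "j - 1 \<le> M" using that by auto
    then have "s \<le> t (j - 1)" using t_mono[of m "j - 1"] s by simp
    moreover have "t (j - 1) < t j" using that by (intro t_less) auto
    ultimately have "(s - t (j - 1)) / (t j - t (j - 1)) \<le> 0" by (simp add: divide_le_0_iff)
    then show ?thesis by (simp add: ramp_def)
  qed
  have here: "ramp m s = (s - t (m - 1)) / (t m - t (m - 1))"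
    using s t_less[OF m] by (simp add: ramp_def min_def max_def pos_divide_le_eq divide_le_eq)
  obtain k where k: "m = Suc k" using m by (cases m) auto
  have "(\<Sum>j=1..M. ramp j s * (V j x - V (j - 1) x)) = (\<Sum>j=1..m. ramp j s * (V j x - V (j - 1) x))"
    using m after by (intro sum.mono_neutral_right) auto
  also have "\<dots> = (\<Sum>j=1..k. ramp j s * (V j x - V (j - 1) x)) + ramp m s * (V m x - V (m - 1) x)"
    unfolding k by simp
  also have "(\<Sum>j=1..k. ramp j s * (V j x - V (j - 1) x)) = (\<Sum>j=Suc 0..k. V j x - V (j - 1) x)"
    using before k by (intro sum.cong) auto
  also have "\<dots> = V k x - V 0 x" by (rule sum_telescope'') simp
  finally show ?thesis unfolding interp_def here using k by simp
qed

lemma interp_0: "interp V 0 = V 0"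
  using interp_on_cell[of 1 0 V] M_pos t_0 t_less[of 1] by (intro ext) simp

lemma interp_T: "interp V T = V M"
  using interp_on_cell[of M T V] M_pos t_M t_less[of M] by (intro ext) simp

lemma interp_deriv:
  assumes m: "m \<in> {1..M}" and s: "t (m - 1) < s" "s < t m"
  shows "deriv (\<lambda>r. interp V r x) s = (V m x - V (m - 1) x) / (t m - t (m - 1))"
proof (rule DERIV_imp_deriv)
  have "((\<lambda>r. V (m - 1) x + (r - t (m - 1)) / (t m - t (m - 1)) * (V m x - V (m - 1) x))
      has_real_derivative (V m x - V (m - 1) x) / (t m - t (m - 1))) (at s)"
    using s by (auto intro!: derivative_eq_intros)
  then show "((\<lambda>r. interp V r x) has_real_derivative (V m x - V (m - 1) x) / (t m - t (m - 1))) (at s)"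
    by (rule has_field_derivative_transform_within_open[where S = "{t (m - 1)<..<t m}"])
       (use s in \<open>simp_all add: interp_on_cell[OF m] del: One_nat_def\<close>)
qed

lemma interp_diff:
  "interp V s x - interp V r x = (\<Sum>m=1..M. (ramp m s - ramp m r) * (V m x - V (m - 1) x))"
  by (simp add: interp_def left_diff_distrib flip: sum_subtractf)

text \<open>
  With \<open>N\<close> the norm of \<open>H\<^sup>1\<close> this gives the continuity required of test functions. As that norm dominates
  the norm of \<open>L\<^sup>2(\<omega>)\<close>, it also gives the Lipschitz bound on which the pairing with \<open>q\<close> relies.
\<close>

lemma interp_Lipschitz:
  fixes N :: "('b \<Rightarrow> real) \<Rightarrow> real"
  assumes W: "\<And>v w c d. v \<in> W \<Longrightarrow> w \<in> W \<Longrightarrow> (\<lambda>x. c * v x + d * w x) \<in> W"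
    and N: "\<And>v w c d. v \<in> W \<Longrightarrow> w \<in> W \<Longrightarrow> N (\<lambda>x. c * v x + d * w x) \<le> \<bar>c\<bar> * N v + \<bar>d\<bar> * N w"
    and N_nonneg: "\<And>v. 0 \<le> N v"
    and V: "\<And>m. m \<le> M \<Longrightarrow> V m \<in> W"
  shows "\<exists>K\<ge>0. \<forall>s r. N (\<lambda>x. interp V s x - interp V r x) \<le> K * \<bar>s - r\<bar>"
proof -
  have D: "(\<lambda>x. V m x - V (m - 1) x) \<in> W" if "m \<in> {1..M}" for m
  proof -
    have "m \<le> M" "m - 1 \<le> M" using that by auto
    then show ?thesis using W[OF V V, of m "m - 1" 1 "-1"] by simp
  qed
  have zero: "(\<lambda>x. 0) \<in> W" "N (\<lambda>x. 0) = 0"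
    using W[OF V V, of 0 0 0 0] N[OF V V, of 0 0 0 0] N_nonneg[of "\<lambda>x. 0"] by simp_all
  have sum: "(\<lambda>x. \<Sum>m\<in>I. c m * (V m x - V (m - 1) x)) \<in> W \<and>
      N (\<lambda>x. \<Sum>m\<in>I. c m * (V m x - V (m - 1) x)) \<le> (\<Sum>m\<in>I. \<bar>c m\<bar> * N (\<lambda>x. V m x - V (m - 1) x))"
    if "finite I" "I \<subseteq> {1..M}" for I c
    using that
  proof (induction I)
    case empty
    then show ?case using zero by simp
  next
    case (insert i I)
    then have IH: "(\<lambda>x. \<Sum>m\<in>I. c m * (V m x - V (m - 1) x)) \<in> W"
      "N (\<lambda>x. \<Sum>m\<in>I. c m * (V m x - V (m - 1) x)) \<le> (\<Sum>m\<in>I. \<bar>c m\<bar> * N (\<lambda>x. V m x - V (m - 1) x))"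
      by auto
    have i: "i \<in> {1..M}" using insert.prems by simp
    show ?case
      using W[OF D[OF i] IH(1), of "c i" 1] N[OF D[OF i] IH(1), of "c i" 1] IH(2) insert.hyps
      by simp
  qed
  define K where "K = (\<Sum>m=1..M. 1 / (t m - t (m - 1)) * N (\<lambda>x. V m x - V (m - 1) x))"
  have "0 \<le> K"
    unfolding K_def using t_less by (intro sum_nonneg mult_nonneg_nonneg N_nonneg) (simp add: less_imp_le)
  moreover have "N (\<lambda>x. interp V s x - interp V r x) \<le> K * \<bar>s - r\<bar>" for s r
  proof -
    have "N (\<lambda>x. interp V s x - interp V r x)
        \<le> (\<Sum>m=1..M. \<bar>ramp m s - ramp m r\<bar> * N (\<lambda>x. V m x - V (m - 1) x))"
      unfolding interp_diff using sum[of "{1..M}" "\<lambda>m. ramp m s - ramp m r"] by simp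
    also have "\<dots> \<le> (\<Sum>m=1..M. (1 / (t m - t (m - 1)) * \<bar>s - r\<bar>) * N (\<lambda>x. V m x - V (m - 1) x))"
      by (intro sum_mono mult_right_mono ramp_Lipschitz N_nonneg)
    also have "\<dots> = K * \<bar>s - r\<bar>"
      unfolding K_def sum_distrib_right by (intro sum.cong) simp_all
    finally show ?thesis .
  qed
  ultimately show ?thesis by blast
qed

end

section \<open>The dual Crank--Nicolson scheme\<close>

lemma l2inner_null:
  assumes "v \<in> Ltwo S" "w \<in> Ltwo S" "l2inner S v v = 0"
  shows "l2inner S v w = 0"
  using l2inner_Cauchy_Schwarz[OF assms(1,2)] assms(3) by (simp add: l2norm_eq_sqrt_inner)

lemma l2inner_Young:
  assumes "v \<in> Ltwo S" "w \<in> Ltwo S"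
  shows "l2inner S v w \<le> (l2inner S v v + l2inner S w w) / 2"
proof -
  have "l2inner S v w \<le> l2norm S v * l2norm S w"
    using l2inner_Cauchy_Schwarz[OF assms] by linarith
  also have "\<dots> \<le> ((l2norm S v)\<^sup>2 + (l2norm S w)\<^sup>2) / 2"
    using sum_squares_bound[of "l2norm S v" "l2norm S w"] by simp
  finally show ?thesis by (simp add: l2norm_sq)
qed

locale fe_mesh =
  fixes \<Omega> :: "'a::euclidean_space set" and h :: real and \<T> :: "'a set set"
  assumes open_dom: "open \<Omega>" and bounded_dom: "bounded \<Omega>" and mesh: "mesh_of \<Omega> h \<T>"
begin

abbreviation Vh :: "('a \<Rightarrow> real) set" where "Vh \<equiv> fe_space \<Omega> \<T>"

lemmas Vh_lincomb = fe_space_lincomb[OF open_dom bounded_dom]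
lemmas Vh_Hone = fe_space_Hone[of _ \<Omega> \<T>]
lemmas Vh_Ltwo = fe_space_Ltwo[of _ \<Omega> \<T>]
lemmas Vh_wgrad = wgrad_weak(1)[OF Vh_Hone]

lemma Vh_l2inner_lincomb:
  "u \<in> Vh \<Longrightarrow> v \<in> Vh \<Longrightarrow> w \<in> Vh \<Longrightarrow>
    l2inner \<Omega> (\<lambda>x. c * u x + d * v x) w = c * l2inner \<Omega> u w + d * l2inner \<Omega> v w"
  by (intro l2inner_lincomb_left Vh_Ltwo)

lemma Vh_dirichlet_lincomb:
  "u \<in> Vh \<Longrightarrow> v \<in> Vh \<Longrightarrow> w \<in> Vh \<Longrightarrow>
    dirichlet \<Omega> (\<lambda>x. c * u x + d * v x) w = c * dirichlet \<Omega> u w + d * dirichlet \<Omega> v w"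
  by (intro dirichlet_lincomb_left[OF open_dom bounded_dom] Vh_Hone)

text \<open>
  The unknown \<open>r\<close> represents a linear functional with respect to the form
  \<open>(v, w) + k / 2 (\<nabla>v, \<nabla>w)\<close>, which is positive semidefinite on \<open>V\<^sub>h\<close> and degenerates only at functions
  that vanish almost everywhere on \<open>\<Omega>\<close>.
\<close>

lemma Crank_Nicolson_step:
  assumes k: "0 < k" and g: "g \<in> Vh" and U: "U \<in> Vh"
  shows "\<exists>r\<in>Vh. \<forall>w\<in>Vh. l2inner \<Omega> r w - l2inner \<Omega> g w + k / 2 * (dirichlet \<Omega> r w + dirichlet \<Omega> g w)
    = k * dirichlet \<Omega> U w"
proof -
  obtain N where N: "finite N" "\<And>v x. v \<in> Vh \<Longrightarrow> \<forall>p\<in>N. v p = 0 \<Longrightarrow> x \<in> \<Omega> \<Longrightarrow> v x = 0"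
    using fe_space_finitely_determined[OF mesh] by blast
  define B where "B v w = l2inner \<Omega> v w + k / 2 * dirichlet \<Omega> v w" for v w
  define L where "L w = l2inner \<Omega> w g - k / 2 * dirichlet \<Omega> w g + k * dirichlet \<Omega> w U" for w
  have B_zero: "l2inner \<Omega> v v = 0 \<and> dirichlet \<Omega> v v = 0" if "B v v = 0" for v
    using that k unfolding B_def
    by (smt (verit) half_gt_zero l2inner_self_nonneg mult_nonneg_nonneg mult_pos_pos)
  have null: "l2inner \<Omega> v w = 0" "dirichlet \<Omega> v w = 0" if "v \<in> Vh" "w \<in> Vh" "B v v = 0" for v w
    using B_zero[OF that(3)] l2inner_null[OF Vh_Ltwo[OF that(1)] Vh_Ltwo[OF that(2)]]
      l2inner_null[OF Vh_wgrad[OF that(1)] Vh_wgrad[OF that(2)]] by simp_all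
  have "\<exists>r\<in>Vh. \<forall>w\<in>Vh. B r w = L w"
  proof (rule riesz_on_finitely_determined_space[OF N(1)])
    show "Vh \<noteq> {}" using g by blast
    show "(\<lambda>x. c * v x + d * w x) \<in> Vh" if "v \<in> Vh" "w \<in> Vh" for v w c d
      by (rule Vh_lincomb[OF that])
    show "B (\<lambda>x. c * u x + d * v x) w = c * B u w + d * B v w" if "u \<in> Vh" "v \<in> Vh" "w \<in> Vh" for u v w c d
      unfolding B_def Vh_l2inner_lincomb[OF that] Vh_dirichlet_lincomb[OF that] by (simp add: algebra_simps)
    show "B v w = B w v" for v w
      by (simp add: B_def l2inner_commute)
    show "B v w = 0" if "v \<in> Vh" "w \<in> Vh" "B v v = 0" for v w
      using null[OF that] by (simp add: B_def)
    show "B v v = 0" if v: "v \<in> Vh" "\<forall>p\<in>N. v p = 0" for v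
    proof -
      have zero: "v x = 0" if "x \<in> \<Omega>" for x using N(2)[OF v that] .
      have "l2inner \<Omega> v v = l2inner \<Omega> (\<lambda>x. 0 :: real) (\<lambda>x. 0)" by (rule l2inner_cong) (simp_all add: zero)
      moreover have "wgrad \<Omega> v = wgrad \<Omega> (\<lambda>x. 0 * g x + 0 * g x)"
        by (rule wgrad_cong) (simp add: zero)
      ultimately show ?thesis
        using Vh_dirichlet_lincomb[OF g g v(1), of 0 0] by (simp add: B_def)
    qed
    show "L (\<lambda>x. c * v x + d * w x) = c * L v + d * L w" if "v \<in> Vh" "w \<in> Vh" for v w c d
      unfolding L_def Vh_l2inner_lincomb[OF that g] Vh_dirichlet_lincomb[OF that g] Vh_dirichlet_lincomb[OF that U]
      by (simp add: algebra_simps)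
    show "L v = 0" if "v \<in> Vh" "B v v = 0" for v
      using null[OF that(1) g that(2)] null[OF that(1) U that(2)] by (simp add: L_def)
  qed
  then obtain r where r: "r \<in> Vh" "\<And>w. w \<in> Vh \<Longrightarrow> B r w = L w" by blast
  have "l2inner \<Omega> r w - l2inner \<Omega> g w + k / 2 * (dirichlet \<Omega> r w + dirichlet \<Omega> g w) = k * dirichlet \<Omega> U w"
    if "w \<in> Vh" for w
    using r(2)[OF that] unfolding B_def L_def l2inner_commute[of \<Omega> w g]
      l2inner_commute[of \<Omega> "wgrad \<Omega> w" "wgrad \<Omega> g"] l2inner_commute[of \<Omega> "wgrad \<Omega> w" "wgrad \<Omega> U"]
    by (simp add: algebra_simps)
  then show ?thesis using r(1) by blast
qed

end

locale space_time_mesh = fe_mesh \<Omega> h \<T> + time_partition T M t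
  for \<Omega> :: "'a::euclidean_space set" and h \<T> T M t
begin

lemma Crank_Nicolson_exists:
  assumes U: "\<And>m. m \<in> {1..M} \<Longrightarrow> U m \<in> Vh" and g: "g \<in> Vh"
  shows "\<exists>V. (\<forall>m\<le>M. V m \<in> Vh) \<and> V M = g \<and>
    (\<forall>m\<in>{1..M}. \<forall>w\<in>Vh. l2inner \<Omega> (V (m - 1)) w - l2inner \<Omega> (V m) w
      + (t m - t (m - 1)) / 2 * (dirichlet \<Omega> (V (m - 1)) w + dirichlet \<Omega> (V m) w)
      = (t m - t (m - 1)) * dirichlet \<Omega> (U m) w)"
proof -
  define step where "step m v r \<longleftrightarrow> r \<in> Vh \<and> (\<forall>w\<in>Vh. l2inner \<Omega> r w - l2inner \<Omega> v w
      + (t m - t (m - 1)) / 2 * (dirichlet \<Omega> r w + dirichlet \<Omega> v w)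
      = (t m - t (m - 1)) * dirichlet \<Omega> (U m) w)" for m v r
  define S where "S m v = (SOME r. step m v r)" for m v
  have S: "step m v (S m v)" if "m \<in> {1..M}" "v \<in> Vh" for m v
  proof -
    have "\<exists>r. step m v r"
      using Crank_Nicolson_step[OF _ that(2) U[OF that(1)], of "t m - t (m - 1)"] t_less[OF that(1)]
      unfolding step_def by auto
    then show ?thesis unfolding S_def by (rule someI_ex)
  qed
  \<comment> \<open>the recursion counts the steps back from the final time\<close>
  define V where "V m = rec_nat g (\<lambda>k. S (M - k)) (M - m)" for m
  have V_M: "V M = g" by (simp add: V_def)
  have V_step: "V (m - 1) = S m (V m)" if "m \<in> {1..M}" for m
  proof -
    have "M - (m - 1) = Suc (M - m)" "M - (M - m) = m" using that by auto
    then show ?thesis by (simp add: V_def)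
  qed
  have V_in: "V m \<in> Vh" if "m \<le> M" for m
    using that
  proof (induction rule: inc_induct)
    case base
    then show ?case using g V_M by simp
  next
    case (step n)
    then have "Suc n \<in> {1..M}" by simp
    from S[OF this step.IH] V_step[OF this] show ?case by (simp add: step_def)
  qed
  show ?thesis
  proof (intro exI[of _ V] conjI allI impI ballI V_in V_M)
    fix m w assume m: "m \<in> {1..M}" and w: "w \<in> Vh"
    have "step m (V m) (V (m - 1))"
      unfolding V_step[OF m] using m by (intro S V_in) auto
    then show "l2inner \<Omega> (V (m - 1)) w - l2inner \<Omega> (V m) w
        + (t m - t (m - 1)) / 2 * (dirichlet \<Omega> (V (m - 1)) w + dirichlet \<Omega> (V m) w)
        = (t m - t (m - 1)) * dirichlet \<Omega> (U m) w"
      using w unfolding step_def by blast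
  qed
qed

text \<open>
  Testing a step with \<open>w = V\<^sub>m\<^sub>-\<^sub>1 + V\<^sub>m\<close> turns the first two terms into
  \<open>\<parallel>V\<^sub>m\<^sub>-\<^sub>1\<parallel>\<^sup>2 - \<parallel>V\<^sub>m\<parallel>\<^sup>2\<close> and the gradient term into \<open>\<tau>\<^sub>m / 2 \<parallel>\<nabla>w\<parallel>\<^sup>2\<close>, which absorbs the part of the
  right-hand side that depends on \<open>w\<close>.
\<close>

lemma Crank_Nicolson_stable:
  assumes U: "\<And>m. m \<in> {1..M} \<Longrightarrow> U m \<in> Vh" and V: "\<And>m. m \<le> M \<Longrightarrow> V m \<in> Vh"
    and step: "\<And>m w. m \<in> {1..M} \<Longrightarrow> w \<in> Vh \<Longrightarrow> l2inner \<Omega> (V (m - 1)) w - l2inner \<Omega> (V m) w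
      + (t m - t (m - 1)) / 2 * (dirichlet \<Omega> (V (m - 1)) w + dirichlet \<Omega> (V m) w)
      = (t m - t (m - 1)) * dirichlet \<Omega> (U m) w"
    and "m \<le> M"
  shows "(l2norm \<Omega> (V m))\<^sup>2 \<le> (\<Sum>j=1..M. (t j - t (j - 1)) * dirichlet \<Omega> (U j) (U j)) + (l2norm \<Omega> (V M))\<^sup>2"
proof -
  have one: "l2inner \<Omega> (V (m - 1)) (V (m - 1)) \<le> l2inner \<Omega> (V m) (V m) + (t m - t (m - 1)) * dirichlet \<Omega> (U m) (U m)"
    if m: "m \<in> {1..M}" for m
  proof -
    define w where "w = (\<lambda>x. 1 * V (m - 1) x + 1 * V m x)"
    have "m \<le> M" "m - 1 \<le> M" using m by auto
    then have V': "V (m - 1) \<in> Vh" "V m \<in> Vh" by (auto intro: V)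
    have w: "w \<in> Vh" unfolding w_def by (rule Vh_lincomb[OF V'])
    have k: "0 < t m - t (m - 1)" using t_less[OF m] by simp
    have ip: "l2inner \<Omega> z w = l2inner \<Omega> (V (m - 1)) z + l2inner \<Omega> (V m) z" if "z \<in> Vh" for z
      unfolding l2inner_commute[of \<Omega> z w] unfolding w_def Vh_l2inner_lincomb[OF V' that] by simp
    have dp: "dirichlet \<Omega> (V (m - 1)) w + dirichlet \<Omega> (V m) w = dirichlet \<Omega> w w"
      using Vh_dirichlet_lincomb[OF V' w, of 1 1] by (simp add: w_def)
    have diff: "l2inner \<Omega> (V (m - 1)) w - l2inner \<Omega> (V m) w
        = l2inner \<Omega> (V (m - 1)) (V (m - 1)) - l2inner \<Omega> (V m) (V m)"
      using ip[OF V'(1)] ip[OF V'(2)] l2inner_commute[of \<Omega> "V m" "V (m - 1)"] by linarith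
    have "(t m - t (m - 1)) * dirichlet \<Omega> (U m) w
        \<le> (t m - t (m - 1)) * ((dirichlet \<Omega> (U m) (U m) + dirichlet \<Omega> w w) / 2)"
      using k by (intro mult_left_mono l2inner_Young Vh_wgrad U m w) auto
    moreover have "0 \<le> (t m - t (m - 1)) * dirichlet \<Omega> (U m) (U m)" using k by simp
    ultimately show ?thesis
      using step[OF m w] unfolding dp diff by (simp add: distrib_left add_divide_distrib)
  qed
  have nonneg: "0 \<le> (t j - t (j - 1)) * dirichlet \<Omega> (U j) (U j)" if "j \<in> {1..M}" for j
    using t_less[OF that] by simp
  have "l2inner \<Omega> (V m) (V m) \<le> (\<Sum>j=Suc m..M. (t j - t (j - 1)) * dirichlet \<Omega> (U j) (U j)) + l2inner \<Omega> (V M) (V M)"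
    using \<open>m \<le> M\<close>
  proof (induction rule: inc_induct)
    case base
    show ?case by simp
  next
    case (step n)
    have "(\<Sum>j=Suc n..M. (t j - t (j - 1)) * dirichlet \<Omega> (U j) (U j))
        = (t (Suc n) - t n) * dirichlet \<Omega> (U (Suc n)) (U (Suc n))
          + (\<Sum>j=Suc (Suc n)..M. (t j - t (j - 1)) * dirichlet \<Omega> (U j) (U j))"
      using step.hyps by (subst sum.atLeast_Suc_atMost) auto
    then show ?case using one[of "Suc n"] step by simp
  qed
  also have "(\<Sum>j=Suc m..M. (t j - t (j - 1)) * dirichlet \<Omega> (U j) (U j))
      \<le> (\<Sum>j=1..M. (t j - t (j - 1)) * dirichlet \<Omega> (U j) (U j))"
    using nonneg by (intro sum_mono2) auto
  finally show ?thesis by (simp add: l2norm_sq)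
qed

lemma interp_eq_lincomb:
  assumes "m \<in> {1..M}" "t (m - 1) \<le> s" "s \<le> t m"
  shows "interp V s = (\<lambda>x. (1 - (s - t (m - 1)) / (t m - t (m - 1))) * V (m - 1) x
    + (s - t (m - 1)) / (t m - t (m - 1)) * V m x)"
  by (simp only: interp_on_cell[OF assms] fun_eq_iff) (simp add: algebra_simps diff_divide_distrib)

lemma interp_in_Vh:
  assumes V: "\<And>m. m \<le> M \<Longrightarrow> V m \<in> Vh" and s: "0 \<le> s" "s \<le> T"
  shows "interp V s \<in> Vh"
proof (cases "s = 0")
  case True
  then show ?thesis using V[of 0] by (simp add: interp_0)
next
  case False
  then obtain m where m: "m \<in> {1..M}" "t (m - 1) < s" "s \<le> t m" using cells_cover[of s] s by auto
  then have "m \<le> M" "m - 1 \<le> M" by auto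
  then show ?thesis
    unfolding interp_eq_lincomb[OF m(1) less_imp_le[OF m(2)] m(3)] by (intro Vh_lincomb V)
qed

lemma interp_l2norm_bound:
  assumes V: "\<And>m. m \<le> M \<Longrightarrow> V m \<in> Vh" and E: "\<And>m. m \<le> M \<Longrightarrow> l2norm \<Omega> (V m) \<le> E"
    and s: "0 \<le> s" "s \<le> T"
  shows "l2norm \<Omega> (interp V s) \<le> E"
proof (cases "s = 0")
  case True
  then show ?thesis using E[of 0] by (simp add: interp_0)
next
  case False
  then obtain m where m: "m \<in> {1..M}" "t (m - 1) < s" "s \<le> t m" using cells_cover[of s] s by auto
  then have mM: "m \<le> M" "m - 1 \<le> M" by auto
  define l where "l = (s - t (m - 1)) / (t m - t (m - 1))"
  have l: "0 \<le> l" "l \<le> 1" using m by (auto simp: l_def)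
  have "l2norm \<Omega> (interp V s) \<le> \<bar>1 - l\<bar> * l2norm \<Omega> (V (m - 1)) + \<bar>l\<bar> * l2norm \<Omega> (V m)"
    unfolding interp_eq_lincomb[OF m(1) less_imp_le[OF m(2)] m(3)] l_def
    by (intro l2norm_lincomb Vh_Ltwo V mM)
  also have "\<dots> \<le> (1 - l) * E + l * E"
    using l E[OF mM(1)] E[OF mM(2)] by (intro add_mono mult_mono) auto
  finally show ?thesis by (simp add: algebra_simps)
qed

lemma interp_in_P_space:
  assumes V: "\<And>m. m \<le> M \<Longrightarrow> V m \<in> Vh"
  shows "interp V \<in> P_space \<Omega> T \<T> M t"
proof -
  have "\<exists>K\<ge>0. \<forall>s r. h1norm \<Omega> (\<lambda>x. interp V s x - interp V r x) \<le> K * \<bar>s - r\<bar>"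
    by (rule interp_Lipschitz[where W = Vh])
       (auto intro: Vh_lincomb V h1norm_lincomb[OF open_dom bounded_dom] Vh_Hone)
  then obtain K where K: "\<And>s r. h1norm \<Omega> (\<lambda>x. interp V s x - interp V r x) \<le> K * \<bar>s - r\<bar>" by blast
  have "((\<lambda>r. h1norm \<Omega> (\<lambda>x. interp V r x - interp V s x)) \<longlongrightarrow> 0) (at s within {0..T})" for s
  proof (rule Lim_null_comparison)
    show "\<forall>\<^sub>F r in at s within {0..T}. norm (h1norm \<Omega> (\<lambda>x. interp V r x - interp V s x)) \<le> K * \<bar>r - s\<bar>"
      using K by simp
    have "((\<lambda>r. K * \<bar>r - s\<bar>) \<longlongrightarrow> K * \<bar>s - s\<bar>) (at s within {0..T})" by (intro tendsto_intros)
    then show "((\<lambda>r. K * \<bar>r - s\<bar>) \<longlongrightarrow> 0) (at s within {0..T})" by simp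
  qed
  moreover have "time_poly \<Omega> 1 (time_cell M t m) Vh (interp V)" if m: "m \<in> {1..M}" for m
    unfolding time_poly_def
  proof (intro exI conjI allI impI ballI)
    define \<tau> where "\<tau> = t m - t (m - 1)"
    define c where "c j = (if j = 0 then (\<lambda>x. (1 + t (m - 1) / \<tau>) * V (m - 1) x + (- (t (m - 1) / \<tau>)) * V m x)
      else (\<lambda>x. (- (1 / \<tau>)) * V (m - 1) x + (1 / \<tau>) * V m x))" for j :: nat
    have mM: "m \<le> M" "m - 1 \<le> M" using m by auto
    show "c j \<in> Vh" for j
      unfolding c_def by (split if_split) (intro conjI impI Vh_lincomb V mM)
    fix s x assume "s \<in> time_cell M t m"
    then have s: "t (m - 1) \<le> s" "s \<le> t m" by (auto simp: time_cell_def split: if_splits)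
    have "\<tau> \<noteq> 0" using t_less[OF m] by (simp add: \<tau>_def)
    then show "interp V s x = (\<Sum>j\<le>1. s ^ j * c j x)"
      unfolding interp_on_cell[OF m s] \<tau>_def[symmetric] by (simp add: c_def field_simps)
  qed
  ultimately show ?thesis
    unfolding P_space_def using fe_space_Hone0[OF interp_in_Vh[of V, OF V]] by auto
qed

text \<open>
  On a cell the time derivative of the interpolant is the constant \<open>(V\<^sub>m - V\<^sub>m\<^sub>-\<^sub>1) / \<tau>\<^sub>m\<close>, and the gradient term
  is an affine function of time with mean value \<open>(\<nabla>V\<^sub>m\<^sub>-\<^sub>1 + \<nabla>V\<^sub>m, \<nabla>U\<^sub>m) / 2\<close>. The sum therefore
  consists of the left-hand sides of the Crank--Nicolson steps tested with \<open>U\<^sub>m\<close>.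
\<close>

lemma A_form_interp:
  assumes U: "\<And>m. m \<in> {1..M} \<Longrightarrow> U m \<in> Vh" and V: "\<And>m. m \<le> M \<Longrightarrow> V m \<in> Vh"
    and u: "\<And>m s x. m \<in> {1..M} \<Longrightarrow> t (m - 1) < s \<Longrightarrow> s < t m \<Longrightarrow> x \<in> \<Omega> \<Longrightarrow> u s x = U m x"
  shows "A_form \<Omega> T u (interp V) = (\<Sum>m=1..M. l2inner \<Omega> (V (m - 1)) (U m) - l2inner \<Omega> (V m) (U m)
      + (t m - t (m - 1)) / 2 * (dirichlet \<Omega> (V (m - 1)) (U m) + dirichlet \<Omega> (V m) (U m)))
    + l2inner \<Omega> (u T) (V M)"
proof -
  have VV: "V (m - 1) \<in> Vh" "V m \<in> Vh" if "m \<in> {1..M}" for m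
  proof -
    have "m \<le> M" "m - 1 \<le> M" using that by auto
    then show "V (m - 1) \<in> Vh" "V m \<in> Vh" by (auto intro: V)
  qed
  have "integral\<^sup>L (lebesgue_on {0<..<T}) (\<lambda>s. l2inner \<Omega> (u s) (\<lambda>x. deriv (\<lambda>r. interp V r x) s))
      = (\<Sum>m=1..M. (t m - t (m - 1)) * ((l2inner \<Omega> (V m) (U m) - l2inner \<Omega> (V (m - 1)) (U m)) / (t m - t (m - 1))
          + 0 * ((t (m - 1) + t m) / 2)))"
  proof (rule integral_over_cells)
    fix m s assume m: "m \<in> {1..M}" and s: "t (m - 1) < s" "s < t m"
    let ?k = "t m - t (m - 1)"
    have "l2inner \<Omega> (u s) (\<lambda>x. deriv (\<lambda>r. interp V r x) s)
        = l2inner \<Omega> (U m) (\<lambda>x. (- (1 / ?k)) * V (m - 1) x + (1 / ?k) * V m x)"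
      using u[OF m s] by (intro l2inner_cong) (simp_all only: interp_deriv[OF m s], simp add: diff_divide_distrib)
    also have "\<dots> = (- (1 / ?k)) * l2inner \<Omega> (V (m - 1)) (U m) + (1 / ?k) * l2inner \<Omega> (V m) (U m)"
      unfolding l2inner_commute[of \<Omega> "U m"] by (rule Vh_l2inner_lincomb[OF VV[OF m] U[OF m]])
    finally show "l2inner \<Omega> (u s) (\<lambda>x. deriv (\<lambda>r. interp V r x) s)
        = (l2inner \<Omega> (V m) (U m) - l2inner \<Omega> (V (m - 1)) (U m)) / ?k + 0 * s"
      by (simp add: diff_divide_distrib)
  qed
  also have "\<dots> = (\<Sum>m=1..M. l2inner \<Omega> (V m) (U m) - l2inner \<Omega> (V (m - 1)) (U m))"
  proof (intro sum.cong refl)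
    fix m assume "m \<in> {1..M}"
    then have "t m - t (m - 1) \<noteq> 0" using t_less[of m] by simp
    then show "(t m - t (m - 1)) * ((l2inner \<Omega> (V m) (U m) - l2inner \<Omega> (V (m - 1)) (U m)) / (t m - t (m - 1))
          + 0 * ((t (m - 1) + t m) / 2)) = l2inner \<Omega> (V m) (U m) - l2inner \<Omega> (V (m - 1)) (U m)" by simp
  qed
  finally have time: "integral\<^sup>L (lebesgue_on {0<..<T}) (\<lambda>s. l2inner \<Omega> (u s) (\<lambda>x. deriv (\<lambda>r. interp V r x) s))
      = (\<Sum>m=1..M. l2inner \<Omega> (V m) (U m) - l2inner \<Omega> (V (m - 1)) (U m))" .
  define b where "b m = (dirichlet \<Omega> (V m) (U m) - dirichlet \<Omega> (V (m - 1)) (U m)) / (t m - t (m - 1))" for m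
  have "integral\<^sup>L (lebesgue_on {0<..<T}) (\<lambda>s. dirichlet \<Omega> (u s) (interp V s))
      = (\<Sum>m=1..M. (t m - t (m - 1)) * ((dirichlet \<Omega> (V (m - 1)) (U m) - t (m - 1) * b m)
          + b m * ((t (m - 1) + t m) / 2)))"
  proof (rule integral_over_cells)
    fix m s assume m: "m \<in> {1..M}" and s: "t (m - 1) < s" "s < t m"
    define l where "l = (s - t (m - 1)) / (t m - t (m - 1))"
    have "wgrad \<Omega> (u s) = wgrad \<Omega> (U m)"
      by (rule wgrad_cong) (rule u[OF m s])
    then have "dirichlet \<Omega> (u s) (interp V s) = dirichlet \<Omega> (\<lambda>x. (1 - l) * V (m - 1) x + l * V m x) (U m)"
      unfolding interp_eq_lincomb[OF m less_imp_le[OF s(1)] less_imp_le[OF s(2)]] l_def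
      by (simp only: l2inner_commute)
    also have "\<dots> = (1 - l) * dirichlet \<Omega> (V (m - 1)) (U m) + l * dirichlet \<Omega> (V m) (U m)"
      by (rule Vh_dirichlet_lincomb[OF VV[OF m] U[OF m]])
    also have "\<dots> = (dirichlet \<Omega> (V (m - 1)) (U m) - t (m - 1) * b m) + b m * s"
    proof -
      have "l * (dirichlet \<Omega> (V m) (U m) - dirichlet \<Omega> (V (m - 1)) (U m)) = (s - t (m - 1)) * b m"
        by (simp add: l_def b_def)
      then show ?thesis by (simp add: algebra_simps)
    qed
    finally show "dirichlet \<Omega> (u s) (interp V s) = (dirichlet \<Omega> (V (m - 1)) (U m) - t (m - 1) * b m) + b m * s" .
  qed
  also have "\<dots> = (\<Sum>m=1..M. (t m - t (m - 1)) / 2 * (dirichlet \<Omega> (V (m - 1)) (U m) + dirichlet \<Omega> (V m) (U m)))"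
  proof (intro sum.cong refl)
    fix m assume "m \<in> {1..M}"
    then have "t m - t (m - 1) \<noteq> 0" using t_less[of m] by simp
    then have b: "b m * (t m - t (m - 1)) = dirichlet \<Omega> (V m) (U m) - dirichlet \<Omega> (V (m - 1)) (U m)"
      by (simp add: b_def)
    have "(dirichlet \<Omega> (V (m - 1)) (U m) - t (m - 1) * b m) + b m * ((t (m - 1) + t m) / 2)
        = dirichlet \<Omega> (V (m - 1)) (U m) + b m * (t m - t (m - 1)) / 2" by (simp add: field_simps)
    also have "\<dots> = (dirichlet \<Omega> (V (m - 1)) (U m) + dirichlet \<Omega> (V m) (U m)) / 2"
      unfolding b by (simp add: field_simps)
    finally show "(t m - t (m - 1)) * ((dirichlet \<Omega> (V (m - 1)) (U m) - t (m - 1) * b m)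
          + b m * ((t (m - 1) + t m) / 2))
        = (t m - t (m - 1)) / 2 * (dirichlet \<Omega> (V (m - 1)) (U m) + dirichlet \<Omega> (V m) (U m))" by simp
  qed
  finally have space: "integral\<^sup>L (lebesgue_on {0<..<T}) (\<lambda>s. dirichlet \<Omega> (u s) (interp V s))
      = (\<Sum>m=1..M. (t m - t (m - 1)) / 2 * (dirichlet \<Omega> (V (m - 1)) (U m) + dirichlet \<Omega> (V m) (U m)))" .
  show ?thesis
    unfolding A_form_def time space interp_T by (simp add: sum.distrib sum_subtractf)
qed

end

section \<open>The stability estimate\<close>

text \<open>
  Cauchy--Schwarz in space and then in time. If the integrand is not integrable, its integral
  is 0 by convention and the bound is trivial.
\<close>

lemma L2_time_bound:
  assumes f: "f \<in> bochner_L2 {0<..<T} (Ltwo \<Omega>) (l2norm \<Omega>)" and T: "0 < T"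
    and v: "\<And>s. 0 < s \<Longrightarrow> s < T \<Longrightarrow> v s \<in> Ltwo \<Omega> \<and> l2norm \<Omega> (v s) \<le> E"
  shows "\<bar>integral\<^sup>L (lebesgue_on {0<..<T}) (\<lambda>s. l2inner \<Omega> (f s) (v s))\<bar>
    \<le> E * (sqrt T * bochner_norm {0<..<T} (l2norm \<Omega>) f)"
proof -
  let ?M = "lebesgue_on {0<..<T}"
  define n where "n s = l2norm \<Omega> (f s)" for s
  have E: "0 \<le> E" using v[of "T / 2"] T order_trans[OF l2norm_nonneg, of \<Omega> "v (T / 2)" E] by simp
  have n2: "integrable ?M (\<lambda>s. (n s)\<^sup>2)" using f by (simp add: bochner_L2_def n_def)
  have fin: "finite_measure ?M" by (intro finite_measure_lebesgue_on) simp
  have "(\<lambda>s. sqrt ((n s)\<^sup>2)) \<in> borel_measurable ?M"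
    by (rule measurable_compose[OF borel_measurable_integrable[OF n2] borel_measurable_sqrt])
  moreover have "(\<lambda>s. sqrt ((n s)\<^sup>2)) = n" by (simp add: n_def fun_eq_iff)
  ultimately have "n \<in> borel_measurable ?M" by simp
  then have nL: "n \<in> Ltwo {0<..<T}" using n2 by (simp add: Ltwo_def)
  have one: "(\<lambda>s::real. 1::real) \<in> Ltwo {0<..<T}"
    using finite_measure.integrable_const[OF fin] by (simp add: Ltwo_def)
  have n_int: "integrable ?M n" using Ltwo_inner_integrable[OF nL one] by simp
  have "integral\<^sup>L ?M n = l2inner {0<..<T} n (\<lambda>s. 1)" by (simp add: l2inner_def)
  also have "\<dots> \<le> l2norm {0<..<T} n * l2norm {0<..<T} (\<lambda>s. 1::real)"
    using l2inner_Cauchy_Schwarz[OF nL one] by linarith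
  also have "l2norm {0<..<T} n = bochner_norm {0<..<T} (l2norm \<Omega>) f"
    by (simp add: l2norm_def[of "{0<..<T}"] bochner_norm_def n_def)
  also have "l2norm {0<..<T} (\<lambda>s. 1::real) = sqrt T"
    using T by (simp add: l2norm_def measure_restrict_space)
  finally have int_n: "integral\<^sup>L ?M n \<le> bochner_norm {0<..<T} (l2norm \<Omega>) f * sqrt T" .
  have ae: "AE s in ?M. \<bar>l2inner \<Omega> (f s) (v s)\<bar> \<le> E * n s"
  proof -
    have "AE s in ?M. f s \<in> Ltwo \<Omega>" using f by (simp add: bochner_L2_def)
    moreover have "AE s in ?M. 0 < s \<and> s < T" by (intro AE_I2) simp
    ultimately show ?thesis
    proof eventually_elim
      case (elim s)
      then have vs: "v s \<in> Ltwo \<Omega>" "l2norm \<Omega> (v s) \<le> E" using v by auto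
      have "\<bar>l2inner \<Omega> (f s) (v s)\<bar> \<le> n s * l2norm \<Omega> (v s)"
        unfolding n_def by (rule l2inner_Cauchy_Schwarz[OF elim(1) vs(1)])
      also have "\<dots> \<le> n s * E" by (rule mult_left_mono[OF vs(2)]) (simp add: n_def)
      finally show ?case by (simp add: mult.commute)
    qed
  qed
  have "\<bar>integral\<^sup>L ?M (\<lambda>s. l2inner \<Omega> (f s) (v s))\<bar> \<le> E * integral\<^sup>L ?M n"
  proof (cases "integrable ?M (\<lambda>s. l2inner \<Omega> (f s) (v s))")
    case True
    have "\<bar>integral\<^sup>L ?M (\<lambda>s. l2inner \<Omega> (f s) (v s))\<bar> \<le> integral\<^sup>L ?M (\<lambda>s. \<bar>l2inner \<Omega> (f s) (v s)\<bar>)"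
      using integral_norm_bound[of ?M "\<lambda>s. l2inner \<Omega> (f s) (v s)"] by simp
    also have "\<dots> \<le> integral\<^sup>L ?M (\<lambda>s. E * n s)"
      using True n_int ae by (intro integral_mono_AE) auto
    finally show ?thesis by simp
  next
    case False
    have "0 \<le> integral\<^sup>L ?M n" by (intro integral_nonneg_AE) (simp add: n_def)
    then show ?thesis using False E by (simp add: not_integrable_integral_eq)
  qed
  also have "\<dots> \<le> E * (bochner_norm {0<..<T} (l2norm \<Omega>) f * sqrt T)"
    by (rule mult_left_mono[OF int_n E])
  finally show ?thesis by (simp add: mult.commute)
qed

context space_time_mesh
begin

lemma Y_space_nodes:
  assumes "u \<in> Y_space \<Omega> T \<T> M t"
  obtains U where "\<And>m. m \<in> {1..M} \<Longrightarrow> U m \<in> Vh"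
    "\<And>m s x. m \<in> {1..M} \<Longrightarrow> t (m - 1) < s \<Longrightarrow> s < t m \<Longrightarrow> x \<in> \<Omega> \<Longrightarrow> u s x = U m x"
proof -
  have "\<exists>c. c \<in> Vh \<and> (\<forall>s x. t (m - 1) < s \<longrightarrow> s < t m \<longrightarrow> x \<in> \<Omega> \<longrightarrow> u s x = c x)" if m: "m \<in> {1..M}" for m
  proof -
    have "time_poly \<Omega> 0 (time_cell M t m) Vh u" using assms m by (simp add: Y_space_def)
    then obtain c where c: "\<And>j. j \<le> 0 \<Longrightarrow> c j \<in> Vh"
      "\<And>s x. s \<in> time_cell M t m \<Longrightarrow> x \<in> \<Omega> \<Longrightarrow> u s x = (\<Sum>j\<le>0. s ^ j * c j x)"
      unfolding time_poly_def by blast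
    have "u s x = c 0 x" if "t (m - 1) < s" "s < t m" "x \<in> \<Omega>" for s x
      using c(2)[of s x] that by (simp add: time_cell_def)
    then show ?thesis using c(1)[of 0] by blast
  qed
  then have "\<forall>m\<in>{1..M}. \<exists>c. c \<in> Vh \<and> (\<forall>s x. t (m - 1) < s \<longrightarrow> s < t m \<longrightarrow> x \<in> \<Omega> \<longrightarrow> u s x = c x)" by blast
  from bchoice[OF this] show thesis using that by blast
qed

lemma bochner_norm_wgrad:
  assumes u: "\<And>m s x. m \<in> {1..M} \<Longrightarrow> t (m - 1) < s \<Longrightarrow> s < t m \<Longrightarrow> x \<in> \<Omega> \<Longrightarrow> u s x = U m x"
  shows "(bochner_norm {0<..<T} (l2norm \<Omega>) (\<lambda>s. wgrad \<Omega> (u s)))\<^sup>2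
    = (\<Sum>m=1..M. (t m - t (m - 1)) * dirichlet \<Omega> (U m) (U m))"
proof -
  have "(bochner_norm {0<..<T} (l2norm \<Omega>) (\<lambda>s. wgrad \<Omega> (u s)))\<^sup>2
      = integral\<^sup>L (lebesgue_on {0<..<T}) (\<lambda>s. dirichlet \<Omega> (u s) (u s))"
    unfolding bochner_norm_def l2norm_sq by (intro real_sqrt_pow2 integral_nonneg_AE) simp
  also have "\<dots> = (\<Sum>m=1..M. (t m - t (m - 1)) * (dirichlet \<Omega> (U m) (U m) + 0 * ((t (m - 1) + t m) / 2)))"
  proof (rule integral_over_cells)
    fix m s assume m: "m \<in> {1..M}" and s: "t (m - 1) < s" "s < t m"
    have "wgrad \<Omega> (u s) = wgrad \<Omega> (U m)"
      by (rule wgrad_cong) (rule u[OF m s])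
    then show "dirichlet \<Omega> (u s) (u s) = dirichlet \<Omega> (U m) (U m) + 0 * s" by simp
  qed
  finally show ?thesis by simp
qed

text \<open>
  The interpolant of the dual Crank--Nicolson solution is used as a test function: the left-hand
  side of the equation becomes \<open>E\<^sup>2\<close>, and each term on the right is at most \<open>E\<close> times a norm of the data.
\<close>

lemma discrete_stability:
  assumes f: "f \<in> bochner_L2 {0<..<T} (Ltwo \<Omega>) (l2norm \<Omega>)" and u0: "u0 \<in> Ltwo \<Omega>"
    and q: "q \<in> vector_measures {a..b} \<omega>" and ab: "0 < a" "b < T"
    and \<omega>: "\<omega> \<in> sets lebesgue" "\<omega> \<subseteq> \<Omega>"
    and u: "u \<in> Y_space \<Omega> T \<T> M t"
    and eq: "\<And>v. v \<in> P_space \<Omega> T \<T> M t \<Longrightarrow>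
      A_form \<Omega> T u v = integral\<^sup>L (lebesgue_on {0<..<T}) (\<lambda>s. l2inner \<Omega> (f s) (v s))
        + pairing {a..b} \<omega> q v + l2inner \<Omega> u0 (v 0)"
  shows "bochner_norm {0<..<T} (l2norm \<Omega>) (\<lambda>s. wgrad \<Omega> (u s)) + l2norm \<Omega> (u T)
    \<le> 2 * (sqrt T * bochner_norm {0<..<T} (l2norm \<Omega>) f + total_variation {a..b} \<omega> q + l2norm \<Omega> u0)"
proof -
  obtain U where U: "\<And>m. m \<in> {1..M} \<Longrightarrow> U m \<in> Vh"
    and uU: "\<And>m s x. m \<in> {1..M} \<Longrightarrow> t (m - 1) < s \<Longrightarrow> s < t m \<Longrightarrow> x \<in> \<Omega> \<Longrightarrow> u s x = U m x"
    using Y_space_nodes[OF u] by blast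
  have uT: "u T \<in> Vh" using u by (simp add: Y_space_def)
  have "\<exists>V. (\<forall>m\<le>M. V m \<in> Vh) \<and> V M = u T \<and>
    (\<forall>m\<in>{1..M}. \<forall>w\<in>Vh. l2inner \<Omega> (V (m - 1)) w - l2inner \<Omega> (V m) w
      + (t m - t (m - 1)) / 2 * (dirichlet \<Omega> (V (m - 1)) w + dirichlet \<Omega> (V m) w)
      = (t m - t (m - 1)) * dirichlet \<Omega> (U m) w)"
    by (rule Crank_Nicolson_exists[of U "u T", OF U uT])
  then obtain V where V: "\<And>m. m \<le> M \<Longrightarrow> V m \<in> Vh" "V M = u T"
    and step: "\<And>m w. m \<in> {1..M} \<Longrightarrow> w \<in> Vh \<Longrightarrow> l2inner \<Omega> (V (m - 1)) w - l2inner \<Omega> (V m) w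
      + (t m - t (m - 1)) / 2 * (dirichlet \<Omega> (V (m - 1)) w + dirichlet \<Omega> (V m) w)
      = (t m - t (m - 1)) * dirichlet \<Omega> (U m) w"
    by blast
  let ?G = "bochner_norm {0<..<T} (l2norm \<Omega>) (\<lambda>s. wgrad \<Omega> (u s))"
  let ?v = "interp V"
  define E where "E = sqrt (?G\<^sup>2 + (l2norm \<Omega> (u T))\<^sup>2)"
  have E: "0 \<le> E" "E\<^sup>2 = ?G\<^sup>2 + (l2norm \<Omega> (u T))\<^sup>2" by (simp_all add: E_def)
  have nodes: "l2norm \<Omega> (V m) \<le> E" if "m \<le> M" for m
    unfolding E_def using Crank_Nicolson_stable[of U V m, OF U V(1) step that] bochner_norm_wgrad[of u U, OF uU] V(2)
    by (intro real_le_rsqrt) simp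
  have vE: "l2norm \<Omega> (?v s) \<le> E" if "0 \<le> s" "s \<le> T" for s
    by (rule interp_l2norm_bound[of V, OF V(1) nodes that])
  have vV: "?v s \<in> Ltwo \<Omega>" if "0 \<le> s" "s \<le> T" for s
    by (rule Vh_Ltwo) (rule interp_in_Vh[of V, OF V(1) that])
  have "A_form \<Omega> T u ?v = (\<Sum>m=1..M. l2inner \<Omega> (V (m - 1)) (U m) - l2inner \<Omega> (V m) (U m)
      + (t m - t (m - 1)) / 2 * (dirichlet \<Omega> (V (m - 1)) (U m) + dirichlet \<Omega> (V m) (U m)))
      + l2inner \<Omega> (u T) (V M)"
    by (rule A_form_interp[of U V u, OF U V(1) uU])
  also have "\<dots> = (\<Sum>m=1..M. (t m - t (m - 1)) * dirichlet \<Omega> (U m) (U m)) + l2inner \<Omega> (u T) (V M)"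
    by (intro arg_cong2[where f = "(+)"] sum.cong refl step U)
  also have "\<dots> = E\<^sup>2"
    using bochner_norm_wgrad[of u U, OF uU] by (simp only: E(2) V(2) l2norm_sq)
  finally have energy: "A_form \<Omega> T u ?v = E\<^sup>2" .
  have f_part: "integral\<^sup>L (lebesgue_on {0<..<T}) (\<lambda>s. l2inner \<Omega> (f s) (?v s))
      \<le> E * (sqrt T * bochner_norm {0<..<T} (l2norm \<Omega>) f)"
    using L2_time_bound[OF f T_pos, of ?v E] vE vV by (simp add: abs_le_iff)
  have q_part: "pairing {a..b} \<omega> q ?v \<le> E * total_variation {a..b} \<omega> q"
  proof -
    have Ltwo_\<omega>: "w \<in> Ltwo \<omega>" if "w \<in> Ltwo \<Omega>" for w :: "'a \<Rightarrow> real"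
      using Ltwo_mono[OF \<omega>(2) \<omega>(1) _ that] open_dom by (simp add: lebesgue_openin)
    have "\<exists>K\<ge>0. \<forall>s r. h1norm \<Omega> (\<lambda>x. ?v s x - ?v r x) \<le> K * \<bar>s - r\<bar>"
      by (rule interp_Lipschitz[where W = Vh])
         (auto intro: Vh_lincomb V h1norm_lincomb[OF open_dom bounded_dom] Vh_Hone)
    then obtain K where K: "0 \<le> K" "\<And>s r. h1norm \<Omega> (\<lambda>x. ?v s x - ?v r x) \<le> K * \<bar>s - r\<bar>" by blast
    have lip: "l2norm \<omega> (\<lambda>x. ?v s x - ?v r x) \<le> K * \<bar>s - r\<bar>" if "s \<in> {a..b}" "r \<in> {a..b}" for s r
    proof -
      have "?v s \<in> Ltwo \<Omega>" "?v r \<in> Ltwo \<Omega>" using that ab by (auto intro!: vV)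
      then have "l2norm \<omega> (\<lambda>x. ?v s x - ?v r x) \<le> l2norm \<Omega> (\<lambda>x. ?v s x - ?v r x)"
        using \<omega> open_dom by (intro l2norm_mono_set Ltwo_diff) (auto simp: lebesgue_openin)
      also have "\<dots> \<le> h1norm \<Omega> (\<lambda>x. ?v s x - ?v r x)"
        unfolding h1norm_def by (rule real_le_rsqrt) simp
      finally show ?thesis using K(2)[of s r] by linarith
    qed
    have "\<bar>pairing {a..b} \<omega> q ?v\<bar> \<le> E * total_variation {a..b} \<omega> q"
    proof (rule pairing_bound[OF q K(1) _ lip _ E(1)])
      fix s assume "s \<in> {a..b}"
      then have s: "0 \<le> s" "s \<le> T" using ab by auto
      show "?v s \<in> Ltwo \<omega>" by (intro Ltwo_\<omega> vV s)
      have "l2norm \<omega> (?v s) \<le> l2norm \<Omega> (?v s)"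
        using \<omega> open_dom vV[OF s] by (intro l2norm_mono_set) (auto simp: lebesgue_openin)
      then show "l2norm \<omega> (?v s) \<le> E" using vE[OF s] by linarith
    qed
    then show ?thesis by linarith
  qed
  have u0_part: "l2inner \<Omega> u0 (?v 0) \<le> E * l2norm \<Omega> u0"
  proof -
    have "l2inner \<Omega> u0 (?v 0) \<le> l2norm \<Omega> u0 * l2norm \<Omega> (?v 0)"
      using l2inner_Cauchy_Schwarz[OF u0 vV[of 0]] T_pos by simp
    also have "\<dots> \<le> l2norm \<Omega> u0 * E" using vE[of 0] T_pos by (intro mult_left_mono) auto
    finally show ?thesis by (simp add: mult.commute)
  qed
  define R where "R = sqrt T * bochner_norm {0<..<T} (l2norm \<Omega>) f + total_variation {a..b} \<omega> q + l2norm \<Omega> u0"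
  have "E\<^sup>2 \<le> E * R"
    using eq[OF interp_in_P_space[of V, OF V(1)]] energy f_part q_part u0_part
    unfolding R_def distrib_left by linarith
  moreover have "0 \<le> R"
  proof -
    have "0 \<le> bochner_norm {0<..<T} (l2norm \<Omega>) f" by (simp add: bochner_norm_def)
    then show ?thesis unfolding R_def using total_variation_nonneg[OF q] T_pos by simp
  qed
  ultimately have "E \<le> R" using E(1) by (cases "E = 0") (auto simp: power2_eq_square)
  moreover have "?G \<le> E" unfolding E_def by (rule real_le_rsqrt) simp
  moreover have "l2norm \<Omega> (u T) \<le> E" unfolding E_def by (rule real_le_rsqrt) simp
  ultimately have "?G + l2norm \<Omega> (u T) \<le> 2 * R" by linarith
  then show ?thesis unfolding R_def .
qed

end

theorem lemma5p4:
  fixes \<Omega> \<omega> :: "'a::euclidean_space set"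
    and T a b :: real
    and H :: "real set"
    and \<T> :: "real \<Rightarrow> 'a set set"
  assumes "DIM('a) = 2 \<or> DIM('a) = 3"
    and "convex_polyhedral_domain \<Omega>"
    and "0 < T"
    and "polygonal_domain \<omega>" and "\<omega> \<subseteq> \<Omega>"
    and "0 < a" and "a < b" and "b < T"
    and "mesh_family \<Omega> \<omega> H \<T>"
  shows "\<exists>C>0. \<forall>\<tau>. \<forall>h\<in>H. \<forall>M t. time_grid T a b M t \<tau> \<longrightarrow>
    (\<forall>f\<in>bochner_L2 {0<..<T} (Ltwo \<Omega>) (l2norm \<Omega>). \<forall>u0\<in>Ltwo \<Omega>. \<forall>q\<in>vector_measures {a..b} \<omega>.
     \<forall>u\<in>Y_space \<Omega> T (\<T> h) M t.
       (\<forall>v\<in>P_space \<Omega> T (\<T> h) M t.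
          A_form \<Omega> T u v = integral\<^sup>L (lebesgue_on {0<..<T}) (\<lambda>s. l2inner \<Omega> (f s) (v s))
            + pairing {a..b} \<omega> q v + l2inner \<Omega> u0 (v 0)) \<longrightarrow>
       bochner_norm {0<..<T} (l2norm \<Omega>) (\<lambda>s. wgrad \<Omega> (u s)) + l2norm \<Omega> (u T)
         \<le> C * (bochner_norm {0<..<T} (l2norm \<Omega>) f + total_variation {a..b} \<omega> q + l2norm \<Omega> u0))"
proof (intro exI[of _ "2 * (1 + sqrt T)"] conjI allI ballI impI)
  show "0 < 2 * (1 + sqrt T)" using assms(3) by (simp add: add_pos_nonneg)
  fix \<tau> h M t f u0 q u
  assume h: "h \<in> H" and grid: "time_grid T a b M t \<tau>"
    and f: "f \<in> bochner_L2 {0<..<T} (Ltwo \<Omega>) (l2norm \<Omega>)" and u0: "u0 \<in> Ltwo \<Omega>"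
    and q: "q \<in> vector_measures {a..b} \<omega>" and u: "u \<in> Y_space \<Omega> T (\<T> h) M t"
    and eq: "\<forall>v\<in>P_space \<Omega> T (\<T> h) M t.
          A_form \<Omega> T u v = integral\<^sup>L (lebesgue_on {0<..<T}) (\<lambda>s. l2inner \<Omega> (f s) (v s))
            + pairing {a..b} \<omega> q v + l2inner \<Omega> u0 (v 0)"
  interpret space_time_mesh \<Omega> h "\<T> h" T M t
  proof
    show "open \<Omega>" using assms(2) by (simp add: convex_polyhedral_domain_def)
    have "bounded (closure \<Omega>)" using assms(2) by (auto simp: convex_polyhedral_domain_def polytope_imp_bounded)
    then show "bounded \<Omega>" using closure_subset bounded_subset by blast
    show "mesh_of \<Omega> h (\<T> h)" using assms(9) h by (simp add: mesh_family_def)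
  qed (use grid in \<open>auto simp: time_grid_def\<close>)
  have \<omega>: "\<omega> \<in> sets lebesgue" using assms(4) by (auto simp: polygonal_domain_def lebesgue_openin)
  let ?F = "bochner_norm {0<..<T} (l2norm \<Omega>) f" and ?Q = "total_variation {a..b} \<omega> q" and ?u0 = "l2norm \<Omega> u0"
  have "bochner_norm {0<..<T} (l2norm \<Omega>) (\<lambda>s. wgrad \<Omega> (u s)) + l2norm \<Omega> (u T) \<le> 2 * (sqrt T * ?F + ?Q + ?u0)"
    using eq by (intro discrete_stability[OF f u0 q assms(6,8) \<omega> assms(5) u]) blast
  also have "\<dots> \<le> 2 * ((1 + sqrt T) * (?F + ?Q + ?u0))"
  proof -
    have "0 \<le> ?F" "0 \<le> ?Q" "0 \<le> ?u0" "0 \<le> sqrt T"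
      using total_variation_nonneg[OF q] assms(3) by (simp_all add: bochner_norm_def)
    moreover from this have "0 \<le> sqrt T * ?Q" "0 \<le> sqrt T * ?u0" by simp_all
    ultimately show ?thesis unfolding distrib_left distrib_right by linarith
  qed
  finally show "bochner_norm {0<..<T} (l2norm \<Omega>) (\<lambda>s. wgrad \<Omega> (u s)) + l2norm \<Omega> (u T)
      \<le> 2 * (1 + sqrt T) * (?F + ?Q + ?u0)" by (simp only: mult.assoc)
qed

end
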